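(* Let $R$ be a Banach ring. Given an infinite filtering ordered set $I$ and a functor $I\to\mathrm{Ban}_R$, $i\mapsto W_i$, such that the corresponding object $W=\text{``}\mathrm{colim}"_{i\in I}W_i$ is nuclear in $\mathrm{Ind}(\mathrm{Ban}_R)$, there is a filtered category $K$ with the same cardinality of objects and morphisms as $I$, a functor $K\to\mathrm{Ban}_R$, $k\mapsto L_k$, with corresponding object $L=\text{``}\mathrm{colim}"_{k\in K}L_k$, and an isomorphism $W\cong L$, such that each Banach module $L_k$ is a countable product in $\mathrm{Ban}^{\le1}_R$ of weighted copies of $R$ and the transition morphisms of the system $\{L_k\}$ (attached to non-identity morphisms of $K$) are nuclear.
   Context: A Banach ring $R$ is a commutative unital ring with a function $|\cdot|:R\to\mathbb{R}_{\ge0}$ with $|a|=0$ iff $a=0$, $|a+b|\le|a|+|b|$, $|ab|\le C|a||b|$ for some constant $C>0$, complete for $|a-b|$. A Banach $R$-module is an $R$-module $M$ with a complete norm satisfying the triangle inequality and $\|am\|\le C|a|\|m\|$ for some $C>0$. $\mathrm{Ban}_R$ is the category of Banach $R$-modules and bounded $R$-linear maps; it is closed symmetric monoidal with the completed projective tensor product $\widehat{\otimes}_R$, unit $R$, and internal Hom $\underline{\mathrm{Hom}}(V,W)$ the bounded maps with operator norm; $V^\vee=\underline{\mathrm{Hom}}(V,R)$. $\mathrm{Ban}^{\le1}_R$ has the same objects and the morphisms of norm $\le1$; its product is $\prod^{\le1}_{s}V_s=\{(v_s):\sup_s\|v_s\|<\infty\}$ with norm $\sup_s\|v_s\|$. For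 $r>0$, the weighted copy $R_r$ of $R$ is $R$ with norm $r|\cdot|$. A morphism $V\to W$ in $\mathrm{Ban}_R$ is nuclear if it lies in the image of $\mathrm{Hom}(R,V^\vee\widehat{\otimes}_RW)\to\mathrm{Hom}(R,\underline{\mathrm{Hom}}(V,W))=\mathrm{Hom}(V,W)$. $\mathrm{Ind}(\mathrm{Ban}_R)$ is the ind-completion, with $\widehat{\otimes}_R$ and $\underline{\mathrm{Hom}}$ extended by $(\text{``}\mathrm{colim}"E_i)\widehat{\otimes}_R(\text{``}\mathrm{colim}"F_j)=\text{``}\mathrm{colim}"_{(i,j)}E_i\widehat{\otimes}_RF_j$ and $\underline{\mathrm{Hom}}(\text{``}\mathrm{colim}"E_i,\text{``}\mathrm{colim}"F_j)=\lim_i\text{``}\mathrm{colim}"_j\underline{\mathrm{Hom}}(E_i,F_j)$. An object $V$ of $\mathrm{Ind}(\mathrm{Ban}_R)$ is nuclear if for every $X\in\mathrm{Ban}_R$ the natural morphism $X^\vee\widehat{\otimes}_RV\to\underline{\mathrm{Hom}}(X,V)$ is an isomorphism. *)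

theory Defs
  imports
    "HOL-Analysis.Analysis"
    "HOL-Algebra.Free_Abelian_Groups"
    "HOL-Algebra.Module"
    "HOL-Library.Equipollence"
begin

section \<open>Banach rings and Banach modules\<close>

record 'a nring = "'a ring" +
  rnorm :: "'a \<Rightarrow> real"

record ('a, 'b) nmodule = "('a, 'b) module" +
  mnorm :: "'b \<Rightarrow> real"

definition ncauchy :: "('b, 'c) ring_scheme \<Rightarrow> ('b \<Rightarrow> real) \<Rightarrow> (nat \<Rightarrow> 'b) \<Rightarrow> bool" where
  "ncauchy G N x \<longleftrightarrow> range x \<subseteq> carrier G \<and>
     (\<forall>e>0. \<exists>n0. \<forall>m\<ge>n0. \<forall>n\<ge>n0. N (x m \<ominus>\<^bsub>G\<^esub> x n) < e)"

definition ncomplete :: "('b, 'c) ring_scheme \<Rightarrow> ('b \<Rightarrow> real) \<Rightarrow> bool" where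
  "ncomplete G N \<longleftrightarrow>
     (\<forall>x. ncauchy G N x \<longrightarrow> (\<exists>l\<in>carrier G. (\<lambda>n. N (x n \<ominus>\<^bsub>G\<^esub> l)) \<longlonglongrightarrow> 0))"

definition is_norm :: "('b, 'c) ring_scheme \<Rightarrow> ('b \<Rightarrow> real) \<Rightarrow> bool" where
  "is_norm G N \<longleftrightarrow>
     (\<forall>x\<in>carrier G. 0 \<le> N x \<and> (N x = 0 \<longleftrightarrow> x = \<zero>\<^bsub>G\<^esub>)) \<and>
     (\<forall>x\<in>carrier G. \<forall>y\<in>carrier G. N (x \<oplus>\<^bsub>G\<^esub> y) \<le> N x + N y)"

definition banach_ring :: "('a, 'x) nring_scheme \<Rightarrow> bool" where
  "banach_ring R \<longleftrightarrow> cring R \<and> is_norm R (rnorm R) \<and>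
     (\<exists>C>0. \<forall>a\<in>carrier R. \<forall>b\<in>carrier R. rnorm R (a \<otimes>\<^bsub>R\<^esub> b) \<le> C * rnorm R a * rnorm R b) \<and>
     ncomplete R (rnorm R)"

definition banach_module ::
  "('a, 'x) nring_scheme \<Rightarrow> ('a, 'b, 'y) nmodule_scheme \<Rightarrow> bool" where
  "banach_module R M \<longleftrightarrow> module R M \<and> is_norm M (mnorm M) \<and>
     (\<exists>C>0. \<forall>a\<in>carrier R. \<forall>m\<in>carrier M. mnorm M (a \<odot>\<^bsub>M\<^esub> m) \<le> C * rnorm R a * mnorm M m) \<and>
     ncomplete M (mnorm M)"

text \<open>Modules inherit the fields \<open>mult\<close> and \<open>one\<close> from the ring record.  They carry no
  meaning for a module and are left \<open>undefined\<close> in the constructions below.\<close>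

definition self_module :: "('a, 'x) nring_scheme \<Rightarrow> ('a, 'a) nmodule" where
  "self_module R = \<lparr>carrier = carrier R, mult = undefined, one = undefined,
     zero = \<zero>\<^bsub>R\<^esub>, add = add R, smult = mult R, mnorm = rnorm R\<rparr>"

definition weighted_copy :: "('a, 'x) nring_scheme \<Rightarrow> real \<Rightarrow> ('a, 'a) nmodule" where
  "weighted_copy R c = (self_module R)\<lparr>mnorm := (\<lambda>a. c * rnorm R a)\<rparr>"

text \<open>The product in the category of Banach modules and maps of norm at most \<open>1\<close>.  The
  inserted \<open>0\<close> only matters for \<open>S = {}\<close>, as the supremum of the empty set of reals is
  unspecified.\<close>

definition prod_le1 :: "'s set \<Rightarrow> ('s \<Rightarrow> ('a, 'b) nmodule) \<Rightarrow> ('a, 's \<Rightarrow> 'b) nmodule" where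
  "prod_le1 S V = \<lparr>
     carrier = {v \<in> (\<Pi>\<^sub>E s\<in>S. carrier (V s)). bdd_above ((\<lambda>s. mnorm (V s) (v s)) ` S)},
     mult = undefined, one = undefined,
     zero = (\<lambda>s\<in>S. \<zero>\<^bsub>V s\<^esub>),
     add = (\<lambda>v w. \<lambda>s\<in>S. v s \<oplus>\<^bsub>V s\<^esub> w s),
     smult = (\<lambda>a v. \<lambda>s\<in>S. a \<odot>\<^bsub>V s\<^esub> v s),
     mnorm = (\<lambda>v. Sup (insert 0 ((\<lambda>s. mnorm (V s) (v s)) ` S)))\<rparr>"

section \<open>Bounded linear maps and the internal Hom\<close>

text \<open>Maps are extensional (\<open>undefined\<close> off the carrier), so that equality of morphisms is
  equality of functions, composition is \<^const>\<open>compose\<close> and identities are restrictions.\<close>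

definition ban_hom :: "('a, 'x) nring_scheme \<Rightarrow> ('a, 'b, 'y) nmodule_scheme \<Rightarrow>
    ('a, 'c, 'z) nmodule_scheme \<Rightarrow> ('b \<Rightarrow> 'c) set" where
  "ban_hom R V W = {f \<in> carrier V \<rightarrow>\<^sub>E carrier W.
     (\<forall>x\<in>carrier V. \<forall>y\<in>carrier V. f (x \<oplus>\<^bsub>V\<^esub> y) = f x \<oplus>\<^bsub>W\<^esub> f y) \<and>
     (\<forall>a\<in>carrier R. \<forall>x\<in>carrier V. f (a \<odot>\<^bsub>V\<^esub> x) = a \<odot>\<^bsub>W\<^esub> f x) \<and>
     (\<exists>C. \<forall>x\<in>carrier V. mnorm W (f x) \<le> C * mnorm V x)}"

definition op_norm :: "('a, 'b, 'y) nmodule_scheme \<Rightarrow> ('a, 'c, 'z) nmodule_scheme \<Rightarrow>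
    ('b \<Rightarrow> 'c) \<Rightarrow> real" where
  "op_norm V W f = Inf {C. 0 \<le> C \<and> (\<forall>x\<in>carrier V. mnorm W (f x) \<le> C * mnorm V x)}"

definition ihom :: "('a, 'x) nring_scheme \<Rightarrow> ('a, 'b) nmodule \<Rightarrow> ('a, 'c) nmodule \<Rightarrow>
    ('a, 'b \<Rightarrow> 'c) nmodule" where
  "ihom R V W = \<lparr>carrier = ban_hom R V W, mult = undefined, one = undefined,
     zero = (\<lambda>x\<in>carrier V. \<zero>\<^bsub>W\<^esub>),
     add = (\<lambda>f g. \<lambda>x\<in>carrier V. f x \<oplus>\<^bsub>W\<^esub> g x),
     smult = (\<lambda>a f. \<lambda>x\<in>carrier V. a \<odot>\<^bsub>W\<^esub> f x),
     mnorm = op_norm V W\<rparr>"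

definition dual :: "('a, 'x) nring_scheme \<Rightarrow> ('a, 'b) nmodule \<Rightarrow> ('a, 'b \<Rightarrow> 'a) nmodule" where
  "dual R V = ihom R V (self_module R)"

section \<open>The completed projective tensor product\<close>

subsection \<open>The algebraic tensor product with the projective seminorm\<close>

definition tensor_free :: "('a, 'b) nmodule \<Rightarrow> ('a, 'c) nmodule \<Rightarrow> ('b \<times> 'c \<Rightarrow>\<^sub>0 int) monoid" where
  "tensor_free V W = free_Abelian_group (carrier V \<times> carrier W)"

definition tensor_rels :: "('a, 'x) nring_scheme \<Rightarrow> ('a, 'b) nmodule \<Rightarrow> ('a, 'c) nmodule \<Rightarrow>
    ('b \<times> 'c \<Rightarrow>\<^sub>0 int) set" where
  "tensor_rels R V W =
     {frag_of (v \<oplus>\<^bsub>V\<^esub> v', w) - frag_of (v, w) - frag_of (v', w) | v v' w.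
        v \<in> carrier V \<and> v' \<in> carrier V \<and> w \<in> carrier W} \<union>
     {frag_of (v, w \<oplus>\<^bsub>W\<^esub> w') - frag_of (v, w) - frag_of (v, w') | v w w'.
        v \<in> carrier V \<and> w \<in> carrier W \<and> w' \<in> carrier W} \<union>
     {frag_of (a \<odot>\<^bsub>V\<^esub> v, w) - frag_of (v, a \<odot>\<^bsub>W\<^esub> w) | a v w.
        a \<in> carrier R \<and> v \<in> carrier V \<and> w \<in> carrier W}"

definition tensor_sub :: "('a, 'x) nring_scheme \<Rightarrow> ('a, 'b) nmodule \<Rightarrow> ('a, 'c) nmodule \<Rightarrow>
    ('b \<times> 'c \<Rightarrow>\<^sub>0 int) set" where
  "tensor_sub R V W = generate (tensor_free V W) (tensor_rels R V W)"

definition tensor_class :: "('a, 'x) nring_scheme \<Rightarrow> ('a, 'b) nmodule \<Rightarrow> ('a, 'c) nmodule \<Rightarrow>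
    ('b \<times> 'c \<Rightarrow>\<^sub>0 int) \<Rightarrow> ('b \<times> 'c \<Rightarrow>\<^sub>0 int) set" where
  "tensor_class R V W z = tensor_sub R V W #>\<^bsub>tensor_free V W\<^esub> z"

text \<open>The seminorm is the infimum of \<open>\<Sum>\<^sub>i \<parallel>v\<^sub>i\<parallel> \<parallel>w\<^sub>i\<parallel>\<close> over all ways of writing the element as a
  finite sum \<open>\<Sum>\<^sub>i v\<^sub>i \<otimes> w\<^sub>i\<close>; the list \<open>ps\<close> is the list of the pairs \<open>(v\<^sub>i, w\<^sub>i)\<close>.\<close>

definition alg_tensor :: "('a, 'x) nring_scheme \<Rightarrow> ('a, 'b) nmodule \<Rightarrow> ('a, 'c) nmodule \<Rightarrow>
    ('a, ('b \<times> 'c \<Rightarrow>\<^sub>0 int) set) nmodule" where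
  "alg_tensor R V W = (let Q = tensor_free V W Mod tensor_sub R V W in
    \<lparr>carrier = carrier Q, mult = undefined, one = undefined,
     zero = \<one>\<^bsub>Q\<^esub>, add = mult Q,
     smult = (\<lambda>a c. \<Union>z\<in>c. tensor_class R V W (frag_extend (\<lambda>(v, w). frag_of (a \<odot>\<^bsub>V\<^esub> v, w)) z)),
     mnorm = (\<lambda>c. Inf {(\<Sum>(v, w)\<leftarrow>ps. mnorm V v * mnorm W w) | ps.
        set ps \<subseteq> carrier V \<times> carrier W \<and> tensor_class R V W (\<Sum>p\<leftarrow>ps. frag_of p) = c})\<rparr>)"

subsection \<open>Separated completion of a seminormed module\<close>

definition null_rel :: "('a, 'b) nmodule \<Rightarrow> ((nat \<Rightarrow> 'b) \<times> (nat \<Rightarrow> 'b)) set" where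
  "null_rel M = {(x, y). ncauchy M (mnorm M) x \<and> ncauchy M (mnorm M) y \<and>
     (\<lambda>n. mnorm M (x n \<ominus>\<^bsub>M\<^esub> y n)) \<longlonglongrightarrow> 0}"

definition completion :: "('a, 'b) nmodule \<Rightarrow> ('a, (nat \<Rightarrow> 'b) set) nmodule" where
  "completion M = \<lparr>carrier = {x. ncauchy M (mnorm M) x} // null_rel M,
     mult = undefined, one = undefined,
     zero = null_rel M `` {\<lambda>n. \<zero>\<^bsub>M\<^esub>},
     add = (\<lambda>A B. \<Union>x\<in>A. \<Union>y\<in>B. null_rel M `` {\<lambda>n. x n \<oplus>\<^bsub>M\<^esub> y n}),
     smult = (\<lambda>a A. \<Union>x\<in>A. null_rel M `` {\<lambda>n. a \<odot>\<^bsub>M\<^esub> x n}),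
     mnorm = (\<lambda>A. THE l. \<forall>x\<in>A. (\<lambda>n. mnorm M (x n)) \<longlonglongrightarrow> l)\<rparr>"

definition ctensor :: "('a, 'x) nring_scheme \<Rightarrow> ('a, 'b) nmodule \<Rightarrow> ('a, 'c) nmodule \<Rightarrow>
    ('a, (nat \<Rightarrow> ('b \<times> 'c \<Rightarrow>\<^sub>0 int) set) set) nmodule" where
  "ctensor R V W = completion (alg_tensor R V W)"

definition pure_tensor :: "('a, 'x) nring_scheme \<Rightarrow> ('a, 'b) nmodule \<Rightarrow> ('a, 'c) nmodule \<Rightarrow>
    'b \<Rightarrow> 'c \<Rightarrow> (nat \<Rightarrow> ('b \<times> 'c \<Rightarrow>\<^sub>0 int) set) set" where
  "pure_tensor R V W v w =
     null_rel (alg_tensor R V W) `` {\<lambda>n. tensor_class R V W (frag_of (v, w))}"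

text \<open>For a bounded \<open>R\<close>-bilinear map \<open>\<beta>\<close> into a Banach module \<open>Z\<close>, the unique bounded linear map with
  \<open>v \<otimes> w \<mapsto> \<beta> v w\<close>; it is only used for such \<open>\<beta>\<close>.\<close>

definition tensor_lift :: "('a, 'x) nring_scheme \<Rightarrow> ('a, 'b) nmodule \<Rightarrow> ('a, 'c) nmodule \<Rightarrow>
    ('a, 'd) nmodule \<Rightarrow> ('b \<Rightarrow> 'c \<Rightarrow> 'd) \<Rightarrow> (nat \<Rightarrow> ('b \<times> 'c \<Rightarrow>\<^sub>0 int) set) set \<Rightarrow> 'd" where
  "tensor_lift R V W Z \<beta> = (THE h. h \<in> ban_hom R (ctensor R V W) Z \<and>
     (\<forall>v\<in>carrier V. \<forall>w\<in>carrier W. h (pure_tensor R V W v w) = \<beta> v w))"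

section \<open>Nuclear morphisms\<close>

definition canonical_map :: "('a, 'x) nring_scheme \<Rightarrow> ('a, 'b) nmodule \<Rightarrow> ('a, 'c) nmodule \<Rightarrow>
    (nat \<Rightarrow> (('b \<Rightarrow> 'a) \<times> 'c \<Rightarrow>\<^sub>0 int) set) set \<Rightarrow> 'b \<Rightarrow> 'c" where
  "canonical_map R V W = tensor_lift R (dual R V) W (ihom R V W)
     (\<lambda>\<phi> w. \<lambda>x\<in>carrier V. \<phi> x \<odot>\<^bsub>W\<^esub> w)"

text \<open>The identification \<open>Hom(R, Hom(V, W)) = Hom(V, W)\<close> is evaluation at \<open>1\<close>.\<close>

definition nuclear_morphism :: "('a, 'x) nring_scheme \<Rightarrow> ('a, 'b) nmodule \<Rightarrow> ('a, 'c) nmodule \<Rightarrow>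
    ('b \<Rightarrow> 'c) \<Rightarrow> bool" where
  "nuclear_morphism R V W f \<longleftrightarrow> f \<in> ban_hom R V W \<and>
     (\<exists>u\<in>ban_hom R (self_module R) (ctensor R (dual R V) W).
        f = compose (carrier R) (canonical_map R V W) u \<one>\<^bsub>R\<^esub>)"

section \<open>Filtered categories and ind-objects\<close>

record ('o, 'm) category =
  Ob :: "'o set"
  Arr :: "'m set"
  src :: "'m \<Rightarrow> 'o"
  tgt :: "'m \<Rightarrow> 'o"
  ident :: "'o \<Rightarrow> 'm"
  cmp :: "'m \<Rightarrow> 'm \<Rightarrow> 'm"

definition is_category :: "('o, 'm) category \<Rightarrow> bool" where
  "is_category K \<longleftrightarrow>
     (\<forall>f\<in>Arr K. src K f \<in> Ob K \<and> tgt K f \<in> Ob K) \<and>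
     (\<forall>k\<in>Ob K. ident K k \<in> Arr K \<and> src K (ident K k) = k \<and> tgt K (ident K k) = k) \<and>
     (\<forall>f\<in>Arr K. \<forall>g\<in>Arr K. tgt K f = src K g \<longrightarrow>
        cmp K g f \<in> Arr K \<and> src K (cmp K g f) = src K f \<and> tgt K (cmp K g f) = tgt K g) \<and>
     (\<forall>f\<in>Arr K. cmp K f (ident K (src K f)) = f \<and> cmp K (ident K (tgt K f)) f = f) \<and>
     (\<forall>f\<in>Arr K. \<forall>g\<in>Arr K. \<forall>h\<in>Arr K. tgt K f = src K g \<longrightarrow> tgt K g = src K h \<longrightarrow>
        cmp K h (cmp K g f) = cmp K (cmp K h g) f)"

definition filtered_category :: "('o, 'm) category \<Rightarrow> bool" where
  "filtered_category K \<longleftrightarrow> is_category K \<and> Ob K \<noteq> {} \<and>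
     (\<forall>i\<in>Ob K. \<forall>j\<in>Ob K. \<exists>f\<in>Arr K. \<exists>g\<in>Arr K. src K f = i \<and> src K g = j \<and> tgt K f = tgt K g) \<and>
     (\<forall>f\<in>Arr K. \<forall>g\<in>Arr K. src K f = src K g \<longrightarrow> tgt K f = tgt K g \<longrightarrow>
        (\<exists>h\<in>Arr K. src K h = tgt K f \<and> cmp K h f = cmp K h g))"

definition order_category :: "'i set \<Rightarrow> 'i rel \<Rightarrow> ('i, 'i \<times> 'i) category" where
  "order_category I r = \<lparr>Ob = I, Arr = r, src = fst, tgt = snd, ident = (\<lambda>i. (i, i)),
     cmp = (\<lambda>g f. (fst f, snd g))\<rparr>"

text \<open>A diagram of Banach modules stands for its formal colimit whenever its index category is
  filtered.\<close>

record ('a, 'b, 'o, 'm) diagram =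
  idx :: "('o, 'm) category"
  dob :: "'o \<Rightarrow> ('a, 'b) nmodule"
  dar :: "'m \<Rightarrow> 'b \<Rightarrow> 'b"

definition banach_functor :: "('a, 'x) nring_scheme \<Rightarrow> ('a, 'b, 'o, 'm) diagram \<Rightarrow> bool" where
  "banach_functor R V \<longleftrightarrow> is_category (idx V) \<and>
     (\<forall>k\<in>Ob (idx V). banach_module R (dob V k)) \<and>
     (\<forall>f\<in>Arr (idx V). dar V f \<in> ban_hom R (dob V (src (idx V) f)) (dob V (tgt (idx V) f))) \<and>
     (\<forall>k\<in>Ob (idx V). dar V (ident (idx V) k) = (\<lambda>x\<in>carrier (dob V k). x)) \<and>
     (\<forall>f\<in>Arr (idx V). \<forall>g\<in>Arr (idx V). tgt (idx V) f = src (idx V) g \<longrightarrow>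
        dar V (cmp (idx V) g f) =
          compose (carrier (dob V (src (idx V) f))) (dar V g) (dar V f))"

text \<open>For a Banach module \<open>E\<close>, the set \<open>colim\<^sub>j Hom(E, W\<^sub>j)\<close> is the quotient of the set of pairs
  \<open>(j, f : E \<rightarrow> W\<^sub>j)\<close> by \<^term>\<open>colim_rel R E W\<close>.\<close>

definition colim_rel :: "('a, 'x) nring_scheme \<Rightarrow> ('a, 'b) nmodule \<Rightarrow> ('a, 'c, 'o, 'm) diagram \<Rightarrow>
    (('o \<times> ('b \<Rightarrow> 'c)) \<times> ('o \<times> ('b \<Rightarrow> 'c))) set" where
  "colim_rel R E W = {((j, f), (j', f')).
     j \<in> Ob (idx W) \<and> f \<in> ban_hom R E (dob W j) \<and>
     j' \<in> Ob (idx W) \<and> f' \<in> ban_hom R E (dob W j') \<and>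
     (\<exists>u\<in>Arr (idx W). \<exists>u'\<in>Arr (idx W). src (idx W) u = j \<and> src (idx W) u' = j' \<and>
        tgt (idx W) u = tgt (idx W) u' \<and>
        compose (carrier E) (dar W u) f = compose (carrier E) (dar W u') f')}"

definition colim_hom :: "('a, 'x) nring_scheme \<Rightarrow> ('a, 'b) nmodule \<Rightarrow> ('a, 'c, 'o, 'm) diagram \<Rightarrow>
    ('o \<times> ('b \<Rightarrow> 'c)) set set" where
  "colim_hom R E W = (SIGMA j : Ob (idx W). ban_hom R E (dob W j)) // colim_rel R E W"

text \<open>\<open>Hom(V, W) = lim\<^sub>k colim\<^sub>j Hom(V\<^sub>k, W\<^sub>j)\<close>: compatible families of classes.\<close>

definition ind_hom :: "('a, 'x) nring_scheme \<Rightarrow> ('a, 'b, 'o, 'm) diagram \<Rightarrow>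
    ('a, 'c, 'p, 'n) diagram \<Rightarrow> ('o \<Rightarrow> ('p \<times> ('b \<Rightarrow> 'c)) set) set" where
  "ind_hom R V W = {\<phi> \<in> (\<Pi>\<^sub>E k\<in>Ob (idx V). colim_hom R (dob V k) W).
     \<forall>u\<in>Arr (idx V). \<forall>(j, f)\<in>\<phi> (tgt (idx V) u).
       (j, compose (carrier (dob V (src (idx V) u))) f (dar V u)) \<in> \<phi> (src (idx V) u)}"

definition ind_id :: "('a, 'x) nring_scheme \<Rightarrow> ('a, 'b, 'o, 'm) diagram \<Rightarrow>
    'o \<Rightarrow> ('o \<times> ('b \<Rightarrow> 'b)) set" where
  "ind_id R V = (\<lambda>k\<in>Ob (idx V). colim_rel R (dob V k) V `` {(k, \<lambda>x\<in>carrier (dob V k). x)})"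

definition ind_comp :: "('a, 'x) nring_scheme \<Rightarrow> ('a, 'b, 'o, 'm) diagram \<Rightarrow>
    ('a, 'd, 'q, 'l) diagram \<Rightarrow> ('p \<Rightarrow> ('q \<times> ('c \<Rightarrow> 'd)) set) \<Rightarrow>
    ('o \<Rightarrow> ('p \<times> ('b \<Rightarrow> 'c)) set) \<Rightarrow> 'o \<Rightarrow> ('q \<times> ('b \<Rightarrow> 'd)) set" where
  "ind_comp R V Z \<psi> \<phi> = (\<lambda>k\<in>Ob (idx V). \<Union>(j, f)\<in>\<phi> k. \<Union>(l, g)\<in>\<psi> j.
     colim_rel R (dob V k) Z `` {(l, compose (carrier (dob V k)) g f)})"

definition ind_iso :: "('a, 'x) nring_scheme \<Rightarrow> ('a, 'b, 'o, 'm) diagram \<Rightarrow>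
    ('a, 'c, 'p, 'n) diagram \<Rightarrow> ('o \<Rightarrow> ('p \<times> ('b \<Rightarrow> 'c)) set) \<Rightarrow> bool" where
  "ind_iso R V W \<phi> \<longleftrightarrow> \<phi> \<in> ind_hom R V W \<and>
     (\<exists>\<psi>\<in>ind_hom R W V. ind_comp R V V \<psi> \<phi> = ind_id R V \<and> ind_comp R W W \<phi> \<psi> = ind_id R W)"

section \<open>Nuclear ind-objects\<close>

definition tensor_diagram :: "('a, 'x) nring_scheme \<Rightarrow> ('a, 'e) nmodule \<Rightarrow>
    ('a, 'b, 'o, 'm) diagram \<Rightarrow>
    ('a, (nat \<Rightarrow> ('e \<times> 'b \<Rightarrow>\<^sub>0 int) set) set, 'o, 'm) diagram" where
  "tensor_diagram R E V = \<lparr>idx = idx V, dob = (\<lambda>k. ctensor R E (dob V k)),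
     dar = (\<lambda>u. let A = dob V (src (idx V) u); B = dob V (tgt (idx V) u) in
       tensor_lift R E A (ctensor R E B) (\<lambda>e v. pure_tensor R E B e (dar V u v)))\<rparr>"

definition hom_diagram :: "('a, 'x) nring_scheme \<Rightarrow> ('a, 'e) nmodule \<Rightarrow>
    ('a, 'b, 'o, 'm) diagram \<Rightarrow> ('a, 'e \<Rightarrow> 'b, 'o, 'm) diagram" where
  "hom_diagram R E V = \<lparr>idx = idx V, dob = (\<lambda>k. ihom R E (dob V k)),
     dar = (\<lambda>u. \<lambda>f\<in>ban_hom R E (dob V (src (idx V) u)). compose (carrier E) (dar V u) f)\<rparr>"

definition natural_morphism :: "('a, 'x) nring_scheme \<Rightarrow> ('a, 'e) nmodule \<Rightarrow>
    ('a, 'b, 'o, 'm) diagram \<Rightarrow>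
    'o \<Rightarrow> ('o \<times> ((nat \<Rightarrow> (('e \<Rightarrow> 'a) \<times> 'b \<Rightarrow>\<^sub>0 int) set) set \<Rightarrow> 'e \<Rightarrow> 'b)) set" where
  "natural_morphism R X V = (\<lambda>k\<in>Ob (idx V).
     colim_rel R (ctensor R (dual R X) (dob V k)) (hom_diagram R X V) ``
       {(k, canonical_map R X (dob V k))})"

text \<open>The carriers of the Banach modules \<open>X\<close> and those of the modules \<open>dob V k\<close> are arbitrary
  subsets of the same type, which plays the role of the universe in which the category of
  Banach modules is formed.\<close>

definition nuclear_ind :: "('a, 'x) nring_scheme \<Rightarrow> ('a, 'b, 'o, 'm) diagram \<Rightarrow> bool" where
  "nuclear_ind R V \<longleftrightarrow> (\<forall>X :: ('a, 'b) nmodule. banach_module R X \<longrightarrow>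
     ind_iso R (tensor_diagram R (dual R X) V) (hom_diagram R X V) (natural_morphism R X V))"

end

theory Submission
  imports Defs
begin

text \<open>
  Why the theorem holds.  A nuclear morphism \<open>f : V \<rightarrow> W\<close> is the same thing as a sum
  \<open>f x = \<Sum>\<^sub>k \<phi>\<^sub>k(x) w\<^sub>k\<close> with \<open>\<phi>\<^sub>k\<close> in the dual of \<open>V\<close>, \<open>w\<^sub>k\<close> in \<open>W\<close> and \<open>\<Sum>\<^sub>k \<parallel>\<phi>\<^sub>k\<parallel> \<parallel>w\<^sub>k\<parallel> < \<infinity>\<close>
  (\<open>canonical_map_nuclear_series\<close>, \<open>nuclear_series_imp_nuclear\<close>), because every element of a completed
  projective tensor product is an absolutely convergent series of pure tensors
  (\<open>series_expansion\<close>).  Such a morphism factors through a countable product \<open>L\<close> of weighted copies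
  of the ring, by \<open>x \<mapsto> (\<phi>\<^sub>k(x))\<^sub>k\<close> followed by \<open>(v\<^sub>k)\<^sub>k \<mapsto> \<Sum>\<^sub>k v\<^sub>k w\<^sub>k\<close>: with weights that are essentially
  \<open>1 / \<parallel>\<phi>\<^sub>k\<parallel>\<close> the first map has norm at most \<open>1\<close>, and the second one is again nuclear, as the \<open>k\<close>-th
  coordinate of \<open>L\<close> has norm at most about \<open>\<parallel>\<phi>\<^sub>k\<parallel>\<close> (\<open>nuclear_series_factor\<close>).

  If the ind-object \<open>W\<close> is nuclear, the inverse of the natural morphism for \<open>X = W\<^sub>i\<close>, applied to the
  identity of \<open>W\<^sub>i\<close>, gives a tensor in some \<open>W\<^sub>i\<^sup>\<or> \<otimes> W\<^sub>j\<close> which represents a transition map of \<open>W\<close>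
  at a later stage.  So for every \<open>i\<close> there is \<open>s i \<ge> i\<close> such that \<open>W\<^sub>i \<rightarrow> W\<^bsub>s i\<^esub>\<close> is nuclear
  (\<open>nuclear_ind_transition\<close>), and it factors as \<open>W\<^sub>i \<rightarrow> L\<^sub>i \<rightarrow> W\<^bsub>s i\<^esub>\<close>.

  The modules \<open>L\<^sub>i\<close> are then interleaved with the \<open>W\<^sub>i\<close>: for \<open>s i \<le> j\<close> put
  \<open>L\<^sub>i \<rightarrow> W\<^bsub>s i\<^esub> \<rightarrow> W\<^sub>j \<rightarrow> L\<^sub>j\<close>, which is nuclear because \<open>L\<^sub>i \<rightarrow> W\<^bsub>s i\<^esub>\<close> is.  The relation \<open>s i \<le> j\<close> is
  transitive, but it may hold for \<open>i = j\<close>, for instance when \<open>I\<close> has a largest element.  Therefore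
  the index category is the poset \<open>I \<times> \<nat>\<close>, transported to \<open>I\<close> along a bijection, in which \<open>(i, m)\<close>
  lies strictly below \<open>(j, n)\<close> iff \<open>s i \<le> j\<close> and \<open>m < n\<close>.  It is directed, and as \<open>I\<close> is infinite
  it has as many elements and arrows as \<open>I\<close>.  The maps \<open>W\<^sub>i \<rightarrow> L\<^sub>i\<close> and \<open>L\<^sub>i \<rightarrow> W\<^bsub>s i\<^esub>\<close> are
  representatives of mutually inverse morphisms of ind-objects (\<open>W_iso_L\<close>).
\<close>


section \<open>Seminormed modules\<close>

lemma null_seq_le:
  fixes f g :: "nat \<Rightarrow> real"
  assumes "\<And>n. 0 \<le> f n" "\<And>n. f n \<le> g n" "g \<longlonglongrightarrow> 0"
  shows "f \<longlonglongrightarrow> 0"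
  using assms by (intro tendsto_sandwich[OF _ _ tendsto_const assms(3)] always_eventually) auto

lemma (in abelian_group) minus_split:
  assumes "x \<in> carrier G" "y \<in> carrier G" "z \<in> carrier G"
  shows "x \<ominus> z = (x \<ominus> y) \<oplus> (y \<ominus> z)"
  using assms by (simp add: minus_eq a_assoc r_neg1)

lemma (in abelian_group) minus_add_distrib:
  assumes "a \<in> carrier G" "b \<in> carrier G" "c \<in> carrier G" "d \<in> carrier G"
  shows "(a \<oplus> b) \<ominus> (c \<oplus> d) = (a \<ominus> c) \<oplus> (b \<ominus> d)"
  using assms by (simp add: minus_eq minus_add a_ac)

lemma (in abelian_group) neg_minus:
  assumes "a \<in> carrier G" "b \<in> carrier G"
  shows "\<ominus> (a \<ominus> b) = b \<ominus> a"
  using assms by (simp add: minus_eq minus_add a_ac)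

lemma (in abelian_group) minus_add_cancel':
  assumes "a \<in> carrier G" "b \<in> carrier G"
  shows "(a \<ominus> b) \<oplus> b = a"
  using assms by (simp add: minus_eq a_assoc l_neg)

lemma (in module) smult_minus_distrib:
  assumes "a \<in> carrier R" "x \<in> carrier M" "y \<in> carrier M"
  shows "a \<odot>\<^bsub>M\<^esub> (x \<ominus>\<^bsub>M\<^esub> y) = a \<odot>\<^bsub>M\<^esub> x \<ominus>\<^bsub>M\<^esub> a \<odot>\<^bsub>M\<^esub> y"
  using assms by (simp add: M.minus_eq smult_r_distr smult_r_minus)

text \<open>The algebraic tensor product carries only a seminorm, so the basic limit arguments are made for
  seminormed modules over a Banach ring.  Neither for the ring nor for the module is
  \<open>\<parallel>-x\<parallel> = \<parallel>x\<parallel>\<close> part of the axioms; negation is bounded because it is multiplication by \<open>-1\<close>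
  (\<open>norm_neg_ex\<close>).\<close>

locale seminormed_module = module R M
  for R :: "('a, 'x) nring_scheme" (structure) and M :: "('a, 'b, 'y) nmodule_scheme" (structure) +
  assumes banach_ring: "banach_ring R"
    and norm_nonneg: "x \<in> carrier M \<Longrightarrow> 0 \<le> mnorm M x"
    and norm_zero: "mnorm M \<zero>\<^bsub>M\<^esub> = 0"
    and norm_triangle: "\<lbrakk>x \<in> carrier M; y \<in> carrier M\<rbrakk> \<Longrightarrow>
      mnorm M (x \<oplus>\<^bsub>M\<^esub> y) \<le> mnorm M x + mnorm M y"
    and norm_smult_ex: "\<exists>C>0. \<forall>a\<in>carrier R. \<forall>x\<in>carrier M.
      mnorm M (a \<odot>\<^bsub>M\<^esub> x) \<le> C * rnorm R a * mnorm M x"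

text \<open>Two sequences whose difference tends to \<open>0\<close>.  With a constant sequence on the right this is
  convergence.\<close>

definition asymp_eq :: "('a, 'b, 'y) nmodule_scheme \<Rightarrow> (nat \<Rightarrow> 'b) \<Rightarrow> (nat \<Rightarrow> 'b) \<Rightarrow> bool" where
  "asymp_eq M x y \<longleftrightarrow> (\<lambda>n. mnorm M (x n \<ominus>\<^bsub>M\<^esub> y n)) \<longlonglongrightarrow> 0"

context seminormed_module
begin

lemma rnorm_nonneg: "a \<in> carrier R \<Longrightarrow> 0 \<le> rnorm R a"
  using banach_ring by (auto simp: banach_ring_def is_norm_def)

lemma norm_neg_ex: "\<exists>K>0. \<forall>x\<in>carrier M. mnorm M (\<ominus>\<^bsub>M\<^esub> x) \<le> K * mnorm M x"
proof -
  obtain C where C: "C > 0" "\<And>a x. a \<in> carrier R \<Longrightarrow> x \<in> carrier M \<Longrightarrow>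
      mnorm M (a \<odot>\<^bsub>M\<^esub> x) \<le> C * rnorm R a * mnorm M x"
    using norm_smult_ex by blast
  have "mnorm M (\<ominus>\<^bsub>M\<^esub> x) \<le> (C * rnorm R (\<ominus> \<one>) + 1) * mnorm M x" if x: "x \<in> carrier M" for x
    using C(2)[of "\<ominus> \<one>" x] x norm_nonneg[OF x] by (simp add: smult_l_minus algebra_simps)
  moreover have "C * rnorm R (\<ominus> \<one>) + 1 > 0"
    using C(1) rnorm_nonneg[of "\<ominus> \<one>"] by (simp add: add_nonneg_pos)
  ultimately show ?thesis by blast
qed

lemma norm_minus_triangle:
  assumes "x \<in> carrier M" "y \<in> carrier M" "z \<in> carrier M"
  shows "mnorm M (x \<ominus>\<^bsub>M\<^esub> z) \<le> mnorm M (x \<ominus>\<^bsub>M\<^esub> y) + mnorm M (y \<ominus>\<^bsub>M\<^esub> z)"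
  using assms norm_triangle[of "x \<ominus>\<^bsub>M\<^esub> y" "y \<ominus>\<^bsub>M\<^esub> z"] M.minus_split[of x y z] by simp

lemma norm_le_minus:
  assumes "x \<in> carrier M" "y \<in> carrier M"
  shows "mnorm M x \<le> mnorm M (x \<ominus>\<^bsub>M\<^esub> y) + mnorm M y"
  using assms norm_triangle[of "x \<ominus>\<^bsub>M\<^esub> y" y] M.minus_add_cancel'[of x y] by simp

lemma norm_diff_abs:
  assumes "x \<in> carrier M" "y \<in> carrier M"
  shows "\<bar>mnorm M x - mnorm M y\<bar> \<le> mnorm M (x \<ominus>\<^bsub>M\<^esub> y) + mnorm M (y \<ominus>\<^bsub>M\<^esub> x)"
  using norm_le_minus[of x y] norm_le_minus[of y x] assms
    norm_nonneg[of "x \<ominus>\<^bsub>M\<^esub> y"] norm_nonneg[of "y \<ominus>\<^bsub>M\<^esub> x"] by simp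

lemma minus_self: "x \<in> carrier M \<Longrightarrow> mnorm M (x \<ominus>\<^bsub>M\<^esub> x) = 0"
  by (simp add: M.minus_eq M.r_neg norm_zero)

lemma asymp_eq_refl: "range x \<subseteq> carrier M \<Longrightarrow> asymp_eq M x x"
  by (simp add: asymp_eq_def minus_self image_subset_iff)

lemma asymp_eq_sym:
  assumes xy: "range x \<subseteq> carrier M" "range y \<subseteq> carrier M" and a: "asymp_eq M x y"
  shows "asymp_eq M y x"
proof -
  obtain K where K: "\<And>x. x \<in> carrier M \<Longrightarrow> mnorm M (\<ominus>\<^bsub>M\<^esub> x) \<le> K * mnorm M x"
    using norm_neg_ex by blast
  have "(\<lambda>n. K * mnorm M (x n \<ominus>\<^bsub>M\<^esub> y n)) \<longlonglongrightarrow> 0"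
    using tendsto_mult_right_zero[OF a[unfolded asymp_eq_def]] .
  then show ?thesis
    unfolding asymp_eq_def
  proof (rule null_seq_le[rotated 2])
    fix n
    have "x n \<in> carrier M" "y n \<in> carrier M" using xy by auto
    then show "0 \<le> mnorm M (y n \<ominus>\<^bsub>M\<^esub> x n)"
        "mnorm M (y n \<ominus>\<^bsub>M\<^esub> x n) \<le> K * mnorm M (x n \<ominus>\<^bsub>M\<^esub> y n)"
      using K[of "x n \<ominus>\<^bsub>M\<^esub> y n"] by (simp_all add: norm_nonneg M.neg_minus)
  qed
qed

lemma asymp_eq_trans:
  assumes "range x \<subseteq> carrier M" "range y \<subseteq> carrier M" "range z \<subseteq> carrier M"
    and "asymp_eq M x y" "asymp_eq M y z"
  shows "asymp_eq M x z"
  unfolding asymp_eq_def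
proof (rule null_seq_le)
  show "(\<lambda>n. mnorm M (x n \<ominus>\<^bsub>M\<^esub> y n) + mnorm M (y n \<ominus>\<^bsub>M\<^esub> z n)) \<longlonglongrightarrow> 0"
    using tendsto_add_zero assms(4,5) unfolding asymp_eq_def by blast
  fix n
  have "x n \<in> carrier M" "y n \<in> carrier M" "z n \<in> carrier M" using assms by auto
  then show "0 \<le> mnorm M (x n \<ominus>\<^bsub>M\<^esub> z n)"
    "mnorm M (x n \<ominus>\<^bsub>M\<^esub> z n) \<le> mnorm M (x n \<ominus>\<^bsub>M\<^esub> y n) + mnorm M (y n \<ominus>\<^bsub>M\<^esub> z n)"
    by (simp_all add: norm_nonneg norm_minus_triangle)
qed

lemma asymp_eq_add:
  assumes "range x \<subseteq> carrier M" "range y \<subseteq> carrier M" "range x' \<subseteq> carrier M" "range y' \<subseteq> carrier M"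
    and "asymp_eq M x x'" "asymp_eq M y y'"
  shows "asymp_eq M (\<lambda>n. x n \<oplus>\<^bsub>M\<^esub> y n) (\<lambda>n. x' n \<oplus>\<^bsub>M\<^esub> y' n)"
  unfolding asymp_eq_def
proof (rule null_seq_le)
  show "(\<lambda>n. mnorm M (x n \<ominus>\<^bsub>M\<^esub> x' n) + mnorm M (y n \<ominus>\<^bsub>M\<^esub> y' n)) \<longlonglongrightarrow> 0"
    using tendsto_add_zero assms(5,6) unfolding asymp_eq_def by blast
  fix n
  have c: "x n \<in> carrier M" "y n \<in> carrier M" "x' n \<in> carrier M" "y' n \<in> carrier M"
    using assms by auto
  show "0 \<le> mnorm M (x n \<oplus>\<^bsub>M\<^esub> y n \<ominus>\<^bsub>M\<^esub> (x' n \<oplus>\<^bsub>M\<^esub> y' n))"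
    using c by (simp add: norm_nonneg)
  show "mnorm M (x n \<oplus>\<^bsub>M\<^esub> y n \<ominus>\<^bsub>M\<^esub> (x' n \<oplus>\<^bsub>M\<^esub> y' n))
      \<le> mnorm M (x n \<ominus>\<^bsub>M\<^esub> x' n) + mnorm M (y n \<ominus>\<^bsub>M\<^esub> y' n)"
    using c by (simp add: M.minus_add_distrib norm_triangle)
qed

lemma asymp_eq_smult:
  assumes "range x \<subseteq> carrier M" "range y \<subseteq> carrier M" "a \<in> carrier R" "asymp_eq M x y"
  shows "asymp_eq M (\<lambda>n. a \<odot>\<^bsub>M\<^esub> x n) (\<lambda>n. a \<odot>\<^bsub>M\<^esub> y n)"
proof -
  obtain C where C: "C > 0" "\<And>a x. a \<in> carrier R \<Longrightarrow> x \<in> carrier M \<Longrightarrow>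
      mnorm M (a \<odot>\<^bsub>M\<^esub> x) \<le> C * rnorm R a * mnorm M x"
    using norm_smult_ex by blast
  show ?thesis
    unfolding asymp_eq_def
  proof (rule null_seq_le)
    show "(\<lambda>n. C * rnorm R a * mnorm M (x n \<ominus>\<^bsub>M\<^esub> y n)) \<longlonglongrightarrow> 0"
      using tendsto_mult_right_zero[OF assms(4)[unfolded asymp_eq_def]] .
    fix n
    have "x n \<in> carrier M" "y n \<in> carrier M" using assms by auto
    then show "0 \<le> mnorm M (a \<odot>\<^bsub>M\<^esub> x n \<ominus>\<^bsub>M\<^esub> a \<odot>\<^bsub>M\<^esub> y n)"
      "mnorm M (a \<odot>\<^bsub>M\<^esub> x n \<ominus>\<^bsub>M\<^esub> a \<odot>\<^bsub>M\<^esub> y n) \<le> C * rnorm R a * mnorm M (x n \<ominus>\<^bsub>M\<^esub> y n)"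
      using assms(3) C(2)[of a "x n \<ominus>\<^bsub>M\<^esub> y n"] by (simp_all add: norm_nonneg smult_minus_distrib)
  qed
qed

lemma asymp_eq_uniq_zero:
  assumes "a \<in> carrier M" "b \<in> carrier M" "asymp_eq M (\<lambda>_. a) (\<lambda>_. b)"
  shows "mnorm M (a \<ominus>\<^bsub>M\<^esub> b) = 0"
  using assms by (simp add: asymp_eq_def tendsto_const_iff)

lemma ncauchyD:
  assumes "ncauchy M (mnorm M) x" "e > 0"
  obtains n0 where "\<And>m n. m \<ge> n0 \<Longrightarrow> n \<ge> n0 \<Longrightarrow> mnorm M (x m \<ominus>\<^bsub>M\<^esub> x n) < e"
  using assms unfolding ncauchy_def by meson

lemma ncauchy_range: "ncauchy M (mnorm M) x \<Longrightarrow> range x \<subseteq> carrier M"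
  by (simp add: ncauchy_def)

lemma ncauchy_const: "a \<in> carrier M \<Longrightarrow> ncauchy M (mnorm M) (\<lambda>_. a)"
  by (auto simp: ncauchy_def minus_self)

lemma ncauchy_add:
  assumes "ncauchy M (mnorm M) x" "ncauchy M (mnorm M) y"
  shows "ncauchy M (mnorm M) (\<lambda>n. x n \<oplus>\<^bsub>M\<^esub> y n)"
  unfolding ncauchy_def
proof (intro conjI allI impI)
  have c: "x n \<in> carrier M" "y n \<in> carrier M" for n
    using assms[THEN ncauchy_range] by auto
  then show "range (\<lambda>n. x n \<oplus>\<^bsub>M\<^esub> y n) \<subseteq> carrier M" by auto
  fix e :: real assume "e > 0"
  then obtain n1 n2 where
    "\<And>m n. m \<ge> n1 \<Longrightarrow> n \<ge> n1 \<Longrightarrow> mnorm M (x m \<ominus>\<^bsub>M\<^esub> x n) < e / 2"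
    "\<And>m n. m \<ge> n2 \<Longrightarrow> n \<ge> n2 \<Longrightarrow> mnorm M (y m \<ominus>\<^bsub>M\<^esub> y n) < e / 2"
    using ncauchyD[OF assms(1), of "e/2"] ncauchyD[OF assms(2), of "e/2"] by (metis half_gt_zero)
  moreover have "mnorm M (x m \<oplus>\<^bsub>M\<^esub> y m \<ominus>\<^bsub>M\<^esub> (x n \<oplus>\<^bsub>M\<^esub> y n))
      \<le> mnorm M (x m \<ominus>\<^bsub>M\<^esub> x n) + mnorm M (y m \<ominus>\<^bsub>M\<^esub> y n)" for m n
    using c by (simp add: M.minus_add_distrib norm_triangle)
  ultimately have "mnorm M (x m \<oplus>\<^bsub>M\<^esub> y m \<ominus>\<^bsub>M\<^esub> (x n \<oplus>\<^bsub>M\<^esub> y n)) < e"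
    if "m \<ge> max n1 n2" "n \<ge> max n1 n2" for m n
    using that by (smt (verit) field_sum_of_halves max.bounded_iff)
  then show "\<exists>n0. \<forall>m\<ge>n0. \<forall>n\<ge>n0. mnorm M (x m \<oplus>\<^bsub>M\<^esub> y m \<ominus>\<^bsub>M\<^esub> (x n \<oplus>\<^bsub>M\<^esub> y n)) < e"
    by blast
qed

lemma ncauchy_smult:
  assumes "ncauchy M (mnorm M) x" "a \<in> carrier R"
  shows "ncauchy M (mnorm M) (\<lambda>n. a \<odot>\<^bsub>M\<^esub> x n)"
  unfolding ncauchy_def
proof (intro conjI allI impI)
  have c: "x n \<in> carrier M" for n
    using assms(1)[THEN ncauchy_range] by auto
  then show "range (\<lambda>n. a \<odot>\<^bsub>M\<^esub> x n) \<subseteq> carrier M" using assms(2) by auto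
  obtain C where C: "C > 0" "\<And>a x. a \<in> carrier R \<Longrightarrow> x \<in> carrier M \<Longrightarrow>
      mnorm M (a \<odot>\<^bsub>M\<^esub> x) \<le> C * rnorm R a * mnorm M x"
    using norm_smult_ex by blast
  define D where "D = C * rnorm R a + 1"
  have D: "D > 0" using C(1) rnorm_nonneg[OF assms(2)] by (simp add: D_def add_nonneg_pos)
  fix e :: real assume "e > 0"
  then obtain n0 where n0: "\<And>m n. m \<ge> n0 \<Longrightarrow> n \<ge> n0 \<Longrightarrow> mnorm M (x m \<ominus>\<^bsub>M\<^esub> x n) < e / D"
    using ncauchyD[OF assms(1), of "e/D"] D by (metis divide_pos_pos)
  have "mnorm M (a \<odot>\<^bsub>M\<^esub> x m \<ominus>\<^bsub>M\<^esub> a \<odot>\<^bsub>M\<^esub> x n) < e" if "m \<ge> n0" "n \<ge> n0" for m n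
  proof -
    have "mnorm M (a \<odot>\<^bsub>M\<^esub> x m \<ominus>\<^bsub>M\<^esub> a \<odot>\<^bsub>M\<^esub> x n) \<le> C * rnorm R a * mnorm M (x m \<ominus>\<^bsub>M\<^esub> x n)"
      using C(2)[OF assms(2), of "x m \<ominus>\<^bsub>M\<^esub> x n"] c assms(2) by (simp add: smult_minus_distrib)
    also have "\<dots> \<le> D * mnorm M (x m \<ominus>\<^bsub>M\<^esub> x n)"
      using norm_nonneg[of "x m \<ominus>\<^bsub>M\<^esub> x n"] c by (simp add: D_def mult_right_mono)
    also have "\<dots> < D * (e / D)" using n0[OF that] D by (intro mult_strict_left_mono)
    finally show ?thesis using D by simp
  qed
  then show "\<exists>n0. \<forall>m\<ge>n0. \<forall>n\<ge>n0. mnorm M (a \<odot>\<^bsub>M\<^esub> x m \<ominus>\<^bsub>M\<^esub> a \<odot>\<^bsub>M\<^esub> x n) < e"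
    by blast
qed

lemma ncauchy_subseq:
  assumes "ncauchy M (mnorm M) x" "strict_mono r"
  shows "ncauchy M (mnorm M) (x \<circ> r)" "asymp_eq M (x \<circ> r) x"
proof -
  have c: "x n \<in> carrier M" for n
    using assms(1)[THEN ncauchy_range] by auto
  have r: "r n \<ge> n" for n using assms(2) by (rule seq_suble)
  show "ncauchy M (mnorm M) (x \<circ> r)"
    unfolding ncauchy_def
  proof (intro conjI allI impI)
    show "range (x \<circ> r) \<subseteq> carrier M" using c by auto
    fix e :: real assume "e > 0"
    then obtain n0 where "\<And>m n. m \<ge> n0 \<Longrightarrow> n \<ge> n0 \<Longrightarrow> mnorm M (x m \<ominus>\<^bsub>M\<^esub> x n) < e"
      using ncauchyD[OF assms(1)] by metis
    then show "\<exists>n0. \<forall>m\<ge>n0. \<forall>n\<ge>n0. mnorm M ((x \<circ> r) m \<ominus>\<^bsub>M\<^esub> (x \<circ> r) n) < e"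
      using r by (metis comp_apply order_trans)
  qed
  show "asymp_eq M (x \<circ> r) x"
    unfolding asymp_eq_def LIMSEQ_iff
  proof (intro allI impI)
    fix e :: real assume "e > 0"
    then obtain n0 where "\<And>m n. m \<ge> n0 \<Longrightarrow> n \<ge> n0 \<Longrightarrow> mnorm M (x m \<ominus>\<^bsub>M\<^esub> x n) < e"
      using ncauchyD[OF assms(1)] by metis
    then show "\<exists>no. \<forall>n\<ge>no. norm (mnorm M ((x \<circ> r) n \<ominus>\<^bsub>M\<^esub> x n) - 0) < e"
      using r c norm_nonneg by (intro exI[of _ n0]) (simp, meson M.minus_closed abs_of_nonneg order_trans)
  qed
qed

lemma asymp_eq_norm_diff:
  assumes x: "range x \<subseteq> carrier M" and y: "range y \<subseteq> carrier M" and xy: "asymp_eq M x y"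
  shows "(\<lambda>n. mnorm M (x n) - mnorm M (y n)) \<longlonglongrightarrow> 0"
proof -
  have yx: "asymp_eq M y x" by (rule asymp_eq_sym[OF x y xy])
  have "(\<lambda>n. \<bar>mnorm M (x n) - mnorm M (y n)\<bar>) \<longlonglongrightarrow> 0"
  proof (rule null_seq_le)
    show "(\<lambda>n. mnorm M (x n \<ominus>\<^bsub>M\<^esub> y n) + mnorm M (y n \<ominus>\<^bsub>M\<^esub> x n)) \<longlonglongrightarrow> 0"
      using tendsto_add_zero xy yx unfolding asymp_eq_def by blast
    show "\<bar>mnorm M (x n) - mnorm M (y n)\<bar> \<le> mnorm M (x n \<ominus>\<^bsub>M\<^esub> y n) + mnorm M (y n \<ominus>\<^bsub>M\<^esub> x n)" for n
      using x y by (intro norm_diff_abs) auto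
  qed auto
  then show ?thesis by (simp add: tendsto_rabs_zero_iff)
qed

lemma asymp_eq_norm_tendsto:
  assumes "range x \<subseteq> carrier M" "range y \<subseteq> carrier M" "asymp_eq M x y" "(\<lambda>n. mnorm M (y n)) \<longlonglongrightarrow> l"
  shows "(\<lambda>n. mnorm M (x n)) \<longlonglongrightarrow> l"
  using tendsto_add[OF asymp_eq_norm_diff[OF assms(1-3)] assms(4)] by simp

lemma ncauchy_norm_convergent:
  assumes x: "ncauchy M (mnorm M) x"
  shows "convergent (\<lambda>n. mnorm M (x n))"
proof -
  have c: "x n \<in> carrier M" for n using x[THEN ncauchy_range] by auto
  have "Cauchy (\<lambda>n. mnorm M (x n))"
  proof (rule metric_CauchyI)
    fix e :: real assume "e > 0"
    then obtain n0 where n0: "\<And>m n. m \<ge> n0 \<Longrightarrow> n \<ge> n0 \<Longrightarrow> mnorm M (x m \<ominus>\<^bsub>M\<^esub> x n) < e / 2"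
      using ncauchyD[OF x, of "e/2"] by auto
    have "dist (mnorm M (x m)) (mnorm M (x n)) < e" if "m \<ge> n0" "n \<ge> n0" for m n
      using norm_diff_abs[OF c c, of m n] n0[OF that] n0[OF that(2,1)] by (simp add: dist_real_def)
    then show "\<exists>M'. \<forall>m\<ge>M'. \<forall>n\<ge>M'. dist (mnorm M (x m)) (mnorm M (x n)) < e" by blast
  qed
  then show ?thesis by (simp add: Cauchy_convergent_iff)
qed

end

section \<open>Banach modules and convergent series\<close>

locale banach_mod = seminormed_module +
  assumes banach_module: "banach_module R M"

lemma banach_modI:
  assumes "banach_ring R" "banach_module R M"
  shows "banach_mod R M"
proof -
  interpret module R M using assms(2) by (simp add: banach_module_def)
  show ?thesis
    using assms by unfold_locales (auto simp: banach_module_def is_norm_def)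
qed

text \<open>The partial sum of the first \<open>n\<close> terms of a series.\<close>

fun psum :: "('b, 'c) ring_scheme \<Rightarrow> (nat \<Rightarrow> 'b) \<Rightarrow> nat \<Rightarrow> 'b" where
  "psum G y 0 = \<zero>\<^bsub>G\<^esub>"
| "psum G y (Suc n) = psum G y n \<oplus>\<^bsub>G\<^esub> y n"

lemma (in abelian_group) psum_closed: "(\<And>k. y k \<in> carrier G) \<Longrightarrow> psum G y n \<in> carrier G"
  by (induction n) auto

context seminormed_module
begin

lemma norm_psum_diff_le:
  assumes "\<And>k. y k \<in> carrier M" "\<And>k. mnorm M (y k) \<le> a k"
  shows "mnorm M (psum M y (n + d) \<ominus>\<^bsub>M\<^esub> psum M y n) \<le> (\<Sum>k<d. a (n + k))"
proof (induction d)
  case 0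
  then show ?case using assms(1) by (simp add: minus_self M.psum_closed)
next
  case (Suc d)
  have "psum M y (n + d) \<oplus>\<^bsub>M\<^esub> y (n + d) \<ominus>\<^bsub>M\<^esub> psum M y n
      = (psum M y (n + d) \<ominus>\<^bsub>M\<^esub> psum M y n) \<oplus>\<^bsub>M\<^esub> y (n + d)"
    using assms(1) M.psum_closed[of y] by (simp add: M.minus_eq M.a_ac)
  then show ?case
    using norm_triangle[of "psum M y (n + d) \<ominus>\<^bsub>M\<^esub> psum M y n" "y (n + d)"] assms(1)
      M.psum_closed[of y] Suc assms(2)[of "n+d"] by simp
qed

lemma ncauchy_psum:
  assumes y: "\<And>k. y k \<in> carrier M" and le: "\<And>k. mnorm M (y k) \<le> a k" and a: "summable a"
  shows "ncauchy M (mnorm M) (psum M y)"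
  unfolding ncauchy_def
proof (intro conjI allI impI)
  have c: "psum M y n \<in> carrier M" for n using y by (rule M.psum_closed)
  then show "range (psum M y) \<subseteq> carrier M" by auto
  have a0: "a k \<ge> 0" for k using le[of k] norm_nonneg[OF y, of k] by simp
  obtain K where K: "K > 0" "\<And>x. x \<in> carrier M \<Longrightarrow> mnorm M (\<ominus>\<^bsub>M\<^esub> x) \<le> K * mnorm M x"
    using norm_neg_ex by blast
  fix e :: real assume e: "e > 0"
  define e' where "e' = e / (1 + K)"
  have "e' * (1 + K) = e" using K(1) by (simp add: e'_def)
  then have e': "e' + K * e' = e" by (simp add: algebra_simps)
  have e'0: "e' > 0" using e K(1) by (simp add: e'_def)
  obtain n0 where n0: "\<And>n. n \<ge> n0 \<Longrightarrow> norm (suminf (\<lambda>i. a (i + n))) < e'"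
    using suminf_exist_split[OF e'0 a] by blast
  have up: "mnorm M (psum M y m \<ominus>\<^bsub>M\<^esub> psum M y n) < e'" if mn: "n \<ge> n0" "m \<ge> n" for m n
  proof -
    have "mnorm M (psum M y (n + (m - n)) \<ominus>\<^bsub>M\<^esub> psum M y n) \<le> (\<Sum>k<m-n. a (n + k))"
      by (rule norm_psum_diff_le[OF y le])
    also have "\<dots> = (\<Sum>k<m-n. a (k + n))" by (simp only: add.commute)
    also have "\<dots> \<le> suminf (\<lambda>i. a (i + n))"
      using a0 summable_ignore_initial_segment[OF a, of n] by (intro sum_le_suminf) simp_all
    also have "\<dots> < e'" using n0[OF mn(1)] by simp
    finally show ?thesis using mn by simp
  qed
  have "mnorm M (psum M y m \<ominus>\<^bsub>M\<^esub> psum M y n) < e" if mn: "n \<ge> n0" "m \<ge> n0" for m n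
  proof (cases "m \<ge> n")
    case True
    then show ?thesis using up[OF mn(1) True] e' e'0 mult_pos_pos[OF K(1) e'0] by linarith
  next
    case False
    have "mnorm M (psum M y m \<ominus>\<^bsub>M\<^esub> psum M y n) \<le> K * mnorm M (psum M y n \<ominus>\<^bsub>M\<^esub> psum M y m)"
      using K(2)[of "psum M y n \<ominus>\<^bsub>M\<^esub> psum M y m"] c by (simp add: M.neg_minus)
    also have "\<dots> \<le> K * e'" using up[OF mn(2), of n] False K(1) by simp
    finally show ?thesis using e' e'0 by linarith
  qed
  then show "\<exists>n0. \<forall>m\<ge>n0. \<forall>n\<ge>n0. mnorm M (psum M y m \<ominus>\<^bsub>M\<^esub> psum M y n) < e" by blast
qed

lemma ncauchy_fast_subseq:
  assumes x: "ncauchy M (mnorm M) x" and e: "\<And>k. e k > (0::real)"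
  obtains r where "strict_mono r" "\<And>k. mnorm M (x (r (Suc k)) \<ominus>\<^bsub>M\<^esub> x (r k)) < e k"
proof -
  have "\<exists>n0. \<forall>m\<ge>n0. \<forall>n\<ge>n0. mnorm M (x m \<ominus>\<^bsub>M\<^esub> x n) < e k" for k
    using x e[of k] by (simp add: ncauchy_def)
  then have "\<exists>b. \<forall>k. \<forall>m\<ge>b k. \<forall>n\<ge>b k. mnorm M (x m \<ominus>\<^bsub>M\<^esub> x n) < e k"
    by (intro choice) blast
  then obtain b where b: "\<And>k m n. m \<ge> b k \<Longrightarrow> n \<ge> b k \<Longrightarrow> mnorm M (x m \<ominus>\<^bsub>M\<^esub> x n) < e k"
    by blast
  define r where "r k = (\<Sum>i\<le>k. b i + 1)" for k
  have r: "strict_mono r" by (rule strict_monoI_Suc) (simp add: r_def)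
  have rb: "r k \<ge> b k" for k
    using member_le_sum[of k "{..k}" "\<lambda>i. b i + 1"] by (simp add: r_def)
  moreover have "r (Suc k) \<ge> r k" for k using r by (simp add: strict_mono_leD)
  ultimately have "r (Suc k) \<ge> b k" for k by (meson order_trans)
  then show ?thesis using that[OF r] b rb by blast
qed

end

context banach_mod
begin

lemma norm_eq_zero: "x \<in> carrier M \<Longrightarrow> mnorm M x = 0 \<Longrightarrow> x = \<zero>\<^bsub>M\<^esub>"
  using banach_module by (auto simp: banach_module_def is_norm_def)

lemma complete:
  assumes "ncauchy M (mnorm M) x"
  obtains l where "l \<in> carrier M" "asymp_eq M x (\<lambda>_. l)"
proof -
  have "\<exists>l\<in>carrier M. asymp_eq M x (\<lambda>_. l)"
    using banach_module assms unfolding banach_module_def ncomplete_def asymp_eq_def by blast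
  then show ?thesis using that by blast
qed

lemma limit_unique:
  assumes "range x \<subseteq> carrier M" "a \<in> carrier M" "b \<in> carrier M"
    and "asymp_eq M x (\<lambda>_. a)" "asymp_eq M x (\<lambda>_. b)"
  shows "a = b"
proof -
  have "asymp_eq M (\<lambda>_. a) (\<lambda>_. b)"
    by (rule asymp_eq_trans[OF _ assms(1) _ asymp_eq_sym[OF assms(1) _ assms(4)] assms(5)])
      (use assms(2,3) in auto)
  then have "a \<ominus>\<^bsub>M\<^esub> b = \<zero>\<^bsub>M\<^esub>"
    using assms(2,3) by (intro norm_eq_zero asymp_eq_uniq_zero) auto
  then show ?thesis
    using M.minus_add_cancel'[of a b] assms(2,3) by simp
qed

lemma norm_limit_le:
  assumes "range x \<subseteq> carrier M" "a \<in> carrier M" "asymp_eq M x (\<lambda>_. a)"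
    and "\<And>n. n \<ge> n0 \<Longrightarrow> mnorm M (x n) \<le> B n" "B \<longlonglongrightarrow> b"
  shows "mnorm M a \<le> b"
proof -
  have "(\<lambda>n. mnorm M (x n)) \<longlonglongrightarrow> mnorm M a"
    by (rule asymp_eq_norm_tendsto[OF assms(1) _ assms(3)]) (use assms(2) in auto)
  then show ?thesis
    by (rule LIMSEQ_le[OF _ assms(5)]) (use assms(4) in auto)
qed

end

section \<open>Banach modules of functions\<close>

text \<open>A common setting for the internal Hom and for weighted products: a module \<open>F\<close> of functions on
  \<open>T\<close> with values in a Banach module \<open>Z\<close> and pointwise operations, consisting of the functions
  with a property \<open>Q\<close> that are bounded by a multiple of a weight, the norm being the least such
  multiple.  If \<open>Q\<close> is stable under the operations and under pointwise limits, then \<open>F\<close> is a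
  Banach module (\<open>banach_module_F\<close>).  For the internal Hom, \<open>Q\<close> is linearity and the weight of a
  vector is its norm; for a product of copies of the ring with weights \<open>c s\<close>, \<open>Q\<close> is trivial and
  the weight of the index \<open>s\<close> is \<open>1 / c s\<close>.\<close>

locale function_module = Z: banach_mod R Z
  for R :: "('a, 'x) nring_scheme" (structure) and Z :: "('a, 'b, 'y) nmodule_scheme" +
  fixes T :: "'t set" and weight :: "'t \<Rightarrow> real" and Q :: "('t \<Rightarrow> 'b) \<Rightarrow> bool"
    and F :: "('a, 't \<Rightarrow> 'b) nmodule"
  assumes weight_nonneg: "t \<in> T \<Longrightarrow> 0 \<le> weight t"
    and carrier_F: "carrier F = {f \<in> T \<rightarrow>\<^sub>E carrier Z. Q f \<and>
      (\<exists>B. \<forall>t\<in>T. mnorm Z (f t) \<le> B * weight t)}"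
    and zero_F: "\<zero>\<^bsub>F\<^esub> = (\<lambda>t\<in>T. \<zero>\<^bsub>Z\<^esub>)"
    and add_F: "f \<oplus>\<^bsub>F\<^esub> g = (\<lambda>t\<in>T. f t \<oplus>\<^bsub>Z\<^esub> g t)"
    and smult_F: "a \<odot>\<^bsub>F\<^esub> f = (\<lambda>t\<in>T. a \<odot>\<^bsub>Z\<^esub> f t)"
    and norm_F: "f \<in> carrier F \<Longrightarrow> mnorm F f \<le> B \<longleftrightarrow>
      0 \<le> B \<and> (\<forall>t\<in>T. mnorm Z (f t) \<le> B * weight t)"
    and Q_zero: "Q (\<lambda>t\<in>T. \<zero>\<^bsub>Z\<^esub>)"
    and Q_add: "\<lbrakk>f \<in> T \<rightarrow>\<^sub>E carrier Z; g \<in> T \<rightarrow>\<^sub>E carrier Z; Q f; Q g\<rbrakk> \<Longrightarrow>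
      Q (\<lambda>t\<in>T. f t \<oplus>\<^bsub>Z\<^esub> g t)"
    and Q_smult: "\<lbrakk>a \<in> carrier R; f \<in> T \<rightarrow>\<^sub>E carrier Z; Q f\<rbrakk> \<Longrightarrow> Q (\<lambda>t\<in>T. a \<odot>\<^bsub>Z\<^esub> f t)"
    and Q_limit: "\<lbrakk>\<And>n. fs n \<in> T \<rightarrow>\<^sub>E carrier Z; \<And>n. Q (fs n); g \<in> T \<rightarrow>\<^sub>E carrier Z;
      \<And>t. t \<in> T \<Longrightarrow> asymp_eq Z (\<lambda>n. fs n t) (\<lambda>_. g t)\<rbrakk> \<Longrightarrow> Q g"
begin

lemma F_memI:
  assumes "f \<in> T \<rightarrow>\<^sub>E carrier Z" "Q f" "\<And>t. t \<in> T \<Longrightarrow> mnorm Z (f t) \<le> B * weight t"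
  shows "f \<in> carrier F"
  unfolding carrier_F using assms by blast

lemma F_memD: "f \<in> carrier F \<Longrightarrow> f \<in> T \<rightarrow>\<^sub>E carrier Z" "f \<in> carrier F \<Longrightarrow> Q f"
  unfolding carrier_F by blast+

lemma app_closed: "f \<in> carrier F \<Longrightarrow> t \<in> T \<Longrightarrow> f t \<in> carrier Z"
  using F_memD(1)[of f] by (rule PiE_mem)

lemma norm_F_app: "f \<in> carrier F \<Longrightarrow> t \<in> T \<Longrightarrow> mnorm Z (f t) \<le> mnorm F f * weight t"
  using norm_F[of f "mnorm F f"] by simp

lemma norm_F_nonneg: "f \<in> carrier F \<Longrightarrow> 0 \<le> mnorm F f"
  using norm_F[of f "mnorm F f"] by simp

lemma fun_eqI: "f \<in> carrier F \<Longrightarrow> g \<in> carrier F \<Longrightarrow> (\<And>t. t \<in> T \<Longrightarrow> f t = g t) \<Longrightarrow> f = g"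
  by (rule PiE_ext[OF F_memD(1) F_memD(1)])

lemma zero_closed_F: "(\<lambda>t\<in>T. \<zero>\<^bsub>Z\<^esub>) \<in> carrier F"
  by (rule F_memI[OF _ Q_zero, of 0]) (simp_all add: Z.norm_zero)

lemma add_closed_F:
  assumes "f \<in> carrier F" "g \<in> carrier F" shows "(\<lambda>t\<in>T. f t \<oplus>\<^bsub>Z\<^esub> g t) \<in> carrier F"
proof -
  have "mnorm Z (f t \<oplus>\<^bsub>Z\<^esub> g t) \<le> (mnorm F f + mnorm F g) * weight t" if "t \<in> T" for t
    using Z.norm_triangle[OF app_closed app_closed, OF assms(1) that assms(2) that]
      norm_F_app[OF assms(1) that] norm_F_app[OF assms(2) that]
    by (simp add: algebra_simps)
  then show ?thesis
    using Q_add[OF F_memD(1)[OF assms(1)] F_memD(1)[OF assms(2)] F_memD(2)[OF assms(1)]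
        F_memD(2)[OF assms(2)]]
    by (intro F_memI[where B = "mnorm F f + mnorm F g"]) (simp_all add: assms app_closed)
qed

lemma smult_bound_F:
  "\<exists>C>0. \<forall>a\<in>carrier R. \<forall>f\<in>carrier F. \<forall>t\<in>T.
    mnorm Z (a \<odot>\<^bsub>Z\<^esub> f t) \<le> C * rnorm R a * mnorm F f * weight t"
proof -
  obtain C where C: "C > 0" "\<And>a x. a \<in> carrier R \<Longrightarrow> x \<in> carrier Z \<Longrightarrow>
      mnorm Z (a \<odot>\<^bsub>Z\<^esub> x) \<le> C * rnorm R a * mnorm Z x"
    using Z.norm_smult_ex by blast
  show ?thesis
  proof (intro exI[of _ C] conjI C(1) ballI)
    fix a f t assume a: "a \<in> carrier R" and f: "f \<in> carrier F" and t: "t \<in> T"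
    have "mnorm Z (a \<odot>\<^bsub>Z\<^esub> f t) \<le> C * rnorm R a * mnorm Z (f t)"
      using C(2)[OF a] app_closed[OF f t] .
    also have "\<dots> \<le> C * rnorm R a * (mnorm F f * weight t)"
      using C(1) Z.rnorm_nonneg[OF a] norm_F_app[OF f t] by (intro mult_left_mono) auto
    finally show "mnorm Z (a \<odot>\<^bsub>Z\<^esub> f t) \<le> C * rnorm R a * mnorm F f * weight t"
      by (simp add: mult.assoc)
  qed
qed

lemma smult_closed_F:
  assumes "a \<in> carrier R" "f \<in> carrier F" shows "(\<lambda>t\<in>T. a \<odot>\<^bsub>Z\<^esub> f t) \<in> carrier F"
proof -
  obtain C where C: "C > 0" "\<And>a f t. \<lbrakk>a \<in> carrier R; f \<in> carrier F; t \<in> T\<rbrakk> \<Longrightarrow>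
    mnorm Z (a \<odot>\<^bsub>Z\<^esub> f t) \<le> C * rnorm R a * mnorm F f * weight t"
    using smult_bound_F by blast
  then show ?thesis
    using Q_smult[OF assms(1) F_memD(1)[OF assms(2)] F_memD(2)[OF assms(2)]]
    by (intro F_memI[where B = "C * rnorm R a * mnorm F f"]) (simp_all add: assms app_closed)
qed

lemma abelian_group_F: "abelian_group F"
proof (rule abelian_groupI)
  show "x \<oplus>\<^bsub>F\<^esub> y \<in> carrier F" if "x \<in> carrier F" "y \<in> carrier F" for x y
    using that by (simp add: add_F add_closed_F)
  show "\<zero>\<^bsub>F\<^esub> \<in> carrier F" by (simp add: zero_F zero_closed_F)
  show "\<exists>y\<in>carrier F. y \<oplus>\<^bsub>F\<^esub> x = \<zero>\<^bsub>F\<^esub>" if x: "x \<in> carrier F" for x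
  proof (rule bexI)
    show "(\<lambda>t\<in>T. (\<ominus> \<one>) \<odot>\<^bsub>Z\<^esub> x t) \<in> carrier F" using x by (simp add: smult_closed_F)
    show "(\<lambda>t\<in>T. (\<ominus> \<one>) \<odot>\<^bsub>Z\<^esub> x t) \<oplus>\<^bsub>F\<^esub> x = \<zero>\<^bsub>F\<^esub>"
      using x by (auto simp: add_F zero_F Z.smult_l_minus app_closed Z.M.l_neg intro!: restrict_ext)
  qed
  show "\<zero>\<^bsub>F\<^esub> \<oplus>\<^bsub>F\<^esub> x = x" if "x \<in> carrier F" for x
    using that add_closed_F[OF zero_closed_F that]
    by (intro fun_eqI) (simp_all add: add_F zero_F app_closed)
qed (auto simp: add_F add_closed_F app_closed Z.M.a_ac intro!: restrict_ext)

lemma module_F: "module R F"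
proof (rule moduleI)
  show "cring R" by (rule Z.is_cring)
  show "abelian_group F" by (rule abelian_group_F)
  show "\<one> \<odot>\<^bsub>F\<^esub> x = x" if "x \<in> carrier F" for x
    using that smult_closed_F[of \<one> x] by (intro fun_eqI) (auto simp: smult_F app_closed)
qed (auto simp: smult_F add_F smult_closed_F app_closed Z.smult_l_distr Z.smult_r_distr
    Z.smult_assoc1 intro!: restrict_ext)

lemma minus_F:
  assumes "f \<in> carrier F" "g \<in> carrier F"
  shows "f \<ominus>\<^bsub>F\<^esub> g = (\<lambda>t\<in>T. f t \<ominus>\<^bsub>Z\<^esub> g t)"
proof -
  interpret F: module R F by (rule module_F)
  have "\<ominus>\<^bsub>F\<^esub> g = (\<ominus> \<one>) \<odot>\<^bsub>F\<^esub> g"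
    using assms by (simp add: F.smult_l_minus)
  then show ?thesis
    using assms by (auto simp: F.minus_eq Z.M.minus_eq add_F smult_F app_closed Z.smult_l_minus
        intro!: restrict_ext)
qed

lemma is_norm_F: "is_norm F (mnorm F)"
  unfolding is_norm_def
proof (intro conjI ballI)
  fix f assume f: "f \<in> carrier F"
  show "0 \<le> mnorm F f" using f by (rule norm_F_nonneg)
  show "mnorm F f = 0 \<longleftrightarrow> f = \<zero>\<^bsub>F\<^esub>"
  proof
    assume 0: "mnorm F f = 0"
    have "f t = \<zero>\<^bsub>Z\<^esub>" if t: "t \<in> T" for t
      using norm_F_app[OF f t] 0 Z.norm_nonneg[OF app_closed[OF f t]]
      by (intro Z.norm_eq_zero app_closed[OF f t]) simp
    then show "f = \<zero>\<^bsub>F\<^esub>" using f by (intro fun_eqI) (auto simp: zero_F zero_closed_F)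
  next
    assume "f = \<zero>\<^bsub>F\<^esub>"
    then have "mnorm F f \<le> 0" using norm_F[OF f, of 0] by (simp add: zero_F Z.norm_zero)
    then show "mnorm F f = 0" using norm_F_nonneg[OF f] by simp
  qed
next
  fix f g assume fg: "f \<in> carrier F" "g \<in> carrier F"
  have "mnorm Z (f t \<oplus>\<^bsub>Z\<^esub> g t) \<le> (mnorm F f + mnorm F g) * weight t" if "t \<in> T" for t
    using Z.norm_triangle[OF app_closed app_closed, OF fg(1) that fg(2) that]
      norm_F_app[OF fg(1) that] norm_F_app[OF fg(2) that]
    by (simp add: algebra_simps)
  then show "mnorm F (f \<oplus>\<^bsub>F\<^esub> g) \<le> mnorm F f + mnorm F g"
    using fg by (simp add: add_F norm_F add_closed_F norm_F_nonneg)
qed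

lemma ncomplete_F: "ncomplete F (mnorm F)"
  unfolding ncomplete_def
proof (intro allI impI)
  interpret F: module R F by (rule module_F)
  fix f assume cau: "ncauchy F (mnorm F) f"
  have f: "f n \<in> carrier F" for n using cau by (auto simp: ncauchy_def)
  have ft: "f n t \<in> carrier Z" if "t \<in> T" for n t using app_closed[OF f that] .
  have bound: "mnorm Z (f m t \<ominus>\<^bsub>Z\<^esub> f n t) \<le> mnorm F (f m \<ominus>\<^bsub>F\<^esub> f n) * weight t" if "t \<in> T" for m n t
    using norm_F_app[OF F.minus_closed[OF f f] that, of m n] that by (simp add: minus_F[OF f f])
  have ptcau: "ncauchy Z (mnorm Z) (\<lambda>n. f n t)" if t: "t \<in> T" for t
    unfolding ncauchy_def
  proof (intro conjI allI impI)
    show "range (\<lambda>n. f n t) \<subseteq> carrier Z" using ft[OF t] by auto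
    fix e :: real assume "e > 0"
    then have e': "e / (1 + weight t) > 0" using weight_nonneg[OF t] by simp
    then obtain n0 where n0: "\<And>m n. m \<ge> n0 \<Longrightarrow> n \<ge> n0 \<Longrightarrow> mnorm F (f m \<ominus>\<^bsub>F\<^esub> f n) < e / (1 + weight t)"
      using cau unfolding ncauchy_def by meson
    have "mnorm Z (f m t \<ominus>\<^bsub>Z\<^esub> f n t) < e" if "m \<ge> n0" "n \<ge> n0" for m n
    proof -
      have "mnorm Z (f m t \<ominus>\<^bsub>Z\<^esub> f n t) \<le> e / (1 + weight t) * weight t"
        using bound[OF t, of m n] n0[OF that] weight_nonneg[OF t]
        by (smt (verit) mult_right_mono)
      also have "\<dots> < e" using \<open>e > 0\<close> weight_nonneg[OF t] by (simp add: field_simps)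
      finally show ?thesis .
    qed
    then show "\<exists>n0. \<forall>m\<ge>n0. \<forall>n\<ge>n0. mnorm Z (f m t \<ominus>\<^bsub>Z\<^esub> f n t) < e" by blast
  qed
  have "\<exists>l. l \<in> carrier Z \<and> asymp_eq Z (\<lambda>n. f n t) (\<lambda>_. l)" if "t \<in> T" for t
    using Z.complete[OF ptcau[OF that]] by blast
  then obtain l where l: "\<And>t. t \<in> T \<Longrightarrow> l t \<in> carrier Z"
      "\<And>t. t \<in> T \<Longrightarrow> asymp_eq Z (\<lambda>n. f n t) (\<lambda>_. l t)" by metis
  define g where "g = (\<lambda>t\<in>T. l t)"
  have g: "g \<in> T \<rightarrow>\<^sub>E carrier Z" using l by (auto simp: g_def)
  have Qg: "Q g"
    by (rule Q_limit[of f]) (use f g l in \<open>simp_all add: F_memD g_def\<close>)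
  \<comment> \<open>The Cauchy estimate passes to the limit with a bound proportional to the weight, uniformly in \<open>t\<close>.\<close>
  have unif: "mnorm Z (f n t \<ominus>\<^bsub>Z\<^esub> g t) \<le> e * weight t"
    if n0: "\<And>m n. m \<ge> n0 \<Longrightarrow> n \<ge> n0 \<Longrightarrow> mnorm F (f m \<ominus>\<^bsub>F\<^esub> f n) < e" and n: "n \<ge> n0" and t: "t \<in> T"
    for n n0 e t
  proof -
    have "asymp_eq Z (\<lambda>m. f n t \<ominus>\<^bsub>Z\<^esub> f m t) (\<lambda>_. f n t \<ominus>\<^bsub>Z\<^esub> g t)"
    proof -
      have "asymp_eq Z (\<lambda>m. (\<ominus> \<one>) \<odot>\<^bsub>Z\<^esub> f m t) (\<lambda>_. (\<ominus> \<one>) \<odot>\<^bsub>Z\<^esub> g t)"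
        using l t ft by (intro Z.asymp_eq_smult) (auto simp: g_def)
      then have "asymp_eq Z (\<lambda>m. f n t \<oplus>\<^bsub>Z\<^esub> (\<ominus> \<one>) \<odot>\<^bsub>Z\<^esub> f m t) (\<lambda>_. f n t \<oplus>\<^bsub>Z\<^esub> (\<ominus> \<one>) \<odot>\<^bsub>Z\<^esub> g t)"
        using l t ft by (intro Z.asymp_eq_add Z.asymp_eq_refl) (auto simp: g_def)
      then show ?thesis
        using l t ft by (simp add: g_def Z.smult_l_minus Z.M.minus_eq)
    qed
    then show ?thesis
    proof (rule Z.norm_limit_le[rotated 2])
      show "mnorm Z (f n t \<ominus>\<^bsub>Z\<^esub> f m t) \<le> e * weight t" if "m \<ge> n0" for m
        using bound[OF t, of n m] n0[OF n that] weight_nonneg[OF t]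
        by (smt (verit) mult_right_mono)
    qed (use ft[OF t] l t in \<open>auto simp: g_def\<close>)
  qed
  obtain n1 where n1: "\<And>m n. m \<ge> n1 \<Longrightarrow> n \<ge> n1 \<Longrightarrow> mnorm F (f m \<ominus>\<^bsub>F\<^esub> f n) < 1"
    using cau unfolding ncauchy_def by (meson zero_less_one)
  obtain K where K: "K > 0" "\<And>x. x \<in> carrier Z \<Longrightarrow> mnorm Z (\<ominus>\<^bsub>Z\<^esub> x) \<le> K * mnorm Z x"
    using Z.norm_neg_ex by blast
  have "mnorm Z (g t) \<le> (K + mnorm F (f n1)) * weight t" if t: "t \<in> T" for t
  proof -
    have "mnorm Z (g t) \<le> mnorm Z (g t \<ominus>\<^bsub>Z\<^esub> f n1 t) + mnorm Z (f n1 t)"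
      using ft[OF t] g t by (intro Z.norm_le_minus) auto
    moreover have "mnorm Z (g t \<ominus>\<^bsub>Z\<^esub> f n1 t) \<le> K * mnorm Z (f n1 t \<ominus>\<^bsub>Z\<^esub> g t)"
      using K(2)[of "f n1 t \<ominus>\<^bsub>Z\<^esub> g t"] ft[OF t] g t by (auto simp: Z.M.neg_minus PiE_iff)
    moreover have "K * mnorm Z (f n1 t \<ominus>\<^bsub>Z\<^esub> g t) \<le> K * (1 * weight t)"
      using unif[of n1 1 n1 t, OF n1] t K(1) by (intro mult_left_mono) auto
    ultimately show ?thesis using norm_F_app[OF f t, of n1] by (simp add: algebra_simps)
  qed
  then have gF: "g \<in> carrier F" using g Qg by (intro F_memI)
  show "\<exists>l\<in>carrier F. (\<lambda>n. mnorm F (f n \<ominus>\<^bsub>F\<^esub> l)) \<longlonglongrightarrow> 0"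
  proof (rule bexI[OF _ gF], unfold LIMSEQ_iff, intro allI impI)
    fix e :: real assume e: "e > 0"
    then obtain n0 where n0: "\<And>m n. m \<ge> n0 \<Longrightarrow> n \<ge> n0 \<Longrightarrow> mnorm F (f m \<ominus>\<^bsub>F\<^esub> f n) < e / 2"
      using cau unfolding ncauchy_def by (meson half_gt_zero)
    have "mnorm F (f n \<ominus>\<^bsub>F\<^esub> g) \<le> e / 2" if "n \<ge> n0" for n
      using unif[OF n0 that] e norm_F[OF F.minus_closed[OF f[of n] gF], of "e / 2"]
      by (simp add: minus_F[OF f gF])
    then show "\<exists>no. \<forall>n\<ge>no. norm (mnorm F (f n \<ominus>\<^bsub>F\<^esub> g) - 0) < e"
      using e norm_F_nonneg[OF F.minus_closed[OF f gF]] by (intro exI[of _ n0]) fastforce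
  qed
qed

theorem banach_module_F: "banach_module R F"
  unfolding banach_module_def
proof (intro conjI module_F is_norm_F ncomplete_F)
  obtain C where C: "C > 0" "\<And>a f t. \<lbrakk>a \<in> carrier R; f \<in> carrier F; t \<in> T\<rbrakk> \<Longrightarrow>
    mnorm Z (a \<odot>\<^bsub>Z\<^esub> f t) \<le> C * rnorm R a * mnorm F f * weight t"
    using smult_bound_F by blast
  then have "mnorm F (a \<odot>\<^bsub>F\<^esub> f) \<le> C * rnorm R a * mnorm F f" if "a \<in> carrier R" "f \<in> carrier F" for a f
    using that by (simp add: smult_F norm_F smult_closed_F norm_F_nonneg Z.rnorm_nonneg)
  then show "\<exists>C>0. \<forall>a\<in>carrier R. \<forall>m\<in>carrier F. mnorm F (a \<odot>\<^bsub>F\<^esub> m) \<le> C * rnorm R a * mnorm F m"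
    using C(1) by blast
qed

end

section \<open>The ring as a Banach module\<close>

lemma self_module_simps [simp]:
  "carrier (self_module R) = carrier R" "\<zero>\<^bsub>self_module R\<^esub> = \<zero>\<^bsub>R\<^esub>"
  "x \<oplus>\<^bsub>self_module R\<^esub> y = x \<oplus>\<^bsub>R\<^esub> y" "a \<odot>\<^bsub>self_module R\<^esub> x = a \<otimes>\<^bsub>R\<^esub> x"
  "mnorm (self_module R) = rnorm R"
  by (simp_all add: self_module_def)

lemma self_module_minus [simp]: "x \<ominus>\<^bsub>self_module R\<^esub> y = x \<ominus>\<^bsub>R\<^esub> y"
  by (simp add: a_minus_def a_inv_def m_inv_def self_module_def)

lemma banach_mod_self_module:
  assumes R: "banach_ring R"
  shows "banach_mod R (self_module R)"
proof (rule banach_modI[OF R])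
  interpret cring R using R by (simp add: banach_ring_def)
  have "abelian_group (self_module R)"
    by (rule abelian_groupI) (auto simp: a_ac intro!: bexI[of _ "\<ominus>\<^bsub>R\<^esub> _"] l_neg)
  then have "module R (self_module R)"
    by (intro moduleI is_cring) (auto simp: l_distr r_distr m_assoc)
  moreover have "is_norm (self_module R) (rnorm R)" "ncomplete (self_module R) (rnorm R)"
    using R by (auto simp: banach_ring_def is_norm_def ncomplete_def ncauchy_def)
  ultimately show "banach_module R (self_module R)"
    using R by (simp add: banach_module_def banach_ring_def)
qed

section \<open>The internal Hom\<close>

lemma ban_homI:
  assumes "f \<in> carrier V \<rightarrow>\<^sub>E carrier W"
    and "\<And>x y. x \<in> carrier V \<Longrightarrow> y \<in> carrier V \<Longrightarrow> f (x \<oplus>\<^bsub>V\<^esub> y) = f x \<oplus>\<^bsub>W\<^esub> f y"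
    and "\<And>a x. a \<in> carrier R \<Longrightarrow> x \<in> carrier V \<Longrightarrow> f (a \<odot>\<^bsub>V\<^esub> x) = a \<odot>\<^bsub>W\<^esub> f x"
    and "\<And>x. x \<in> carrier V \<Longrightarrow> mnorm W (f x) \<le> C * mnorm V x"
  shows "f \<in> ban_hom R V W"
  unfolding ban_hom_def using assms by blast

lemma ban_homD:
  assumes "f \<in> ban_hom R V W"
  shows "f \<in> carrier V \<rightarrow>\<^sub>E carrier W"
    and "x \<in> carrier V \<Longrightarrow> f x \<in> carrier W"
    and "x \<in> carrier V \<Longrightarrow> y \<in> carrier V \<Longrightarrow> f (x \<oplus>\<^bsub>V\<^esub> y) = f x \<oplus>\<^bsub>W\<^esub> f y"
    and "a \<in> carrier R \<Longrightarrow> x \<in> carrier V \<Longrightarrow> f (a \<odot>\<^bsub>V\<^esub> x) = a \<odot>\<^bsub>W\<^esub> f x"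
  using assms unfolding ban_hom_def by auto

lemma ban_hom_eqI:
  assumes "f \<in> ban_hom R V W" "g \<in> ban_hom R V W'" "\<And>x. x \<in> carrier V \<Longrightarrow> f x = g x"
  shows "f = g"
  using ban_homD(1)[OF assms(1)] ban_homD(1)[OF assms(2)] assms(3)
  by (intro extensionalityI[of f "carrier V"]) (auto simp: PiE_def)

lemma ban_hom_bounded:
  assumes "f \<in> ban_hom R V W" "\<And>x. x \<in> carrier V \<Longrightarrow> 0 \<le> mnorm V x"
  shows "\<exists>C>0. \<forall>x\<in>carrier V. mnorm W (f x) \<le> C * mnorm V x"
proof -
  obtain C where C: "\<And>x. x \<in> carrier V \<Longrightarrow> mnorm W (f x) \<le> C * mnorm V x"
    using assms(1) unfolding ban_hom_def by blast
  have "mnorm W (f x) \<le> (\<bar>C\<bar> + 1) * mnorm V x" if "x \<in> carrier V" for x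
  proof -
    have "C * mnorm V x \<le> (\<bar>C\<bar> + 1) * mnorm V x"
      using assms(2)[OF that] by (intro mult_right_mono) auto
    then show ?thesis using C[OF that] by linarith
  qed
  then show ?thesis by (intro exI[of _ "\<bar>C\<bar> + 1"]) auto
qed

lemma compose_ban_hom:
  assumes U: "seminormed_module R U" and V: "seminormed_module R V"
    and f: "f \<in> ban_hom R U V" and g: "g \<in> ban_hom R V W"
  shows "compose (carrier U) g f \<in> ban_hom R U W"
proof -
  interpret U: seminormed_module R U by (rule U)
  interpret V: seminormed_module R V by (rule V)
  obtain C where C: "C > 0" "\<And>x. x \<in> carrier V \<Longrightarrow> mnorm W (g x) \<le> C * mnorm V x"
    using ban_hom_bounded[OF g V.norm_nonneg] by blast
  obtain D where D: "\<And>x. x \<in> carrier U \<Longrightarrow> mnorm V (f x) \<le> D * mnorm U x"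
    using f unfolding ban_hom_def by blast
  show ?thesis
  proof (rule ban_homI)
    fix x assume x: "x \<in> carrier U"
    have "mnorm W (g (f x)) \<le> C * mnorm V (f x)" using C(2)[OF ban_homD(2)[OF f x]] .
    also have "\<dots> \<le> C * (D * mnorm U x)" using D[OF x] C(1) by (intro mult_left_mono) auto
    finally show "mnorm W (compose (carrier U) g f x) \<le> (C * D) * mnorm U x"
      using x by (simp add: compose_eq mult.assoc)
  qed (auto simp: compose_eq compose_def ban_homD(2,3,4)[OF f] ban_homD(2,3,4)[OF g])
qed

locale banach_hom = V: seminormed_module R V + W: banach_mod R W
  for R :: "('a, 'x) nring_scheme" (structure) and V :: "('a, 'b) nmodule" and W :: "('a, 'c) nmodule"
begin

lemma op_norm_le_iff:
  assumes f: "f \<in> ban_hom R V W"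
  shows "op_norm V W f \<le> B \<longleftrightarrow> 0 \<le> B \<and> (\<forall>x\<in>carrier V. mnorm W (f x) \<le> B * mnorm V x)"
proof -
  define S where "S = {C. 0 \<le> C \<and> (\<forall>x\<in>carrier V. mnorm W (f x) \<le> C * mnorm V x)}"
  have op: "op_norm V W f = Inf S" by (simp add: op_norm_def S_def)
  obtain C where "C > 0" "\<forall>x\<in>carrier V. mnorm W (f x) \<le> C * mnorm V x"
    using ban_hom_bounded[OF f V.norm_nonneg] by blast
  then have "C \<in> S" by (simp add: S_def)
  then have ne: "S \<noteq> {}" by blast
  have bd: "bdd_below S" by (rule bdd_belowI[of _ 0]) (simp add: S_def)
  have 0: "0 \<le> Inf S" using ne by (intro cInf_greatest) (auto simp: S_def)
  have le: "mnorm W (f x) \<le> Inf S * mnorm V x" if x: "x \<in> carrier V" for x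
  proof (cases "mnorm V x = 0")
    case True
    have "mnorm W (f x) \<le> C * mnorm V x" using x \<open>C \<in> S\<close> by (simp add: S_def)
    then show ?thesis using True by simp
  next
    case False
    then have pos: "mnorm V x > 0" using V.norm_nonneg[OF x] by simp
    have "mnorm W (f x) / mnorm V x \<le> Inf S"
      using ne pos x by (intro cInf_greatest) (auto simp: S_def pos_divide_le_eq)
    then show ?thesis using pos by (simp add: pos_divide_le_eq)
  qed
  show ?thesis
  proof (intro iffI conjI ballI)
    assume B: "op_norm V W f \<le> B"
    then show "0 \<le> B" using 0 op by simp
    fix x assume x: "x \<in> carrier V"
    show "mnorm W (f x) \<le> B * mnorm V x"
      using le[OF x] mult_right_mono[OF B V.norm_nonneg[OF x]] op by simp
  next
    assume "0 \<le> B \<and> (\<forall>x\<in>carrier V. mnorm W (f x) \<le> B * mnorm V x)"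
    then show "op_norm V W f \<le> B" unfolding op by (intro cInf_lower bd) (simp add: S_def)
  qed
qed

sublocale H: function_module R W "carrier V" "mnorm V"
  "\<lambda>f. (\<forall>x\<in>carrier V. \<forall>y\<in>carrier V. f (x \<oplus>\<^bsub>V\<^esub> y) = f x \<oplus>\<^bsub>W\<^esub> f y) \<and>
     (\<forall>a\<in>carrier R. \<forall>x\<in>carrier V. f (a \<odot>\<^bsub>V\<^esub> x) = a \<odot>\<^bsub>W\<^esub> f x)"
  "ihom R V W"
proof unfold_locales
  show "f \<in> carrier (ihom R V W) \<Longrightarrow> mnorm (ihom R V W) f \<le> B \<longleftrightarrow>
      0 \<le> B \<and> (\<forall>t\<in>carrier V. mnorm W (f t) \<le> B * mnorm V t)" for f B
    by (simp add: ihom_def op_norm_le_iff)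
next
  fix fs :: "nat \<Rightarrow> 'b \<Rightarrow> 'c" and g
  assume fs: "\<And>n. fs n \<in> carrier V \<rightarrow>\<^sub>E carrier W"
    and lin: "\<And>n. (\<forall>x\<in>carrier V. \<forall>y\<in>carrier V. fs n (x \<oplus>\<^bsub>V\<^esub> y) = fs n x \<oplus>\<^bsub>W\<^esub> fs n y) \<and>
      (\<forall>a\<in>carrier R. \<forall>x\<in>carrier V. fs n (a \<odot>\<^bsub>V\<^esub> x) = a \<odot>\<^bsub>W\<^esub> fs n x)"
    and g: "g \<in> carrier V \<rightarrow>\<^sub>E carrier W"
    and lim: "\<And>t. t \<in> carrier V \<Longrightarrow> asymp_eq W (\<lambda>n. fs n t) (\<lambda>_. g t)"
  have fc: "range (\<lambda>n. fs n x) \<subseteq> carrier W" if "x \<in> carrier V" for x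
    using fs that by (auto simp: PiE_iff)
  have gc: "g x \<in> carrier W" "range (\<lambda>_::nat. g x) \<subseteq> carrier W" if "x \<in> carrier V" for x
    using g that by auto
  show "(\<forall>x\<in>carrier V. \<forall>y\<in>carrier V. g (x \<oplus>\<^bsub>V\<^esub> y) = g x \<oplus>\<^bsub>W\<^esub> g y) \<and>
      (\<forall>a\<in>carrier R. \<forall>x\<in>carrier V. g (a \<odot>\<^bsub>V\<^esub> x) = a \<odot>\<^bsub>W\<^esub> g x)"
  proof (intro conjI ballI)
    fix x y assume x: "x \<in> carrier V" and y: "y \<in> carrier V"
    have xy: "x \<oplus>\<^bsub>V\<^esub> y \<in> carrier V" using x y by simp
    have "asymp_eq W (\<lambda>n. fs n x \<oplus>\<^bsub>W\<^esub> fs n y) (\<lambda>_. g x \<oplus>\<^bsub>W\<^esub> g y)"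
      by (rule W.asymp_eq_add[OF fc[OF x] fc[OF y] gc(2)[OF x] gc(2)[OF y] lim[OF x] lim[OF y]])
    then have "asymp_eq W (\<lambda>n. fs n (x \<oplus>\<^bsub>V\<^esub> y)) (\<lambda>_. g x \<oplus>\<^bsub>W\<^esub> g y)"
      using lin x y by simp
    then show "g (x \<oplus>\<^bsub>V\<^esub> y) = g x \<oplus>\<^bsub>W\<^esub> g y"
      by (rule W.limit_unique[OF fc[OF xy] gc(1)[OF xy] _ lim[OF xy], rotated]) (use gc x y in simp)
  next
    fix a x assume a: "a \<in> carrier R" and x: "x \<in> carrier V"
    have ax: "a \<odot>\<^bsub>V\<^esub> x \<in> carrier V" using a x by simp
    have "asymp_eq W (\<lambda>n. a \<odot>\<^bsub>W\<^esub> fs n x) (\<lambda>_. a \<odot>\<^bsub>W\<^esub> g x)"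
      by (rule W.asymp_eq_smult[OF fc[OF x] gc(2)[OF x] a lim[OF x]])
    then have "asymp_eq W (\<lambda>n. fs n (a \<odot>\<^bsub>V\<^esub> x)) (\<lambda>_. a \<odot>\<^bsub>W\<^esub> g x)"
      using lin a x by simp
    then show "g (a \<odot>\<^bsub>V\<^esub> x) = a \<odot>\<^bsub>W\<^esub> g x"
      by (rule W.limit_unique[OF fc[OF ax] gc(1)[OF ax] _ lim[OF ax], rotated]) (use gc a x in simp)
  qed
next
  fix f g :: "'b \<Rightarrow> 'c"
  assume "f \<in> carrier V \<rightarrow>\<^sub>E carrier W" "g \<in> carrier V \<rightarrow>\<^sub>E carrier W"
  then have "f x \<in> carrier W" "g x \<in> carrier W" if "x \<in> carrier V" for x using that by auto
  moreover assume "(\<forall>x\<in>carrier V. \<forall>y\<in>carrier V. f (x \<oplus>\<^bsub>V\<^esub> y) = f x \<oplus>\<^bsub>W\<^esub> f y) \<and>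
      (\<forall>a\<in>carrier R. \<forall>x\<in>carrier V. f (a \<odot>\<^bsub>V\<^esub> x) = a \<odot>\<^bsub>W\<^esub> f x)"
    "(\<forall>x\<in>carrier V. \<forall>y\<in>carrier V. g (x \<oplus>\<^bsub>V\<^esub> y) = g x \<oplus>\<^bsub>W\<^esub> g y) \<and>
      (\<forall>a\<in>carrier R. \<forall>x\<in>carrier V. g (a \<odot>\<^bsub>V\<^esub> x) = a \<odot>\<^bsub>W\<^esub> g x)"
  ultimately show "(\<forall>x\<in>carrier V. \<forall>y\<in>carrier V. (\<lambda>t\<in>carrier V. f t \<oplus>\<^bsub>W\<^esub> g t) (x \<oplus>\<^bsub>V\<^esub> y)
      = (\<lambda>t\<in>carrier V. f t \<oplus>\<^bsub>W\<^esub> g t) x \<oplus>\<^bsub>W\<^esub> (\<lambda>t\<in>carrier V. f t \<oplus>\<^bsub>W\<^esub> g t) y) \<and>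
    (\<forall>a\<in>carrier R. \<forall>x\<in>carrier V. (\<lambda>t\<in>carrier V. f t \<oplus>\<^bsub>W\<^esub> g t) (a \<odot>\<^bsub>V\<^esub> x)
      = a \<odot>\<^bsub>W\<^esub> (\<lambda>t\<in>carrier V. f t \<oplus>\<^bsub>W\<^esub> g t) x)"
    by (simp add: W.M.a_ac W.smult_r_distr)
next
  fix b and f :: "'b \<Rightarrow> 'c"
  assume b: "b \<in> carrier R" and "f \<in> carrier V \<rightarrow>\<^sub>E carrier W"
  then have "f x \<in> carrier W" if "x \<in> carrier V" for x using that by auto
  moreover assume "(\<forall>x\<in>carrier V. \<forall>y\<in>carrier V. f (x \<oplus>\<^bsub>V\<^esub> y) = f x \<oplus>\<^bsub>W\<^esub> f y) \<and>
      (\<forall>a\<in>carrier R. \<forall>x\<in>carrier V. f (a \<odot>\<^bsub>V\<^esub> x) = a \<odot>\<^bsub>W\<^esub> f x)"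
  ultimately show "(\<forall>x\<in>carrier V. \<forall>y\<in>carrier V. (\<lambda>t\<in>carrier V. b \<odot>\<^bsub>W\<^esub> f t) (x \<oplus>\<^bsub>V\<^esub> y)
      = (\<lambda>t\<in>carrier V. b \<odot>\<^bsub>W\<^esub> f t) x \<oplus>\<^bsub>W\<^esub> (\<lambda>t\<in>carrier V. b \<odot>\<^bsub>W\<^esub> f t) y) \<and>
    (\<forall>a\<in>carrier R. \<forall>x\<in>carrier V. (\<lambda>t\<in>carrier V. b \<odot>\<^bsub>W\<^esub> f t) (a \<odot>\<^bsub>V\<^esub> x)
      = a \<odot>\<^bsub>W\<^esub> (\<lambda>t\<in>carrier V. b \<odot>\<^bsub>W\<^esub> f t) x)"
    using b by (simp add: W.smult_r_distr V.R.m_comm flip: W.smult_assoc1)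
qed (auto simp: ihom_def ban_hom_def V.norm_nonneg)

lemma banach_module_ihom: "banach_module R (ihom R V W)"
  by (rule H.banach_module_F)

lemma banach_mod_ihom: "banach_mod R (ihom R V W)"
  by (rule banach_modI[OF W.banach_ring banach_module_ihom])

end

section \<open>Weighted products of copies of the ring\<close>

abbreviation (input) weighted_product :: "('a, 'x) nring_scheme \<Rightarrow> 's set \<Rightarrow> ('s \<Rightarrow> real) \<Rightarrow> ('a, 's \<Rightarrow> 'a) nmodule" where
  "weighted_product R S c \<equiv> prod_le1 S (\<lambda>s. weighted_copy R (c s))"

locale weighted_prod =
  fixes R :: "('a, 'x) nring_scheme" (structure) and S :: "'s set" and c :: "'s \<Rightarrow> real"
  assumes banach_ring_R: "banach_ring R" and c_pos: "s \<in> S \<Longrightarrow> 0 < c s"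
begin

sublocale Z: banach_mod R "self_module R"
  by (rule banach_mod_self_module[OF banach_ring_R])

lemma weighted_copy_simps:
  "carrier (weighted_copy R d) = carrier R" "\<zero>\<^bsub>weighted_copy R d\<^esub> = \<zero>"
  "x \<oplus>\<^bsub>weighted_copy R d\<^esub> y = x \<oplus> y" "a \<odot>\<^bsub>weighted_copy R d\<^esub> x = a \<otimes> x"
  "mnorm (weighted_copy R d) x = d * rnorm R x"
  by (simp_all add: weighted_copy_def self_module_def)

lemma bdd_above_weighted_iff:
  "bdd_above ((\<lambda>s. c s * rnorm R (v s)) ` S) \<longleftrightarrow> (\<exists>B. \<forall>s\<in>S. rnorm R (v s) \<le> B * (1 / c s))"
  using c_pos by (auto simp: bdd_above_def field_simps)

sublocale P: function_module R "self_module R" S "\<lambda>s. 1 / c s" "\<lambda>_. True" "weighted_product R S c"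
proof unfold_locales
  show "carrier (weighted_product R S c) = {f \<in> S \<rightarrow>\<^sub>E carrier (self_module R). True \<and>
      (\<exists>B. \<forall>t\<in>S. mnorm (self_module R) (f t) \<le> B * (1 / c t))}"
    by (simp add: prod_le1_def weighted_copy_simps bdd_above_weighted_iff)
next
  fix v B assume v: "v \<in> carrier (weighted_product R S c)"
  then have bdd: "bdd_above ((\<lambda>s. c s * rnorm R (v s)) ` S)"
    by (simp add: prod_le1_def weighted_copy_simps)
  have "mnorm (weighted_product R S c) v \<le> B \<longleftrightarrow> 0 \<le> B \<and> (\<forall>s\<in>S. c s * rnorm R (v s) \<le> B)"
    using bdd by (simp add: prod_le1_def weighted_copy_simps cSup_le_iff)
  also have "\<dots> \<longleftrightarrow> 0 \<le> B \<and> (\<forall>t\<in>S. mnorm (self_module R) (v t) \<le> B * (1 / c t))"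
    using c_pos by (auto simp: field_simps)
  finally show "mnorm (weighted_product R S c) v \<le> B \<longleftrightarrow>
      0 \<le> B \<and> (\<forall>t\<in>S. mnorm (self_module R) (v t) \<le> B * (1 / c t))" .
qed (auto simp: prod_le1_def weighted_copy_simps less_imp_le[OF c_pos])

lemma banach_mod_weighted_product: "banach_mod R (weighted_product R S c)"
  by (rule banach_modI[OF banach_ring_R P.banach_module_F])

end

section \<open>The algebraic tensor product\<close>

text \<open>The sum \<open>\<Sum>\<^sub>i \<parallel>v\<^sub>i\<parallel> \<parallel>w\<^sub>i\<parallel>\<close> attached to a list of pairs \<open>(v\<^sub>i, w\<^sub>i)\<close>; the projective seminorm is the
  infimum of these sums.\<close>

definition pairs_cost :: "('a, 'b) nmodule \<Rightarrow> ('a, 'c) nmodule \<Rightarrow> ('b \<times> 'c) list \<Rightarrow> real" where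
  "pairs_cost V W ps = (\<Sum>(v, w)\<leftarrow>ps. mnorm V v * mnorm W w)"

text \<open>The element \<open>\<Sum>\<^sub>i v\<^sub>i \<otimes> w\<^sub>i\<close> of the algebraic tensor product given by a list of pairs.\<close>

definition list_class :: "('a, 'x) nring_scheme \<Rightarrow> ('a, 'b) nmodule \<Rightarrow> ('a, 'c) nmodule \<Rightarrow>
    ('b \<times> 'c) list \<Rightarrow> ('b \<times> 'c \<Rightarrow>\<^sub>0 int) set" where
  "list_class R V W ps = tensor_class R V W (\<Sum>p\<leftarrow>ps. frag_of p)"

lemma pairs_cost_simps [simp]:
  "pairs_cost V W [] = 0"
  "pairs_cost V W (p # ps) = mnorm V (fst p) * mnorm W (snd p) + pairs_cost V W ps"
  "pairs_cost V W (ps @ qs) = pairs_cost V W ps + pairs_cost V W qs"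
  by (simp_all add: pairs_cost_def split_beta)

lemma le_mult_epsilon:
  fixes x y k :: real
  assumes "0 \<le> k" "\<And>e. e > 0 \<Longrightarrow> x \<le> k * (y + e)"
  shows "x \<le> k * y"
proof (rule field_le_epsilon)
  fix d :: real assume d: "d > 0"
  have "x \<le> k * (y + d / (k + 1))" using assms d by simp
  also have "\<dots> = k * y + d * (k / (k + 1))" by (simp add: algebra_simps)
  also have "\<dots> \<le> k * y + d * 1"
    using assms(1) d by (intro add_left_mono mult_left_mono) (auto simp: divide_le_eq_1)
  finally show "x \<le> k * y + d" by simp
qed

lemmas frag_induct_on = free_Abelian_group_induct [consumes 1, case_names zero diff gen]

text \<open>Below, \<open>NN\<close> is the group of relations and \<open>AT\<close> the algebraic tensor product of \<open>V\<close> and \<open>W\<close>,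
  whose elements are the cosets \<open>cls z\<close> of formal integer combinations \<open>z\<close> of pairs in \<open>PS\<close>.\<close>

locale tensor_pair = V: seminormed_module R V + W: seminormed_module R W
  for R :: "('a, 'x) nring_scheme" (structure) and V :: "('a, 'b) nmodule" and W :: "('a, 'c) nmodule"
begin

abbreviation "PS \<equiv> carrier V \<times> carrier W"
abbreviation "NN \<equiv> tensor_sub R V W"
abbreviation "cls \<equiv> tensor_class R V W"
abbreviation "AT \<equiv> alg_tensor R V W"

lemma keys_minus_subset: "Poly_Mapping.keys x \<subseteq> S \<Longrightarrow> Poly_Mapping.keys y \<subseteq> S \<Longrightarrow> Poly_Mapping.keys (x - y) \<subseteq> S"
  using keys_diff[of x y] by blast

lemma keys_plus_subset: "Poly_Mapping.keys x \<subseteq> S \<Longrightarrow> Poly_Mapping.keys y \<subseteq> S \<Longrightarrow> Poly_Mapping.keys (x + y) \<subseteq> S"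
  using keys_add[of x y] by blast

lemma rels_keys: "z \<in> tensor_rels R V W \<Longrightarrow> Poly_Mapping.keys z \<subseteq> PS"
  unfolding tensor_rels_def
  by (elim UnE CollectE exE conjE) (simp_all add: keys_minus_subset)

lemma NN_subgroup: "subgroup NN (tensor_free V W)"
  unfolding tensor_sub_def tensor_free_def
  by (rule group.generate_is_subgroup[OF group_free_Abelian_group]) (use rels_keys in auto)

lemma NN_keys: "z \<in> NN \<Longrightarrow> Poly_Mapping.keys z \<subseteq> PS"
  using subsetD[OF subgroup.subset[OF NN_subgroup], of z] by (simp add: tensor_free_def)

lemma NN_0: "0 \<in> NN"
  using subgroup.one_closed[OF NN_subgroup] by (simp add: tensor_free_def)

lemma NN_add: "x \<in> NN \<Longrightarrow> y \<in> NN \<Longrightarrow> x + y \<in> NN"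
  using subgroup.m_closed[OF NN_subgroup, of x y] by (simp add: tensor_free_def)

lemma NN_neg: "x \<in> NN \<Longrightarrow> - x \<in> NN"
  using subgroup.m_inv_closed[OF NN_subgroup, of x] NN_keys[of x] by (simp add: tensor_free_def)

lemma NN_diff: "x \<in> NN \<Longrightarrow> y \<in> NN \<Longrightarrow> x - y \<in> NN"
  using NN_add[of x "- y"] NN_neg[of y] by simp

lemma NN_rel: "z \<in> tensor_rels R V W \<Longrightarrow> z \<in> NN"
  unfolding tensor_sub_def by (rule generate.incl)

lemma NN_induct [consumes 1, case_names rel zero add neg]:
  assumes "z \<in> NN" and rel: "\<And>z. z \<in> tensor_rels R V W \<Longrightarrow> P z" and zero: "P 0"
    and add: "\<And>x y. x \<in> NN \<Longrightarrow> y \<in> NN \<Longrightarrow> P x \<Longrightarrow> P y \<Longrightarrow> P (x + y)"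
    and neg: "\<And>x. x \<in> NN \<Longrightarrow> P x \<Longrightarrow> P (- x)"
  shows "P z"
  using assms(1) unfolding tensor_sub_def
proof (induction rule: generate.induct)
  case one
  then show ?case using zero by (simp add: tensor_free_def)
next
  case (incl h)
  then show ?case by (rule rel)
next
  case (inv h)
  then show ?case using neg[OF NN_rel[OF inv] rel[OF inv]] rels_keys[OF inv]
    by (simp add: tensor_free_def)
next
  case (eng h1 h2)
  then show ?case using add[of h1 h2] by (simp add: tensor_free_def tensor_sub_def)
qed

text \<open>Cosets are handled through the differences of their representatives, which live in the additive
  group of formal integer combinations.\<close>

lemma cls_iff: "z' \<in> cls z \<longleftrightarrow> z' - z \<in> NN"
  by (force simp: tensor_class_def r_coset_def tensor_free_def)

lemma cls_eq_iff: "cls z = cls z' \<longleftrightarrow> z - z' \<in> NN"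
proof
  assume "cls z = cls z'"
  then show "z - z' \<in> NN" using NN_0 cls_iff[of z z] cls_iff[of z z'] by simp
next
  assume N: "z - z' \<in> NN"
  show "cls z = cls z'"
  proof (intro Set.set_eqI iffI)
    fix y
    show "y \<in> cls z'" if "y \<in> cls z"
      using that NN_add[of "y - z" "z - z'"] N by (simp add: cls_iff)
    show "y \<in> cls z" if "y \<in> cls z'"
      using that NN_diff[of "y - z'" "z - z'"] N by (simp add: cls_iff)
  qed
qed

lemma carrier_AT: "carrier AT = cls ` {z. Poly_Mapping.keys z \<subseteq> PS}"
  by (auto simp: alg_tensor_def Let_def FactGroup_def RCOSETS_def tensor_class_def tensor_free_def)

lemma cls_closed: "Poly_Mapping.keys z \<subseteq> PS \<Longrightarrow> cls z \<in> carrier AT"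
  by (auto simp: carrier_AT)

lemma zero_AT: "\<zero>\<^bsub>AT\<^esub> = cls 0"
  by (auto simp: alg_tensor_def Let_def FactGroup_def tensor_class_def r_coset_def tensor_free_def)

lemma add_AT: "cls x \<oplus>\<^bsub>AT\<^esub> cls y = cls (x + y)"
proof -
  have "cls x \<oplus>\<^bsub>AT\<^esub> cls y = (\<Union>a\<in>cls x. \<Union>b\<in>cls y. {a + b})"
    by (simp add: alg_tensor_def Let_def FactGroup_def set_mult_def tensor_free_def)
  also have "\<dots> = cls (x + y)"
  proof (intro Set.set_eqI iffI)
    fix z assume "z \<in> (\<Union>a\<in>cls x. \<Union>b\<in>cls y. {a + b})"
    then obtain a b where "a \<in> cls x" "b \<in> cls y" "z = a + b" by blast
    then show "z \<in> cls (x + y)"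
      using NN_add[of "a - x" "b - y"] by (simp add: cls_iff algebra_simps)
  next
    fix z assume "z \<in> cls (x + y)"
    then have "z - y \<in> cls x" "y \<in> cls y" by (simp_all add: cls_iff algebra_simps NN_0)
    then show "z \<in> (\<Union>a\<in>cls x. \<Union>b\<in>cls y. {a + b})" by force
  qed
  finally show ?thesis .
qed

text \<open>The action of a scalar on formal combinations of pairs, by multiplication of the first entries.\<close>

definition act :: "'a \<Rightarrow> ('b \<times> 'c \<Rightarrow>\<^sub>0 int) \<Rightarrow> ('b \<times> 'c \<Rightarrow>\<^sub>0 int)" where
  "act a = frag_extend (\<lambda>(v, w). frag_of (a \<odot>\<^bsub>V\<^esub> v, w))"

lemma act_simps [simp]:
  "act a 0 = 0" "act a (x + y) = act a x + act a y" "act a (x - y) = act a x - act a y"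
  "act a (- x) = - act a x" "act a (frag_of (v, w)) = frag_of (a \<odot>\<^bsub>V\<^esub> v, w)"
  by (simp_all add: act_def frag_extend_add frag_extend_diff frag_extend_minus)

lemma act_keys:
  assumes "a \<in> carrier R" "Poly_Mapping.keys z \<subseteq> PS"
  shows "Poly_Mapping.keys (act a z) \<subseteq> PS"
  using assms(2)
proof (induction rule: frag_induct_on)
  case (gen p)
  then show ?case using assms(1) by (cases p) simp
qed (simp_all add: keys_minus_subset)

lemma rel_add_left: "\<lbrakk>v \<in> carrier V; v' \<in> carrier V; w \<in> carrier W\<rbrakk> \<Longrightarrow>
    frag_of (v \<oplus>\<^bsub>V\<^esub> v', w) - frag_of (v, w) - frag_of (v', w) \<in> NN"
  by (rule NN_rel, unfold tensor_rels_def) blast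

lemma rel_add_right: "\<lbrakk>v \<in> carrier V; w \<in> carrier W; w' \<in> carrier W\<rbrakk> \<Longrightarrow>
    frag_of (v, w \<oplus>\<^bsub>W\<^esub> w') - frag_of (v, w) - frag_of (v, w') \<in> NN"
  by (rule NN_rel, unfold tensor_rels_def) blast

lemma rel_smult: "\<lbrakk>a \<in> carrier R; v \<in> carrier V; w \<in> carrier W\<rbrakk> \<Longrightarrow>
    frag_of (a \<odot>\<^bsub>V\<^esub> v, w) - frag_of (v, a \<odot>\<^bsub>W\<^esub> w) \<in> NN"
  by (rule NN_rel, unfold tensor_rels_def) blast

lemma act_NN:
  assumes a: "a \<in> carrier R" and "z \<in> NN"
  shows "act a z \<in> NN"
  using assms(2)
proof (induction rule: NN_induct)
  case (rel z)
  then show ?case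
    unfolding tensor_rels_def
  proof (elim UnE CollectE exE conjE)
    fix v v' w assume "v \<in> carrier V" "v' \<in> carrier V" "w \<in> carrier W"
      "z = frag_of (v \<oplus>\<^bsub>V\<^esub> v', w) - frag_of (v, w) - frag_of (v', w)"
    then show ?thesis
      using rel_add_left[of "a \<odot>\<^bsub>V\<^esub> v" "a \<odot>\<^bsub>V\<^esub> v'" w] a by (simp add: V.smult_r_distr)
  next
    fix v w w' assume "v \<in> carrier V" "w \<in> carrier W" "w' \<in> carrier W"
      "z = frag_of (v, w \<oplus>\<^bsub>W\<^esub> w') - frag_of (v, w) - frag_of (v, w')"
    then show ?thesis using rel_add_right[of "a \<odot>\<^bsub>V\<^esub> v" w w'] a by simp
  next
    fix b v w assume 3: "b \<in> carrier R" "v \<in> carrier V" "w \<in> carrier W"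
      "z = frag_of (b \<odot>\<^bsub>V\<^esub> v, w) - frag_of (v, b \<odot>\<^bsub>W\<^esub> w)"
    have "a \<odot>\<^bsub>V\<^esub> (b \<odot>\<^bsub>V\<^esub> v) = b \<odot>\<^bsub>V\<^esub> (a \<odot>\<^bsub>V\<^esub> v)"
      using 3 a by (simp add: V.R.m_comm flip: V.smult_assoc1)
    then show ?thesis using rel_smult[of b "a \<odot>\<^bsub>V\<^esub> v" w] 3 a by simp
  qed
qed (simp_all add: NN_0 NN_add NN_neg)

lemma smult_AT:
  assumes a: "a \<in> carrier R"
  shows "a \<odot>\<^bsub>AT\<^esub> cls z = cls (act a z)"
proof -
  have "a \<odot>\<^bsub>AT\<^esub> cls z = (\<Union>y\<in>cls z. cls (act a y))"
    by (simp add: alg_tensor_def Let_def act_def)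
  also have "\<dots> = (\<Union>y\<in>cls z. cls (act a z))"
  proof (rule SUP_cong)
    fix y assume "y \<in> cls z"
    then have "act a (y - z) \<in> NN" by (simp only: act_NN[OF a] cls_iff)
    then show "cls (act a y) = cls (act a z)" by (simp add: cls_eq_iff)
  qed simp
  also have "\<dots> = cls (act a z)" using NN_0 cls_iff[of z z] by auto
  finally show ?thesis .
qed

lemma carrier_ATE:
  assumes "x \<in> carrier AT"
  obtains z where "Poly_Mapping.keys z \<subseteq> PS" "x = cls z"
  using assms by (auto simp: carrier_AT)

lemma act_add_left:
  assumes "Poly_Mapping.keys z \<subseteq> PS" and ab: "a \<in> carrier R" "b \<in> carrier R"
  shows "act (a \<oplus> b) z - (act a z + act b z) \<in> NN"
  using assms(1)
proof (induction rule: frag_induct_on)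
  case (diff x y)
  then show ?case using NN_diff[OF diff(3,4)] by (simp add: algebra_simps)
next
  case (gen p)
  then show ?case using rel_add_left[of "a \<odot>\<^bsub>V\<^esub> fst p" "b \<odot>\<^bsub>V\<^esub> fst p" "snd p"] ab
    by (cases p) (simp add: V.smult_l_distr algebra_simps)
qed (simp add: NN_0)

lemma act_assoc:
  assumes "Poly_Mapping.keys z \<subseteq> PS" and ab: "a \<in> carrier R" "b \<in> carrier R"
  shows "act (a \<otimes> b) z = act a (act b z)"
  using assms(1)
  by (induction rule: frag_induct_on) (use ab in \<open>auto simp: V.smult_assoc1\<close>)

lemma act_one:
  assumes "Poly_Mapping.keys z \<subseteq> PS"
  shows "act \<one> z = z"
  using assms by (induction rule: frag_induct_on) auto

lemma module_AT: "module R AT"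
proof (rule moduleI)
  show "cring R" by (rule V.is_cring)
  show "abelian_group AT"
  proof (rule abelian_groupI)
    fix x assume "x \<in> carrier AT"
    then obtain z where z: "Poly_Mapping.keys z \<subseteq> PS" "x = cls z" by (rule carrier_ATE)
    show "\<exists>y\<in>carrier AT. y \<oplus>\<^bsub>AT\<^esub> x = \<zero>\<^bsub>AT\<^esub>"
      using z by (intro bexI[of _ "cls (- z)"]) (simp_all add: add_AT zero_AT cls_closed)
  qed (auto elim!: carrier_ATE simp: add_AT zero_AT cls_closed keys_plus_subset add_ac)
next
  fix a x assume "a \<in> carrier R" "x \<in> carrier AT"
  then show "a \<odot>\<^bsub>AT\<^esub> x \<in> carrier AT"
    by (elim carrier_ATE) (simp add: smult_AT act_keys cls_closed)
next
  fix a b x assume ab: "a \<in> carrier R" "b \<in> carrier R" and "x \<in> carrier AT"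
  then obtain z where z: "Poly_Mapping.keys z \<subseteq> PS" "x = cls z" by (auto elim: carrier_ATE)
  show "(a \<oplus> b) \<odot>\<^bsub>AT\<^esub> x = a \<odot>\<^bsub>AT\<^esub> x \<oplus>\<^bsub>AT\<^esub> b \<odot>\<^bsub>AT\<^esub> x"
    using z ab act_add_left[OF z(1) ab] by (simp add: smult_AT add_AT cls_eq_iff)
  show "(a \<otimes> b) \<odot>\<^bsub>AT\<^esub> x = a \<odot>\<^bsub>AT\<^esub> (b \<odot>\<^bsub>AT\<^esub> x)"
    using z ab by (simp add: smult_AT act_assoc)
next
  fix a x y assume "a \<in> carrier R" "x \<in> carrier AT" "y \<in> carrier AT"
  then show "a \<odot>\<^bsub>AT\<^esub> (x \<oplus>\<^bsub>AT\<^esub> y) = a \<odot>\<^bsub>AT\<^esub> x \<oplus>\<^bsub>AT\<^esub> a \<odot>\<^bsub>AT\<^esub> y"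
    by (auto elim!: carrier_ATE simp: smult_AT add_AT)
next
  fix x assume "x \<in> carrier AT"
  then show "\<one> \<odot>\<^bsub>AT\<^esub> x = x" by (auto elim!: carrier_ATE simp: smult_AT act_one)
qed

sublocale A: module R AT by (rule module_AT)

subsection \<open>Lists of pure tensors and the projective seminorm\<close>

abbreviation "lcls \<equiv> list_class R V W"
abbreviation "cost \<equiv> pairs_cost V W"

lemma keys_list: "set ps \<subseteq> PS \<Longrightarrow> Poly_Mapping.keys (\<Sum>p\<leftarrow>ps. frag_of p) \<subseteq> PS"
  by (induction ps) (simp_all add: keys_plus_subset)

lemma lcls_closed: "set ps \<subseteq> PS \<Longrightarrow> lcls ps \<in> carrier AT"
  by (simp add: list_class_def cls_closed keys_list)

lemma lcls_Nil: "lcls [] = \<zero>\<^bsub>AT\<^esub>"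
  by (simp add: list_class_def zero_AT)

lemma lcls_append: "lcls (ps @ qs) = lcls ps \<oplus>\<^bsub>AT\<^esub> lcls qs"
  by (simp add: list_class_def add_AT)

lemma neg_pure_rel:
  assumes "v \<in> carrier V" "w \<in> carrier W"
  shows "- frag_of (v, w) - frag_of (\<ominus>\<^bsub>V\<^esub> v, w) \<in> NN"
proof -
  have "frag_of (\<zero>\<^bsub>V\<^esub> \<oplus>\<^bsub>V\<^esub> \<zero>\<^bsub>V\<^esub>, w) - frag_of (\<zero>\<^bsub>V\<^esub>, w) - frag_of (\<zero>\<^bsub>V\<^esub>, w) \<in> NN"
    using assms by (intro rel_add_left) auto
  then have "- frag_of (\<zero>\<^bsub>V\<^esub>, w) \<in> NN" by simp
  moreover have "frag_of (v \<oplus>\<^bsub>V\<^esub> \<ominus>\<^bsub>V\<^esub> v, w) - frag_of (v, w) - frag_of (\<ominus>\<^bsub>V\<^esub> v, w) \<in> NN"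
    using assms by (intro rel_add_left) auto
  then have "frag_of (\<zero>\<^bsub>V\<^esub>, w) - frag_of (v, w) - frag_of (\<ominus>\<^bsub>V\<^esub> v, w) \<in> NN"
    using assms by (simp add: V.M.r_neg)
  ultimately show ?thesis using NN_add by fastforce
qed

text \<open>Every element of the algebraic tensor product is a finite sum of pure tensors without integer
  coefficients, since \<open>-(v \<otimes> w) = (-v) \<otimes> w\<close>.  In particular the infimum that defines the seminorm is
  taken over a nonempty set.\<close>

lemma ex_list:
  assumes "x \<in> carrier AT"
  shows "\<exists>ps. set ps \<subseteq> PS \<and> lcls ps = x"
proof -
  obtain z where z: "Poly_Mapping.keys z \<subseteq> PS" "x = cls z" using assms by (rule carrier_ATE)
  define neg where "neg ps = map (\<lambda>(v, w). (\<ominus>\<^bsub>V\<^esub> v, w)) ps" for ps :: "('b \<times> 'c) list"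
  have neg: "set (neg ps) \<subseteq> PS \<and> - (\<Sum>p\<leftarrow>ps. frag_of p) - (\<Sum>p\<leftarrow>neg ps. frag_of p) \<in> NN"
    if "set ps \<subseteq> PS" for ps
    using that
  proof (induction ps)
    case (Cons p ps)
    obtain v w where p: "p = (v, w)" by (cases p)
    have "- (\<Sum>p\<leftarrow>ps. frag_of p) - (\<Sum>p\<leftarrow>neg ps. frag_of p) + (- frag_of (v, w) - frag_of (\<ominus>\<^bsub>V\<^esub> v, w)) \<in> NN"
      using Cons p by (intro NN_add neg_pure_rel) auto
    then show ?case using Cons p by (auto simp: neg_def algebra_simps)
  qed (simp add: neg_def NN_0)
  have "\<exists>ps. set ps \<subseteq> PS \<and> z - (\<Sum>p\<leftarrow>ps. frag_of p) \<in> NN"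
    using z(1)
  proof (induction rule: frag_induct_on)
    case zero
    show ?case by (intro exI[of _ "[]"]) (simp add: NN_0)
  next
    case (diff x y)
    then obtain ps qs where ps: "set ps \<subseteq> PS" "x - (\<Sum>p\<leftarrow>ps. frag_of p) \<in> NN"
      and qs: "set qs \<subseteq> PS" "y - (\<Sum>p\<leftarrow>qs. frag_of p) \<in> NN" by blast
    have "(x - (\<Sum>p\<leftarrow>ps. frag_of p)) - (y - (\<Sum>p\<leftarrow>qs. frag_of p))
        + (- (\<Sum>p\<leftarrow>qs. frag_of p) - (\<Sum>p\<leftarrow>neg qs. frag_of p)) \<in> NN"
      by (rule NN_add[OF NN_diff[OF ps(2) qs(2)] conjunct2[OF neg[OF qs(1)]]])
    then show ?case using ps(1) neg[OF qs(1)]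
      by (intro exI[of _ "ps @ neg qs"]) (simp add: algebra_simps)
  next
    case (gen p)
    then show ?case by (intro exI[of _ "[p]"]) (simp add: NN_0)
  qed
  then show ?thesis using z(2) by (metis cls_eq_iff list_class_def)
qed

lemma mnorm_AT: "mnorm AT c = Inf {cost ps | ps. set ps \<subseteq> PS \<and> lcls ps = c}"
  by (simp add: alg_tensor_def Let_def pairs_cost_def list_class_def)

lemma cost_nonneg: "set ps \<subseteq> PS \<Longrightarrow> 0 \<le> cost ps"
  by (induction ps) (auto simp: V.norm_nonneg W.norm_nonneg)

lemma cost_bdd: "bdd_below {cost ps | ps. set ps \<subseteq> PS \<and> lcls ps = c}"
  by (rule bdd_belowI[of _ 0]) (auto simp: cost_nonneg)

lemma norm_le_cost: "set ps \<subseteq> PS \<Longrightarrow> mnorm AT (lcls ps) \<le> cost ps"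
  unfolding mnorm_AT by (rule cInf_lower[OF _ cost_bdd]) blast

lemma norm_less_list:
  assumes "c \<in> carrier AT" "mnorm AT c < e"
  obtains ps where "set ps \<subseteq> PS" "lcls ps = c" "cost ps < e"
proof -
  have "{cost ps | ps. set ps \<subseteq> PS \<and> lcls ps = c} \<noteq> {}" using ex_list[OF assms(1)] by blast
  from cInf_lessD[OF this assms(2)[unfolded mnorm_AT]] show ?thesis using that by blast
qed

lemma norm_near_list:
  assumes "c \<in> carrier AT" "(e::real) > 0"
  obtains ps where "set ps \<subseteq> PS" "lcls ps = c" "cost ps < mnorm AT c + e"
  using norm_less_list[OF assms(1), of "mnorm AT c + e"] assms(2) by auto

lemma AT_norm_nonneg: "c \<in> carrier AT \<Longrightarrow> 0 \<le> mnorm AT c"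
  unfolding mnorm_AT using ex_list[of c] by (intro cInf_greatest) (auto simp: cost_nonneg)

lemma lcls_smult:
  assumes "a \<in> carrier R" "set ps \<subseteq> PS"
  shows "a \<odot>\<^bsub>AT\<^esub> lcls ps = lcls (map (\<lambda>(v, w). (a \<odot>\<^bsub>V\<^esub> v, w)) ps)"
proof -
  have "act a (\<Sum>p\<leftarrow>ps. frag_of p) = (\<Sum>p\<leftarrow>map (\<lambda>(v, w). (a \<odot>\<^bsub>V\<^esub> v, w)) ps. frag_of p)"
    by (induction ps) auto
  then show ?thesis using assms(1) by (simp add: list_class_def smult_AT)
qed

lemma seminormed_AT: "seminormed_module R AT"
proof (rule seminormed_module.intro[OF module_AT], unfold_locales)
  show "banach_ring R" by (rule V.banach_ring)
  show "0 \<le> mnorm AT x" if "x \<in> carrier AT" for x using that by (rule AT_norm_nonneg)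
  show "mnorm AT \<zero>\<^bsub>AT\<^esub> = 0"
    using norm_le_cost[of "[]"] AT_norm_nonneg[OF A.zero_closed] by (simp add: lcls_Nil)
next
  fix x y assume x: "x \<in> carrier AT" and y: "y \<in> carrier AT"
  show "mnorm AT (x \<oplus>\<^bsub>AT\<^esub> y) \<le> mnorm AT x + mnorm AT y"
  proof (rule field_le_epsilon)
    fix e :: real assume "e > 0"
    then have e: "e / 2 > 0" by simp
    obtain ps where ps: "set ps \<subseteq> PS" "lcls ps = x" "cost ps < mnorm AT x + e / 2"
      by (rule norm_near_list[OF x e])
    obtain qs where qs: "set qs \<subseteq> PS" "lcls qs = y" "cost qs < mnorm AT y + e / 2"
      by (rule norm_near_list[OF y e])
    show "mnorm AT (x \<oplus>\<^bsub>AT\<^esub> y) \<le> mnorm AT x + mnorm AT y + e"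
      using norm_le_cost[of "ps @ qs"] ps qs by (simp add: lcls_append)
  qed
next
  obtain C where C: "C > 0" "\<And>a x. a \<in> carrier R \<Longrightarrow> x \<in> carrier V \<Longrightarrow>
      mnorm V (a \<odot>\<^bsub>V\<^esub> x) \<le> C * rnorm R a * mnorm V x"
    using V.norm_smult_ex by blast
  show "\<exists>C>0. \<forall>a\<in>carrier R. \<forall>x\<in>carrier AT. mnorm AT (a \<odot>\<^bsub>AT\<^esub> x) \<le> C * rnorm R a * mnorm AT x"
  proof (intro exI[of _ C] conjI C(1) ballI)
    fix a x assume a: "a \<in> carrier R" and x: "x \<in> carrier AT"
    have k: "0 \<le> C * rnorm R a" using C(1) V.rnorm_nonneg[OF a] by simp
    have cost: "cost (map (\<lambda>(v, w). (a \<odot>\<^bsub>V\<^esub> v, w)) ps) \<le> C * rnorm R a * cost ps"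
      if "set ps \<subseteq> PS" for ps
      using that
    proof (induction ps)
      case (Cons p ps)
      obtain v w where p: "p = (v, w)" by (cases p)
      have vw: "v \<in> carrier V" "w \<in> carrier W" using Cons.prems p by auto
      have "mnorm V (a \<odot>\<^bsub>V\<^esub> v) * mnorm W w \<le> C * rnorm R a * mnorm V v * mnorm W w"
        using C(2)[OF a vw(1)] W.norm_nonneg[OF vw(2)] by (rule mult_right_mono)
      then show ?case using Cons p by (simp add: algebra_simps)
    qed simp
    show "mnorm AT (a \<odot>\<^bsub>AT\<^esub> x) \<le> C * rnorm R a * mnorm AT x"
    proof (rule le_mult_epsilon[OF k])
      fix e :: real assume e: "e > 0"
      obtain ps where ps: "set ps \<subseteq> PS" "lcls ps = x" "cost ps < mnorm AT x + e"
        by (rule norm_near_list[OF x e])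
      have "mnorm AT (a \<odot>\<^bsub>AT\<^esub> x) \<le> cost (map (\<lambda>(v, w). (a \<odot>\<^bsub>V\<^esub> v, w)) ps)"
        using ps(1) a unfolding ps(2)[symmetric] lcls_smult[OF a ps(1)] by (intro norm_le_cost) auto
      also have "\<dots> \<le> C * rnorm R a * cost ps" by (rule cost[OF ps(1)])
      also have "\<dots> \<le> C * rnorm R a * (mnorm AT x + e)"
        using ps(3) k by (intro mult_left_mono) auto
      finally show "mnorm AT (a \<odot>\<^bsub>AT\<^esub> x) \<le> C * rnorm R a * (mnorm AT x + e)" .
    qed
  qed
qed

end

section \<open>Bounded linear maps and limits\<close>

text \<open>Bounded linear maps preserve differences, partial sums, Cauchy sequences and asymptotic
  equality.\<close>

lemma ban_hom_zero:
  assumes "f \<in> ban_hom R V W" "module R V" "module R W"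
  shows "f \<zero>\<^bsub>V\<^esub> = \<zero>\<^bsub>W\<^esub>"
proof -
  interpret V: module R V by fact
  interpret W: module R W by fact
  have "f (\<zero>\<^bsub>R\<^esub> \<odot>\<^bsub>V\<^esub> \<zero>\<^bsub>V\<^esub>) = \<zero>\<^bsub>R\<^esub> \<odot>\<^bsub>W\<^esub> f \<zero>\<^bsub>V\<^esub>" by (rule ban_homD(4)[OF assms(1)]) auto
  then show ?thesis using ban_homD(2)[OF assms(1), of "\<zero>\<^bsub>V\<^esub>"] by simp
qed

lemma ban_hom_minus:
  assumes f: "f \<in> ban_hom R V W" and "module R V" "module R W" and xy: "x \<in> carrier V" "y \<in> carrier V"
  shows "f (x \<ominus>\<^bsub>V\<^esub> y) = f x \<ominus>\<^bsub>W\<^esub> f y"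
proof -
  interpret V: module R V by fact
  interpret W: module R W by fact
  have neg: "\<ominus>\<^bsub>V\<^esub> y = (\<ominus>\<^bsub>R\<^esub> \<one>\<^bsub>R\<^esub>) \<odot>\<^bsub>V\<^esub> y" using xy by (simp add: V.smult_l_minus)
  have "f (x \<ominus>\<^bsub>V\<^esub> y) = f x \<oplus>\<^bsub>W\<^esub> (\<ominus>\<^bsub>R\<^esub> \<one>\<^bsub>R\<^esub>) \<odot>\<^bsub>W\<^esub> f y"
    using xy unfolding V.minus_eq neg by (simp add: ban_homD(3,4)[OF f])
  then show ?thesis
    using ban_homD(2)[OF f xy(2)] by (simp add: W.minus_eq W.smult_l_minus)
qed

lemma ban_hom_psum:
  assumes f: "f \<in> ban_hom R V W" and V: "module R V" and W: "module R W" and y: "\<And>k. y k \<in> carrier V"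
  shows "f (psum V y n) = psum W (\<lambda>k. f (y k)) n"
proof -
  interpret V: module R V by fact
  show ?thesis
    by (induction n) (simp_all add: ban_hom_zero[OF f V W] ban_homD(3)[OF f] V.M.psum_closed y)
qed

lemma ban_hom_asymp_eq:
  assumes V: "seminormed_module R V" and W: "seminormed_module R W" and f: "f \<in> ban_hom R V W"
    and x: "range x \<subseteq> carrier V" and y: "range y \<subseteq> carrier V" and xy: "asymp_eq V x y"
  shows "asymp_eq W (\<lambda>n. f (x n)) (\<lambda>n. f (y n))"
proof -
  interpret V: seminormed_module R V by fact
  interpret W: seminormed_module R W by fact
  obtain C where C: "\<And>x. x \<in> carrier V \<Longrightarrow> mnorm W (f x) \<le> C * mnorm V x"
    using ban_hom_bounded[OF f V.norm_nonneg] by blast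
  show ?thesis
    unfolding asymp_eq_def
  proof (rule null_seq_le)
    show "(\<lambda>n. C * mnorm V (x n \<ominus>\<^bsub>V\<^esub> y n)) \<longlonglongrightarrow> 0"
      using tendsto_mult_right_zero[OF xy[unfolded asymp_eq_def]] .
    fix n
    have c: "x n \<in> carrier V" "y n \<in> carrier V" using x y by auto
    show "0 \<le> mnorm W (f (x n) \<ominus>\<^bsub>W\<^esub> f (y n))"
      using c by (intro W.norm_nonneg W.minus_closed ban_homD(2)[OF f])
    show "mnorm W (f (x n) \<ominus>\<^bsub>W\<^esub> f (y n)) \<le> C * mnorm V (x n \<ominus>\<^bsub>V\<^esub> y n)"
      using C[of "x n \<ominus>\<^bsub>V\<^esub> y n"] c
      by (simp add: ban_hom_minus[OF f V.module_axioms W.module_axioms])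
  qed
qed

lemma ban_hom_ncauchy:
  assumes V: "seminormed_module R V" and W: "seminormed_module R W" and f: "f \<in> ban_hom R V W"
    and x: "ncauchy V (mnorm V) x"
  shows "ncauchy W (mnorm W) (\<lambda>n. f (x n))"
proof -
  interpret V: seminormed_module R V by fact
  interpret W: seminormed_module R W by fact
  obtain C where C: "C > 0" "\<And>x. x \<in> carrier V \<Longrightarrow> mnorm W (f x) \<le> C * mnorm V x"
    using ban_hom_bounded[OF f V.norm_nonneg] by blast
  have c: "x n \<in> carrier V" for n using V.ncauchy_range[OF x] by auto
  show ?thesis
    unfolding ncauchy_def
  proof (intro conjI allI impI)
    show "range (\<lambda>n. f (x n)) \<subseteq> carrier W" using ban_homD(2)[OF f c] by auto
    fix e :: real assume "e > 0"
    then have "e / C > 0" using C(1) by simp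
    then obtain n0 where n0: "\<And>m n. m \<ge> n0 \<Longrightarrow> n \<ge> n0 \<Longrightarrow> mnorm V (x m \<ominus>\<^bsub>V\<^esub> x n) < e / C"
      using V.ncauchyD[OF x] by metis
    have "mnorm W (f (x m) \<ominus>\<^bsub>W\<^esub> f (x n)) < e" if "m \<ge> n0" "n \<ge> n0" for m n
    proof -
      have "mnorm W (f (x m) \<ominus>\<^bsub>W\<^esub> f (x n)) \<le> C * mnorm V (x m \<ominus>\<^bsub>V\<^esub> x n)"
        using C(2)[of "x m \<ominus>\<^bsub>V\<^esub> x n"] c
        by (simp add: ban_hom_minus[OF f V.module_axioms W.module_axioms])
      also have "\<dots> < C * (e / C)" using n0[OF that] C(1) by (intro mult_strict_left_mono)
      finally show ?thesis using C(1) by simp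
    qed
    then show "\<exists>n0. \<forall>m\<ge>n0. \<forall>n\<ge>n0. mnorm W (f (x m) \<ominus>\<^bsub>W\<^esub> f (x n)) < e" by blast
  qed
qed

section \<open>The universal property of the tensor product\<close>

context tensor_pair
begin

abbreviation "pt v w \<equiv> cls (frag_of (v, w))"

text \<open>A bounded bilinear map extends to the algebraic tensor product.\<close>

lemma alg_tensor_lift:
  assumes Z: "seminormed_module R Z" and B: "0 \<le> B"
    and closed: "\<And>v w. v \<in> carrier V \<Longrightarrow> w \<in> carrier W \<Longrightarrow> \<beta> v w \<in> carrier Z"
    and add_l: "\<And>v v' w. v \<in> carrier V \<Longrightarrow> v' \<in> carrier V \<Longrightarrow> w \<in> carrier W \<Longrightarrow>
      \<beta> (v \<oplus>\<^bsub>V\<^esub> v') w = \<beta> v w \<oplus>\<^bsub>Z\<^esub> \<beta> v' w"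
    and add_r: "\<And>v w w'. v \<in> carrier V \<Longrightarrow> w \<in> carrier W \<Longrightarrow> w' \<in> carrier W \<Longrightarrow>
      \<beta> v (w \<oplus>\<^bsub>W\<^esub> w') = \<beta> v w \<oplus>\<^bsub>Z\<^esub> \<beta> v w'"
    and smult_l: "\<And>a v w. a \<in> carrier R \<Longrightarrow> v \<in> carrier V \<Longrightarrow> w \<in> carrier W \<Longrightarrow>
      \<beta> (a \<odot>\<^bsub>V\<^esub> v) w = a \<odot>\<^bsub>Z\<^esub> \<beta> v w"
    and smult_r: "\<And>a v w. a \<in> carrier R \<Longrightarrow> v \<in> carrier V \<Longrightarrow> w \<in> carrier W \<Longrightarrow>
      \<beta> v (a \<odot>\<^bsub>W\<^esub> w) = a \<odot>\<^bsub>Z\<^esub> \<beta> v w"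
    and bound: "\<And>v w. v \<in> carrier V \<Longrightarrow> w \<in> carrier W \<Longrightarrow> mnorm Z (\<beta> v w) \<le> B * (mnorm V v * mnorm W w)"
  shows "\<exists>H\<in>ban_hom R AT Z. \<forall>v\<in>carrier V. \<forall>w\<in>carrier W. H (pt v w) = \<beta> v w"
proof -
  interpret Z: seminormed_module R Z by fact
  define f where "f = (\<lambda>p. \<beta> (fst p) (snd p))"
  obtain h where h: "h \<in> hom (free_Abelian_group PS) (add_monoid Z)"
    and hf: "\<And>p. p \<in> PS \<Longrightarrow> h (frag_of p) = f p"
  proof (rule comm_group.free_Abelian_group_universal[OF Z.M.a_comm_group, of f PS])
    show "f ` PS \<subseteq> carrier (add_monoid Z)" using closed by (auto simp: f_def)
  qed blast
  have hc: "h z \<in> carrier Z" if "Poly_Mapping.keys z \<subseteq> PS" for z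
    using hom_in_carrier[OF h, of z] that by simp
  have hadd: "h (x + y) = h x \<oplus>\<^bsub>Z\<^esub> h y"
    if "Poly_Mapping.keys x \<subseteq> PS" "Poly_Mapping.keys y \<subseteq> PS" for x y
    using hom_mult[OF h, of x y] that by simp
  have h0: "h 0 = \<zero>\<^bsub>Z\<^esub>"
    using hadd[of 0 0] hc[of 0] Z.M.add.r_cancel_one'[of "h 0" "h 0"] by auto
  have hdiff: "h (x - y) = h x \<ominus>\<^bsub>Z\<^esub> h y"
    if xy: "Poly_Mapping.keys x \<subseteq> PS" "Poly_Mapping.keys y \<subseteq> PS" for x y
  proof -
    have "h x = h (x - y) \<oplus>\<^bsub>Z\<^esub> h y"
      using hadd[of "x - y" y] xy keys_minus_subset[OF xy] by simp
    then show ?thesis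
      using hc xy keys_minus_subset[OF xy] by (simp add: Z.M.minus_eq Z.M.a_assoc Z.M.r_neg)
  qed
  have hNN: "h z = \<zero>\<^bsub>Z\<^esub>" if "z \<in> NN" for z
    using that
  proof (induction rule: NN_induct)
    case (rel z)
    then show ?case
      unfolding tensor_rels_def
    proof (elim UnE CollectE exE conjE)
      fix v v' w assume c: "v \<in> carrier V" "v' \<in> carrier V" "w \<in> carrier W"
        and z: "z = frag_of (v \<oplus>\<^bsub>V\<^esub> v', w) - frag_of (v, w) - frag_of (v', w)"
      then show ?thesis
        using closed[of v w] closed[of v' w]
        by (simp add: hdiff keys_minus_subset hf f_def add_l Z.M.minus_eq Z.M.a_ac Z.M.r_neg Z.M.r_neg1 Z.M.r_neg2)
    next
      fix v w w' assume c: "v \<in> carrier V" "w \<in> carrier W" "w' \<in> carrier W"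
        and z: "z = frag_of (v, w \<oplus>\<^bsub>W\<^esub> w') - frag_of (v, w) - frag_of (v, w')"
      then show ?thesis
        using closed[of v w] closed[of v w']
        by (simp add: hdiff keys_minus_subset hf f_def add_r Z.M.minus_eq Z.M.a_ac Z.M.r_neg Z.M.r_neg1 Z.M.r_neg2)
    next
      fix a v w assume c: "a \<in> carrier R" "v \<in> carrier V" "w \<in> carrier W"
        and z: "z = frag_of (a \<odot>\<^bsub>V\<^esub> v, w) - frag_of (v, a \<odot>\<^bsub>W\<^esub> w)"
      then show ?thesis
        using closed[of v w] by (simp add: hdiff hf f_def smult_l smult_r Z.M.minus_eq Z.M.r_neg)
    qed
  next
    case (neg x)
    then show ?case using hdiff[of 0 x] NN_keys[of x] by (simp add: h0 Z.M.minus_eq Z.M.r_neg)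
  qed (simp_all add: h0 hadd NN_keys)
  define H where "H = (\<lambda>c\<in>carrier AT. h (SOME z. Poly_Mapping.keys z \<subseteq> PS \<and> cls z = c))"
  have H: "H (cls z) = h z" if z: "Poly_Mapping.keys z \<subseteq> PS" for z
  proof -
    define z' where "z' = (SOME z'. Poly_Mapping.keys z' \<subseteq> PS \<and> cls z' = cls z)"
    have z': "Poly_Mapping.keys z' \<subseteq> PS" "cls z' = cls z"
      using someI_ex[of "\<lambda>z'. Poly_Mapping.keys z' \<subseteq> PS \<and> cls z' = cls z"] z
      unfolding z'_def by blast+
    have "h z' \<ominus>\<^bsub>Z\<^esub> h z = \<zero>\<^bsub>Z\<^esub>"
      using hNN[of "z' - z"] hdiff[OF z'(1) z] z'(2) by (simp add: cls_eq_iff)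
    then have "h z' = h z"
      using Z.M.minus_add_cancel'[OF hc[OF z'(1)] hc[OF z]] hc[OF z] by simp
    then show ?thesis using cls_closed[OF z] by (simp add: H_def z'_def)
  qed
  have list: "h (\<Sum>p\<leftarrow>ps. frag_of p) \<in> carrier Z \<and> mnorm Z (h (\<Sum>p\<leftarrow>ps. frag_of p)) \<le> B * cost ps"
    if "set ps \<subseteq> PS" for ps
    using that
  proof (induction ps)
    case (Cons p ps)
    obtain v w where p: "p = (v, w)" by (cases p)
    have vw: "v \<in> carrier V" "w \<in> carrier W" using Cons.prems p by auto
    have IH: "h (\<Sum>p\<leftarrow>ps. frag_of p) \<in> carrier Z" "mnorm Z (h (\<Sum>p\<leftarrow>ps. frag_of p)) \<le> B * cost ps"
      using Cons by auto
    have "h (\<Sum>p\<leftarrow>p # ps. frag_of p) = \<beta> v w \<oplus>\<^bsub>Z\<^esub> h (\<Sum>p\<leftarrow>ps. frag_of p)"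
      using Cons.prems keys_list[of ps] by (simp add: hadd hf f_def p)
    then show ?case
      using IH closed[OF vw] bound[OF vw] Z.norm_triangle[OF closed[OF vw] IH(1)]
      by (simp add: p algebra_simps)
  qed (simp add: h0 Z.norm_zero)
  have "H \<in> ban_hom R AT Z"
  proof (rule ban_homI)
    show "H \<in> carrier AT \<rightarrow>\<^sub>E carrier Z"
      using H hc by (auto simp: H_def carrier_AT)
    show "H (x \<oplus>\<^bsub>AT\<^esub> y) = H x \<oplus>\<^bsub>Z\<^esub> H y" if "x \<in> carrier AT" "y \<in> carrier AT" for x y
      using that by (elim carrier_ATE) (simp add: add_AT H hadd keys_plus_subset)
  next
    fix a x assume a: "a \<in> carrier R" and "x \<in> carrier AT"
    then obtain z where z: "Poly_Mapping.keys z \<subseteq> PS" "x = cls z" by (auto elim: carrier_ATE)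
    have "h (act a z) = a \<odot>\<^bsub>Z\<^esub> h z"
      using z(1)
    proof (induction rule: frag_induct_on)
      case (diff x y)
      then show ?case using a hc by (simp add: hdiff act_keys Z.smult_minus_distrib)
    next
      case (gen p)
      then show ?case using a by (cases p) (simp add: hf f_def smult_l)
    qed (simp add: h0 a)
    then show "H (a \<odot>\<^bsub>AT\<^esub> x) = a \<odot>\<^bsub>Z\<^esub> H x" using z a by (simp add: smult_AT H act_keys)
  next
    fix x assume x: "x \<in> carrier AT"
    show "mnorm Z (H x) \<le> B * mnorm AT x"
    proof (rule le_mult_epsilon[OF B])
      fix e :: real assume "e > 0"
      then obtain ps where ps: "set ps \<subseteq> PS" "lcls ps = x" "cost ps < mnorm AT x + e"
        using norm_near_list[OF x] by blast
      have "mnorm Z (H x) \<le> B * cost ps"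
        using list[OF ps(1)] H[OF keys_list[OF ps(1)]] ps(2) by (simp add: list_class_def)
      also have "\<dots> \<le> B * (mnorm AT x + e)" using ps(3) B by (intro mult_left_mono) auto
      finally show "mnorm Z (H x) \<le> B * (mnorm AT x + e)" .
    qed
  qed
  moreover have "H (pt v w) = \<beta> v w" if "v \<in> carrier V" "w \<in> carrier W" for v w
    using that by (simp add: H hf f_def)
  ultimately show ?thesis by blast
qed

end

section \<open>Separated completions\<close>

locale completed = seminormed_module R M
  for R :: "('a, 'x) nring_scheme" (structure) and M :: "('a, 'b) nmodule" (structure)
begin

abbreviation "cauchy \<equiv> ncauchy M (mnorm M)"
abbreviation "CM \<equiv> completion M"

text \<open>The point of the completion represented by a Cauchy sequence.\<close>

definition cl :: "(nat \<Rightarrow> 'b) \<Rightarrow> (nat \<Rightarrow> 'b) set" where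
  "cl x = null_rel M `` {x}"

lemma null_rel_iff: "(x, y) \<in> null_rel M \<longleftrightarrow> cauchy x \<and> cauchy y \<and> asymp_eq M x y"
  by (simp add: null_rel_def asymp_eq_def)

lemma null_rel_equiv: "equiv {x. cauchy x} (null_rel M)"
proof (rule equivI)
  show "null_rel M \<subseteq> {x. cauchy x} \<times> {x. cauchy x}" by (auto simp: null_rel_iff)
  show "refl_on {x. cauchy x} (null_rel M)"
    by (intro refl_onI) (simp add: null_rel_iff asymp_eq_refl ncauchy_range)
  show "sym (null_rel M)"
  proof (rule symI)
    fix x y assume "(x, y) \<in> null_rel M"
    then show "(y, x) \<in> null_rel M"
      using asymp_eq_sym[of x y] by (simp add: null_rel_iff ncauchy_range)
  qed
  show "trans (null_rel M)"
  proof (rule transI)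
    fix x y z assume "(x, y) \<in> null_rel M" "(y, z) \<in> null_rel M"
    then show "(x, z) \<in> null_rel M"
      using asymp_eq_trans[of x y z] by (simp add: null_rel_iff ncauchy_range)
  qed
qed

lemma cl_eq_iff: "cauchy x \<Longrightarrow> cauchy y \<Longrightarrow> cl x = cl y \<longleftrightarrow> asymp_eq M x y"
  using eq_equiv_class_iff[OF null_rel_equiv, of x y] by (simp add: cl_def null_rel_iff)

lemma mem_cl_iff: "y \<in> cl x \<longleftrightarrow> cauchy x \<and> cauchy y \<and> asymp_eq M x y"
  by (simp add: cl_def null_rel_iff)

lemma self_mem_cl: "cauchy x \<Longrightarrow> x \<in> cl x"
  by (simp add: mem_cl_iff asymp_eq_refl ncauchy_range)

lemma carrier_CM: "carrier CM = cl ` {x. cauchy x}"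
  by (auto simp: completion_def quotient_def cl_def)

lemma carrier_CME:
  assumes "A \<in> carrier CM"
  obtains x where "cauchy x" "A = cl x"
  using assms by (auto simp: carrier_CM)

lemma cl_closed: "cauchy x \<Longrightarrow> cl x \<in> carrier CM"
  by (simp add: carrier_CM)

lemma UN_cl_const:
  assumes "cauchy x" "\<And>x'. x' \<in> cl x \<Longrightarrow> f x' = c"
  shows "(\<Union>x'\<in>cl x. f x') = c"
  using assms(2) self_mem_cl[OF assms(1)] by auto

lemma add_CM:
  assumes x: "cauchy x" and y: "cauchy y"
  shows "cl x \<oplus>\<^bsub>CM\<^esub> cl y = cl (\<lambda>n. x n \<oplus>\<^bsub>M\<^esub> y n)"
proof -
  have "cl x \<oplus>\<^bsub>CM\<^esub> cl y = (\<Union>x'\<in>cl x. \<Union>y'\<in>cl y. cl (\<lambda>n. x' n \<oplus>\<^bsub>M\<^esub> y' n))"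
    by (simp add: completion_def cl_def)
  also have "\<dots> = cl (\<lambda>n. x n \<oplus>\<^bsub>M\<^esub> y n)"
  proof (intro UN_cl_const x y)
    fix x' y' assume "x' \<in> cl x" "y' \<in> cl y"
    then have c: "cauchy x'" "cauchy y'" "asymp_eq M x x'" "asymp_eq M y y'"
      by (simp_all add: mem_cl_iff)
    then have "asymp_eq M (\<lambda>n. x n \<oplus>\<^bsub>M\<^esub> y n) (\<lambda>n. x' n \<oplus>\<^bsub>M\<^esub> y' n)"
      using x y by (intro asymp_eq_add ncauchy_range)
    then show "cl (\<lambda>n. x' n \<oplus>\<^bsub>M\<^esub> y' n) = cl (\<lambda>n. x n \<oplus>\<^bsub>M\<^esub> y n)"
      using cl_eq_iff[OF ncauchy_add[OF x y] ncauchy_add[OF c(1,2)]] by simp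
  qed
  finally show ?thesis .
qed

lemma smult_CM:
  assumes x: "cauchy x" and a: "a \<in> carrier R"
  shows "a \<odot>\<^bsub>CM\<^esub> cl x = cl (\<lambda>n. a \<odot>\<^bsub>M\<^esub> x n)"
proof -
  have "a \<odot>\<^bsub>CM\<^esub> cl x = (\<Union>x'\<in>cl x. cl (\<lambda>n. a \<odot>\<^bsub>M\<^esub> x' n))"
    by (simp add: completion_def cl_def)
  also have "\<dots> = cl (\<lambda>n. a \<odot>\<^bsub>M\<^esub> x n)"
  proof (intro UN_cl_const x)
    fix x' assume "x' \<in> cl x"
    then have c: "cauchy x'" "asymp_eq M x x'" by (simp_all add: mem_cl_iff)
    then have "asymp_eq M (\<lambda>n. a \<odot>\<^bsub>M\<^esub> x n) (\<lambda>n. a \<odot>\<^bsub>M\<^esub> x' n)"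
      using x a by (intro asymp_eq_smult ncauchy_range)
    then show "cl (\<lambda>n. a \<odot>\<^bsub>M\<^esub> x' n) = cl (\<lambda>n. a \<odot>\<^bsub>M\<^esub> x n)"
      using cl_eq_iff[OF ncauchy_smult[OF x a] ncauchy_smult[OF c(1) a]] by simp
  qed
  finally show ?thesis .
qed

lemma norm_CM:
  assumes x: "cauchy x"
  shows "(\<lambda>n. mnorm M (x n)) \<longlonglongrightarrow> mnorm CM (cl x)"
proof -
  obtain l where l: "(\<lambda>n. mnorm M (x n)) \<longlonglongrightarrow> l"
    using ncauchy_norm_convergent[OF x] unfolding convergent_def by blast
  have "mnorm CM (cl x) = (THE l. \<forall>y\<in>cl x. (\<lambda>n. mnorm M (y n)) \<longlonglongrightarrow> l)"
    by (simp add: completion_def)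
  also have "\<dots> = l"
  proof (rule the_equality)
    show "\<forall>y\<in>cl x. (\<lambda>n. mnorm M (y n)) \<longlonglongrightarrow> l"
    proof
      fix y assume "y \<in> cl x"
      then have "cauchy y" "asymp_eq M y x"
        using asymp_eq_sym[of x y] by (simp_all add: mem_cl_iff ncauchy_range)
      then show "(\<lambda>n. mnorm M (y n)) \<longlonglongrightarrow> l"
        using asymp_eq_norm_tendsto[of y x l] ncauchy_range x l by blast
    qed
    show "l' = l" if "\<forall>y\<in>cl x. (\<lambda>n. mnorm M (y n)) \<longlonglongrightarrow> l'" for l'
      using that self_mem_cl[OF x] l LIMSEQ_unique by blast
  qed
  finally show ?thesis using l by simp
qed

lemma norm_CM_le:
  assumes x: "cauchy x" and le: "\<And>n. n \<ge> n0 \<Longrightarrow> mnorm M (x n) \<le> B"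
  shows "mnorm CM (cl x) \<le> B"
  by (rule LIMSEQ_le_const2[OF norm_CM[OF x]]) (use le in blast)

lemma norm_CM_nonneg: "cauchy x \<Longrightarrow> 0 \<le> mnorm CM (cl x)"
  by (rule LIMSEQ_le_const[OF norm_CM]) (use ncauchy_range norm_nonneg in blast)+

text \<open>The map from the ring to the completion that corresponds to an element \<open>t\<close>.\<close>

lemma smult_hom:
  assumes t: "t \<in> carrier CM"
  shows "(\<lambda>a\<in>carrier R. a \<odot>\<^bsub>CM\<^esub> t) \<in> ban_hom R (self_module R) CM"
proof -
  obtain x where x: "cauchy x" "t = cl x" using t by (rule carrier_CME)
  have xc: "x n \<in> carrier M" for n using ncauchy_range[OF x(1)] by auto
  obtain C where C: "C > 0" "\<And>a x. a \<in> carrier R \<Longrightarrow> x \<in> carrier M \<Longrightarrow>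
      mnorm M (a \<odot>\<^bsub>M\<^esub> x) \<le> C * rnorm R a * mnorm M x"
    using norm_smult_ex by blast
  show ?thesis
  proof (rule ban_homI)
    show "(\<lambda>a\<in>carrier R. a \<odot>\<^bsub>CM\<^esub> t) \<in> carrier (self_module R) \<rightarrow>\<^sub>E carrier CM"
      using x by (auto simp: smult_CM ncauchy_smult cl_closed)
  next
    fix a b assume "a \<in> carrier (self_module R)" "b \<in> carrier (self_module R)"
    then show "(\<lambda>a\<in>carrier R. a \<odot>\<^bsub>CM\<^esub> t) (a \<oplus>\<^bsub>self_module R\<^esub> b) =
        (\<lambda>a\<in>carrier R. a \<odot>\<^bsub>CM\<^esub> t) a \<oplus>\<^bsub>CM\<^esub> (\<lambda>a\<in>carrier R. a \<odot>\<^bsub>CM\<^esub> t) b"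
      using x xc by (simp add: smult_CM add_CM ncauchy_smult smult_l_distr)
  next
    fix a b assume "a \<in> carrier R" "b \<in> carrier (self_module R)"
    then show "(\<lambda>a\<in>carrier R. a \<odot>\<^bsub>CM\<^esub> t) (a \<odot>\<^bsub>self_module R\<^esub> b) =
        a \<odot>\<^bsub>CM\<^esub> (\<lambda>a\<in>carrier R. a \<odot>\<^bsub>CM\<^esub> t) b"
      using x xc by (simp add: smult_CM ncauchy_smult smult_assoc1)
  next
    fix a assume "a \<in> carrier (self_module R)"
    then have a: "a \<in> carrier R" by simp
    have "mnorm CM (cl (\<lambda>n. a \<odot>\<^bsub>M\<^esub> x n)) \<le> C * rnorm R a * mnorm CM (cl x)"
      by (rule LIMSEQ_le[OF norm_CM[OF ncauchy_smult[OF x(1) a]]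
            tendsto_mult_left[OF norm_CM[OF x(1)]]]) (use C(2)[OF a xc] in blast)
    then show "mnorm CM ((\<lambda>a\<in>carrier R. a \<odot>\<^bsub>CM\<^esub> t) a) \<le> (C * mnorm CM (cl x)) * mnorm (self_module R) a"
      using a x by (simp add: smult_CM algebra_simps)
  qed
qed

text \<open>Extension of a bounded linear map to the completion by continuity.\<close>

lemma completion_lift:
  assumes Z: "banach_mod R Z" and H: "H \<in> ban_hom R M Z"
  shows "\<exists>h\<in>ban_hom R CM Z. \<forall>x. cauchy x \<longrightarrow> asymp_eq Z (\<lambda>n. H (x n)) (\<lambda>_. h (cl x))"
proof -
  interpret Z: banach_mod R Z by (rule Z)
  note SM = seminormed_module_axioms and SZ = Z.seminormed_module_axioms
  note Hc = ban_homD(2)[OF H]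
  have Hr: "range (\<lambda>n. H (x n)) \<subseteq> carrier Z" if "cauchy x" for x
    using ncauchy_range[OF that] Hc by auto
  have lim: "\<exists>l\<in>carrier Z. asymp_eq Z (\<lambda>n. H (x n)) (\<lambda>_. l)" if "cauchy x" for x
    using Z.complete[OF ban_hom_ncauchy[OF SM SZ H that]] by blast
  define h where "h = (\<lambda>A\<in>carrier CM. SOME l. l \<in> carrier Z \<and>
    (\<exists>x. cauchy x \<and> A = cl x \<and> asymp_eq Z (\<lambda>n. H (x n)) (\<lambda>_. l)))"
  have h: "h (cl x) \<in> carrier Z \<and> asymp_eq Z (\<lambda>n. H (x n)) (\<lambda>_. h (cl x))" if x: "cauchy x" for x
  proof -
    let ?P = "\<lambda>l. l \<in> carrier Z \<and> (\<exists>y. cauchy y \<and> cl x = cl y \<and> asymp_eq Z (\<lambda>n. H (y n)) (\<lambda>_. l))"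
    have "\<exists>l. ?P l" using lim[OF x] x by blast
    then have "?P (SOME l. ?P l)" by (rule someI_ex)
    moreover have "(SOME l. ?P l) = h (cl x)" using cl_closed[OF x] by (simp add: h_def)
    ultimately have "?P (h (cl x))" by (simp only:)
    then obtain y where y: "h (cl x) \<in> carrier Z" "cauchy y" "cl x = cl y"
      "asymp_eq Z (\<lambda>n. H (y n)) (\<lambda>_. h (cl x))" by blast
    have "asymp_eq M x y" using cl_eq_iff[OF x y(2)] y(3) by simp
    then have "asymp_eq Z (\<lambda>n. H (x n)) (\<lambda>n. H (y n))"
      using x y(2) by (intro ban_hom_asymp_eq[OF SM SZ H] ncauchy_range)
    then show ?thesis
      using Z.asymp_eq_trans[OF Hr[OF x] Hr[OF y(2)] _ _ y(4)] y(1) by auto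
  qed
  have uniq: "h (cl x) = l" if "cauchy x" "l \<in> carrier Z" "asymp_eq Z (\<lambda>n. H (x n)) (\<lambda>_. l)" for x l
    using Z.limit_unique[OF Hr[OF that(1)] _ that(2) _ that(3)] h[OF that(1)] by blast
  obtain B where B: "B > 0" "\<And>x. x \<in> carrier M \<Longrightarrow> mnorm Z (H x) \<le> B * mnorm M x"
    using ban_hom_bounded[OF H norm_nonneg] by blast
  have "h \<in> ban_hom R CM Z"
  proof (rule ban_homI)
    show "h \<in> carrier CM \<rightarrow>\<^sub>E carrier Z"
      using h by (auto simp: carrier_CM) (auto simp: h_def carrier_CM)
  next
    fix s t assume "s \<in> carrier CM" "t \<in> carrier CM"
    then obtain x y where x: "cauchy x" "s = cl x" and y: "cauchy y" "t = cl y"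
      by (auto elim!: carrier_CME)
    have xc: "x n \<in> carrier M" "y n \<in> carrier M" for n
      using ncauchy_range x(1) y(1) by blast+
    have "asymp_eq Z (\<lambda>n. H (x n) \<oplus>\<^bsub>Z\<^esub> H (y n)) (\<lambda>_. h (cl x) \<oplus>\<^bsub>Z\<^esub> h (cl y))"
      using h[OF x(1)] h[OF y(1)] Hr[OF x(1)] Hr[OF y(1)] by (intro Z.asymp_eq_add) auto
    then have "h (cl (\<lambda>n. x n \<oplus>\<^bsub>M\<^esub> y n)) = h (cl x) \<oplus>\<^bsub>Z\<^esub> h (cl y)"
      using h[OF x(1)] h[OF y(1)] by (intro uniq ncauchy_add x y) (auto simp: ban_homD(3)[OF H xc])
    then show "h (s \<oplus>\<^bsub>CM\<^esub> t) = h s \<oplus>\<^bsub>Z\<^esub> h t" using x y by (simp add: add_CM)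
  next
    fix a t assume a: "a \<in> carrier R" and "t \<in> carrier CM"
    then obtain x where x: "cauchy x" "t = cl x" by (auto elim!: carrier_CME)
    have xc: "x n \<in> carrier M" for n using ncauchy_range x(1) by blast
    have "asymp_eq Z (\<lambda>n. a \<odot>\<^bsub>Z\<^esub> H (x n)) (\<lambda>_. a \<odot>\<^bsub>Z\<^esub> h (cl x))"
      using h[OF x(1)] Hr[OF x(1)] a by (intro Z.asymp_eq_smult) auto
    then have "h (cl (\<lambda>n. a \<odot>\<^bsub>M\<^esub> x n)) = a \<odot>\<^bsub>Z\<^esub> h (cl x)"
      using h[OF x(1)] a by (intro uniq ncauchy_smult x) (auto simp: ban_homD(4)[OF H a xc])
    then show "h (a \<odot>\<^bsub>CM\<^esub> t) = a \<odot>\<^bsub>Z\<^esub> h t" using x a by (simp add: smult_CM)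
  next
    fix t assume "t \<in> carrier CM"
    then obtain x where x: "cauchy x" "t = cl x" by (rule carrier_CME)
    have "mnorm Z (h (cl x)) \<le> B * mnorm CM (cl x)"
    proof (rule Z.norm_limit_le[OF Hr[OF x(1)]])
      show "(\<lambda>n. B * mnorm M (x n)) \<longlonglongrightarrow> B * mnorm CM (cl x)"
        by (rule tendsto_mult_left[OF norm_CM[OF x(1)]])
      show "mnorm Z (H (x n)) \<le> B * mnorm M (x n)" for n
        using B(2) ncauchy_range[OF x(1)] by blast
    qed (use h[OF x(1)] in auto)
    then show "mnorm Z (h t) \<le> B * mnorm CM t" using x by simp
  qed
  then show ?thesis using h by blast
qed

text \<open>A bounded linear map on the completion is determined by its values on constant sequences: the
  class of a Cauchy sequence \<open>x\<close> is the limit of the classes of the constant sequences \<open>x n\<close>.\<close>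

lemma completion_dense:
  assumes Z: "banach_mod R Z" and h: "h \<in> ban_hom R CM Z" and x: "cauchy x"
  shows "asymp_eq Z (\<lambda>n. h (cl (\<lambda>_. x n))) (\<lambda>_. h (cl x))"
proof -
  interpret Z: banach_mod R Z by (rule Z)
  have xc: "x n \<in> carrier M" for n using ncauchy_range x by blast
  have nn: "0 \<le> mnorm CM t" if "t \<in> carrier CM" for t
    using that by (auto elim!: carrier_CME simp: norm_CM_nonneg)
  obtain C where C: "C > 0" "\<And>t. t \<in> carrier CM \<Longrightarrow> mnorm Z (h t) \<le> C * mnorm CM t"
    using ban_hom_bounded[OF h nn] by blast
  have hc: "h (cl y) \<in> carrier Z" if "cauchy y" for y
    using ban_homD(2)[OF h cl_closed[OF that]] .
  define d where "d n = (\<lambda>m. x m \<ominus>\<^bsub>M\<^esub> x n)" for n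
  have d: "cauchy (d n)" for n
    unfolding d_def M.minus_eq using xc by (intro ncauchy_add x ncauchy_const) auto
  have "h (cl x) \<ominus>\<^bsub>Z\<^esub> h (cl (\<lambda>_. x n)) = h (cl (d n))" for n
  proof -
    have "cl x = cl (d n) \<oplus>\<^bsub>CM\<^esub> cl (\<lambda>_. x n)"
      using xc by (simp add: add_CM d ncauchy_const) (simp add: d_def M.minus_add_cancel')
    then have "h (cl x) = h (cl (d n)) \<oplus>\<^bsub>Z\<^esub> h (cl (\<lambda>_. x n))"
      using ban_homD(3)[OF h cl_closed[OF d] cl_closed[OF ncauchy_const[OF xc]]] by simp
    then show ?thesis using hc[OF d, of n] hc[OF ncauchy_const[OF xc], of n]
      by (simp add: Z.M.minus_eq Z.M.a_assoc Z.M.r_neg)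
  qed
  then have eq: "mnorm Z (h (cl x) \<ominus>\<^bsub>Z\<^esub> h (cl (\<lambda>_. x n))) \<le> C * mnorm CM (cl (d n))" for n
    using C(2)[OF cl_closed[OF d]] by simp
  have "(\<lambda>n. C * mnorm CM (cl (d n))) \<longlonglongrightarrow> 0"
  proof (rule tendsto_mult_right_zero, unfold LIMSEQ_iff, intro allI impI)
    fix e :: real assume e: "e > 0"
    then obtain n0 where n0: "\<And>m n. m \<ge> n0 \<Longrightarrow> n \<ge> n0 \<Longrightarrow> mnorm M (x m \<ominus>\<^bsub>M\<^esub> x n) < e / 2"
      using ncauchyD[OF x, of "e / 2"] by auto
    have "norm (mnorm CM (cl (d n)) - 0) < e" if n: "n \<ge> n0" for n
    proof -
      have "mnorm CM (cl (d n)) \<le> e / 2"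
        by (rule norm_CM_le[OF d, of n0]) (use n0[OF _ n] in \<open>simp add: d_def less_imp_le\<close>)
      then show ?thesis using e norm_CM_nonneg[OF d, of n] by simp
    qed
    then show "\<exists>no. \<forall>n\<ge>no. norm (mnorm CM (cl (d n)) - 0) < e" by blast
  qed
  then have "asymp_eq Z (\<lambda>_. h (cl x)) (\<lambda>n. h (cl (\<lambda>_. x n)))"
    unfolding asymp_eq_def
    by (rule null_seq_le[rotated 2])
      (use eq hc x ncauchy_const[OF xc] in \<open>auto intro!: Z.norm_nonneg\<close>)
  then show ?thesis
    by (rule Z.asymp_eq_sym[rotated 2]) (use hc x ncauchy_const[OF xc] in auto)
qed

lemma completion_hom_eqI:
  assumes Z: "banach_mod R Z" and h: "h \<in> ban_hom R CM Z" and h': "h' \<in> ban_hom R CM Z"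
    and eq: "\<And>c. c \<in> carrier M \<Longrightarrow> h (cl (\<lambda>_. c)) = h' (cl (\<lambda>_. c))"
  shows "h = h'"
proof (rule ban_hom_eqI[OF h h'])
  interpret Z: banach_mod R Z by (rule Z)
  fix t assume "t \<in> carrier CM"
  then obtain x where x: "cauchy x" "t = cl x" by (rule carrier_CME)
  have xc: "x n \<in> carrier M" for n using ncauchy_range x(1) by blast
  have c: "cl x \<in> carrier CM" "cl (\<lambda>_. x n) \<in> carrier CM" for n
    using x(1) xc by (auto intro!: cl_closed ncauchy_const)
  have "asymp_eq Z (\<lambda>n. h (cl (\<lambda>_. x n))) (\<lambda>_. h' (cl x))"
    using completion_dense[OF Z h' x(1)] by (simp add: eq xc)
  then show "h t = h' t"
    using Z.limit_unique[OF _ _ _ completion_dense[OF Z h x(1)]] ban_homD(2)[OF h] ban_homD(2)[OF h']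
      c x(2) by blast
qed

end

section \<open>Series expansion in the completed tensor product\<close>

context tensor_pair
begin

sublocale C: completed R AT
  by (rule completed.intro[OF seminormed_AT])

lemma ctensor_eq: "ctensor R V W = completion AT"
  by (simp add: ctensor_def)

lemma pure_tensor_eq: "pure_tensor R V W v w = C.cl (\<lambda>_. pt v w)"
  by (simp add: pure_tensor_def C.cl_def)

lemma pt_closed: "v \<in> carrier V \<Longrightarrow> w \<in> carrier W \<Longrightarrow> pt v w \<in> carrier AT"
  by (rule cls_closed) simp

lemma lcls_single: "lcls [p] = cls (frag_of p)"
  by (simp add: list_class_def)

lemma pt_lcls: "pt v w = lcls [(v, w)]"
  by (simp add: lcls_single)

lemma pt_norm_le: "v \<in> carrier V \<Longrightarrow> w \<in> carrier W \<Longrightarrow> mnorm AT (pt v w) \<le> mnorm V v * mnorm W w"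
  using norm_le_cost[of "[(v, w)]"] by (simp add: pt_lcls)

lemma pt_zero: "pt \<zero>\<^bsub>V\<^esub> \<zero>\<^bsub>W\<^esub> = \<zero>\<^bsub>AT\<^esub>"
proof -
  have "frag_of (\<zero>\<^bsub>V\<^esub> \<oplus>\<^bsub>V\<^esub> \<zero>\<^bsub>V\<^esub>, \<zero>\<^bsub>W\<^esub>) - frag_of (\<zero>\<^bsub>V\<^esub>, \<zero>\<^bsub>W\<^esub>) - frag_of (\<zero>\<^bsub>V\<^esub>, \<zero>\<^bsub>W\<^esub>) \<in> NN"
    by (intro rel_add_left) auto
  then have "0 - frag_of (\<zero>\<^bsub>V\<^esub>, \<zero>\<^bsub>W\<^esub>) \<in> NN" by simp
  then show ?thesis unfolding zero_AT using cls_eq_iff[of 0 "frag_of (\<zero>\<^bsub>V\<^esub>, \<zero>\<^bsub>W\<^esub>)"] by blast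
qed

lemma hom_eq_on_pure:
  assumes Z: "module R Z" and H: "H \<in> ban_hom R AT Z" and H': "H' \<in> ban_hom R AT Z"
    and eq: "\<And>v w. v \<in> carrier V \<Longrightarrow> w \<in> carrier W \<Longrightarrow> H (pt v w) = H' (pt v w)"
  shows "H = H'"
proof (rule ban_hom_eqI[OF H H'])
  fix x assume "x \<in> carrier AT"
  then obtain ps where ps: "set ps \<subseteq> PS" "lcls ps = x" using ex_list by blast
  have "H (lcls ps) = H' (lcls ps)"
    using ps(1)
  proof (induction ps)
    case Nil
    then show ?case
      using ban_hom_zero[OF H module_AT Z] ban_hom_zero[OF H' module_AT Z] by (simp add: lcls_Nil)
  next
    case (Cons p ps)
    obtain v w where p: "p = (v, w)" by (cases p)
    have vw: "v \<in> carrier V" "w \<in> carrier W" using Cons.prems p by auto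
    have "lcls (p # ps) = pt v w \<oplus>\<^bsub>AT\<^esub> lcls ps" using lcls_append[of "[p]" ps] by (simp add: pt_lcls p)
    then show ?case
      using Cons vw by (simp add: ban_homD(3)[OF H] ban_homD(3)[OF H'] pt_closed lcls_closed eq)
  qed
  then show "H x = H' x" using ps(2) by simp
qed

lemma psum_pt: "psum AT (\<lambda>k. pt (fst (p k)) (snd (p k))) n = lcls (map p [0..<n])"
  by (induction n) (simp_all add: lcls_Nil lcls_append lcls_single)

lemma ncauchy_psum_pt:
  assumes "\<And>k. v k \<in> carrier V" "\<And>k. w k \<in> carrier W" "summable (\<lambda>k. mnorm V (v k) * mnorm W (w k))"
  shows "C.cauchy (psum AT (\<lambda>k. pt (v k) (w k)))"
  by (rule C.ncauchy_psum[OF _ _ assms(3)]) (use assms(1,2) in \<open>simp_all add: pt_closed pt_norm_le\<close>)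

text \<open>Every element of the completed tensor product is an absolutely convergent series of pure
  tensors.  A Cauchy sequence of tensors has a subsequence \<open>x \<circ> r\<close> whose successive differences
  have seminorm less than \<open>2\<^sup>-\<^sup>k\<close>.  These differences are finite sums of pure tensors of cost less
  than \<open>2\<^sup>-\<^sup>k\<close>, and the concatenation of these finite sums is the required series; along the ends
  of the blocks its partial sums are the \<open>x (r k)\<close>.\<close>

lemma series_expansion:
  assumes t: "t \<in> carrier (ctensor R V W)"
  shows "\<exists>v w. (\<forall>k. v k \<in> carrier V) \<and> (\<forall>k. w k \<in> carrier W) \<and>
    summable (\<lambda>k. mnorm V (v k) * mnorm W (w k)) \<and>
    t = C.cl (psum AT (\<lambda>k. pt (v k) (w k)))"
proof -
  obtain x where x: "C.cauchy x" "t = C.cl x"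
    using t unfolding ctensor_eq by (rule C.carrier_CME)
  have xc: "x n \<in> carrier AT" for n using C.ncauchy_range[OF x(1)] by auto
  obtain r where r: "strict_mono r"
    "\<And>k. mnorm AT (x (r (Suc k)) \<ominus>\<^bsub>AT\<^esub> x (r k)) < (1/2) ^ k"
    using C.ncauchy_fast_subseq[OF x(1), of "\<lambda>k. (1/2) ^ k"] by auto
  define D where "D k = (case k of 0 \<Rightarrow> x (r 0) | Suc j \<Rightarrow> x (r (Suc j)) \<ominus>\<^bsub>AT\<^esub> x (r j))" for k
  define c where "c k = (case k of 0 \<Rightarrow> mnorm AT (x (r 0)) + 1 | Suc j \<Rightarrow> (1/2) ^ j)" for k :: nat
  have "\<exists>ps. set ps \<subseteq> PS \<and> lcls ps = D k \<and> cost ps < c k" for k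
  proof -
    have "D k \<in> carrier AT" "mnorm AT (D k) < c k"
      using r(2) xc by (auto simp: D_def c_def split: nat.split)
    then show ?thesis using norm_less_list by metis
  qed
  then have "\<exists>ps. \<forall>k. set (ps k) \<subseteq> PS \<and> lcls (ps k) = D k \<and> cost (ps k) < c k"
    by (intro choice) blast
  then obtain ps where ps: "\<And>k. set (ps k) \<subseteq> PS" "\<And>k. lcls (ps k) = D k" "\<And>k. cost (ps k) < c k"
    by blast
  \<comment> \<open>A pair of zeros makes every block nonempty, so that the concatenation is an infinite sequence.\<close>
  define qs where "qs k = ps k @ [(\<zero>\<^bsub>V\<^esub>, \<zero>\<^bsub>W\<^esub>)]" for k
  have qs: "set (qs k) \<subseteq> PS" "lcls (qs k) = D k" "cost (qs k) < c k" "length (qs k) \<ge> 1" for k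
  proof -
    have "D k \<in> carrier AT" using lcls_closed[OF ps(1)[of k]] ps(2)[of k] by simp
    then show "lcls (qs k) = D k"
      using ps(2)[of k] by (simp add: qs_def lcls_append flip: pt_lcls) (simp add: pt_zero)
  qed (use ps(1,3)[of k] in \<open>auto simp: qs_def V.norm_zero\<close>)
  define Q where "Q k = concat (map qs [0..<k])" for k
  have Q_Suc: "Q (Suc k) = Q k @ qs k" for k by (simp add: Q_def)
  have Q_set: "set (Q k) \<subseteq> PS" for k using qs(1) by (auto simp: Q_def)
  have Q_len: "length (Q k) \<ge> k" for k
  proof (induction k)
    case (Suc k)
    then show ?case using qs(4)[of k] by (simp add: Q_Suc)
  qed simp
  have Q_cls: "lcls (Q (Suc k)) = x (r k)" for k
  proof (induction k)
    case 0
    then show ?case using xc by (simp add: Q_def qs(2) D_def)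
  next
    case (Suc k)
    then show ?case
      unfolding Q_Suc[of "Suc k"] lcls_append qs(2)
      using A.M.minus_add_cancel'[OF xc xc, of "r (Suc k)" "r k"]
        A.M.a_comm[OF A.M.minus_closed[OF xc xc] xc, of "r (Suc k)" "r k" "r k"]
      by (simp add: D_def)
  qed
  have Q_cost: "cost (Q k) \<le> (\<Sum>i<k. c i)" for k
  proof (induction k)
    case (Suc k)
    then show ?case using qs(3)[of k] by (simp add: Q_Suc)
  qed (simp add: Q_def)
  have Q_app: "\<exists>rest. Q (k + d) = Q k @ rest" for k d
    by (induction d) (auto simp: Q_Suc)
  have Q_nth: "Q l ! i = Q k ! i" if "k \<le> l" "i < length (Q k)" for k l i
    using Q_app[of k "l - k"] that by (auto simp: nth_append)
  \<comment> \<open>The lists \<open>Q k\<close> are prefixes of each other, and \<open>Q (Suc n)\<close> is long enough to have an entry \<open>n\<close>.\<close>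
  define p where "p n = Q (Suc n) ! n" for n
  have p: "p n \<in> PS" for n
    using Q_set[of "Suc n"] Q_len[of "Suc n"] nth_mem[of n "Q (Suc n)"] unfolding p_def by force
  have Q_map: "Q k = map p [0..<length (Q k)]" for k
  proof (rule nth_equalityI)
    fix i assume i: "i < length (Q k)"
    have "Q k ! i = p i"
    proof (cases "k \<le> Suc i")
      case True
      then show ?thesis using Q_nth[OF True i] by (simp add: p_def)
    next
      case False
      then show ?thesis using Q_nth[of "Suc i" k i] Q_len[of "Suc i"] by (simp add: p_def)
    qed
    then show "Q k ! i = map p [0..<length (Q k)] ! i" using i by simp
  qed simp
  define v where "v k = fst (p k)" for k
  define w where "w k = snd (p k)" for k
  have vw: "v k \<in> carrier V" "w k \<in> carrier W" for k using p[of k] by (auto simp: v_def w_def)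
  define y where "y = psum AT (\<lambda>k. pt (v k) (w k))"
  have y: "y n = lcls (map p [0..<n])" for n
    unfolding y_def v_def w_def by (rule psum_pt)
  have sum_cost: "(\<Sum>i<n. mnorm V (v i) * mnorm W (w i)) = cost (map p [0..<n])" for n
    by (induction n) (simp_all add: v_def w_def)
  have c_sum: "summable c"
  proof -
    have "summable (\<lambda>k. c (Suc k))" by (simp add: c_def summable_geometric)
    then show ?thesis by (simp add: summable_Suc_iff)
  qed
  have c_pos: "0 \<le> c k" for k using C.norm_nonneg[OF xc] by (simp add: c_def split: nat.split)
  have summ: "summable (\<lambda>k. mnorm V (v k) * mnorm W (w k))"
  proof (rule summableI_nonneg_bounded)
    show "0 \<le> mnorm V (v n) * mnorm W (w n)" for n
      using vw by (simp add: V.norm_nonneg W.norm_nonneg)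
    fix n
    have "(\<Sum>i<n. mnorm V (v i) * mnorm W (w i)) \<le> (\<Sum>i<length (Q n). mnorm V (v i) * mnorm W (w i))"
      using Q_len[of n] vw by (intro sum_mono2) (auto simp: V.norm_nonneg W.norm_nonneg)
    also have "\<dots> = cost (Q n)"
      unfolding sum_cost[of "length (Q n)"] Q_map[of n, symmetric] ..
    also have "\<dots> \<le> (\<Sum>i<n. c i)" by (rule Q_cost)
    also have "\<dots> \<le> suminf c" using c_sum c_pos by (intro sum_le_suminf) auto
    finally show "(\<Sum>i<n. mnorm V (v i) * mnorm W (w i)) \<le> suminf c" .
  qed
  have ycau: "C.cauchy y" unfolding y_def by (rule ncauchy_psum_pt[OF vw summ])
  define s where "s k = length (Q (Suc k))" for k
  have s: "strict_mono s"
  proof (rule strict_monoI_Suc)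
    show "s k < s (Suc k)" for k using qs(4)[of "Suc k"] unfolding s_def Q_Suc[of "Suc k"] by (cases "qs (Suc k)") simp_all
  qed
  have "y (s k) = x (r k)" for k
    using Q_cls[of k] Q_map[of "Suc k"] by (simp add: y s_def)
  then have ys: "y \<circ> s = x \<circ> r" by auto
  have "asymp_eq AT x y"
  proof (rule C.asymp_eq_trans)
    show "asymp_eq AT x (x \<circ> r)"
      using C.asymp_eq_sym[OF C.ncauchy_range[OF C.ncauchy_subseq(1)[OF x(1) r(1)]]
          C.ncauchy_range[OF x(1)] C.ncauchy_subseq(2)[OF x(1) r(1)]] .
    show "asymp_eq AT (x \<circ> r) y"
      using C.ncauchy_subseq(2)[OF ycau s] unfolding ys .
    show "range x \<subseteq> carrier AT" "range (x \<circ> r) \<subseteq> carrier AT" "range y \<subseteq> carrier AT"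
      using C.ncauchy_range[OF x(1)] C.ncauchy_range[OF ycau]
        C.ncauchy_range[OF C.ncauchy_subseq(1)[OF x(1) r(1)]] by blast+
  qed
  then have "t = C.cl y" using C.cl_eq_iff[OF x(1) ycau] x(2) by simp
  then show ?thesis using vw summ unfolding y_def by blast
qed

end

section \<open>Nuclear morphisms as absolutely convergent series\<close>

text \<open>The morphism \<open>f\<close> is the sum \<open>\<Sum>\<^sub>k \<phi>\<^sub>k(x) w\<^sub>k\<close> of an absolutely convergent series of rank one
  operators; the convergence to \<open>f\<close> is only required pointwise.\<close>

definition nuclear_series :: "('a, 'x) nring_scheme \<Rightarrow> ('a, 'b) nmodule \<Rightarrow> ('a, 'c) nmodule \<Rightarrow>
    ('b \<Rightarrow> 'c) \<Rightarrow> (nat \<Rightarrow> 'b \<Rightarrow> 'a) \<Rightarrow> (nat \<Rightarrow> 'c) \<Rightarrow> bool" where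
  "nuclear_series R V W f \<phi> w \<longleftrightarrow> f \<in> ban_hom R V W \<and>
     (\<forall>k. \<phi> k \<in> carrier (dual R V)) \<and> (\<forall>k. w k \<in> carrier W) \<and>
     summable (\<lambda>k. mnorm (dual R V) (\<phi> k) * mnorm W (w k)) \<and>
     (\<forall>x\<in>carrier V. asymp_eq W (psum W (\<lambda>k. \<phi> k x \<odot>\<^bsub>W\<^esub> w k)) (\<lambda>_. f x))"

text \<open>For two Banach modules, \<open>\<beta> \<phi> w\<close> is the rank one operator \<open>x \<mapsto> \<phi>(x) w\<close>, and \<open>T\<close> qualifies the
  tensor product of the dual of \<open>V\<close> with \<open>W\<close>.\<close>

locale nuclear_pair = V: banach_mod R V + W: banach_mod R W
  for R :: "('a, 'x) nring_scheme" (structure) and V :: "('a, 'b) nmodule" and W :: "('a, 'c) nmodule"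
begin

lemma banach_mod_R: "banach_mod R (self_module R)"
  by (rule banach_mod_self_module[OF V.banach_ring])

sublocale VD: banach_hom R V "self_module R"
  by (rule banach_hom.intro[OF V.seminormed_module_axioms banach_mod_R])

sublocale VW: banach_hom R V W
  by (rule banach_hom.intro[OF V.seminormed_module_axioms W.banach_mod_axioms])

sublocale D: banach_mod R "dual R V"
  unfolding dual_def by (rule VD.banach_mod_ihom)

sublocale Hm: banach_mod R "ihom R V W"
  by (rule VW.banach_mod_ihom)

sublocale T: tensor_pair R "dual R V" W
  by (rule tensor_pair.intro[OF D.seminormed_module_axioms W.seminormed_module_axioms])

abbreviation "\<beta> \<equiv> (\<lambda>\<phi> w. \<lambda>x\<in>carrier V. \<phi> x \<odot>\<^bsub>W\<^esub> w)"

lemma dual_app: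
  assumes "\<phi> \<in> carrier (dual R V)" "x \<in> carrier V"
  shows "\<phi> x \<in> carrier R" "rnorm R (\<phi> x) \<le> mnorm (dual R V) \<phi> * mnorm V x"
  using VD.H.app_closed[of \<phi> x] VD.H.norm_F_app[of \<phi> x] assms by (simp_all add: dual_def)

lemma dual_hom: "\<phi> \<in> carrier (dual R V) \<Longrightarrow> \<phi> \<in> ban_hom R V (self_module R)"
  by (simp add: dual_def ihom_def)

lemma rank_one_bound:
  obtains C where "C > 0" "\<And>\<phi> w x. \<lbrakk>\<phi> \<in> carrier (dual R V); w \<in> carrier W; x \<in> carrier V\<rbrakk> \<Longrightarrow>
    mnorm W (\<phi> x \<odot>\<^bsub>W\<^esub> w) \<le> C * (mnorm (dual R V) \<phi> * mnorm W w) * mnorm V x"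
proof -
  obtain C where C: "C > 0" "\<And>a w. a \<in> carrier R \<Longrightarrow> w \<in> carrier W \<Longrightarrow>
      mnorm W (a \<odot>\<^bsub>W\<^esub> w) \<le> C * rnorm R a * mnorm W w"
    using W.norm_smult_ex by blast
  show ?thesis
  proof (rule that[OF C(1)])
    fix \<phi> w x assume phi: "\<phi> \<in> carrier (dual R V)" and w: "w \<in> carrier W" and x: "x \<in> carrier V"
    have "mnorm W (\<phi> x \<odot>\<^bsub>W\<^esub> w) \<le> C * rnorm R (\<phi> x) * mnorm W w"
      by (rule C(2)[OF dual_app(1)[OF phi x] w])
    also have "\<dots> \<le> C * (mnorm (dual R V) \<phi> * mnorm V x) * mnorm W w"
      using dual_app(2)[OF phi x] C(1) W.norm_nonneg[OF w]
      by (intro mult_right_mono mult_left_mono) auto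
    finally show "mnorm W (\<phi> x \<odot>\<^bsub>W\<^esub> w) \<le> C * (mnorm (dual R V) \<phi> * mnorm W w) * mnorm V x"
      by (simp add: algebra_simps)
  qed
qed

lemma rank_one_closed:
  assumes phi: "\<phi> \<in> carrier (dual R V)" and w: "w \<in> carrier W"
  shows "\<beta> \<phi> w \<in> carrier (ihom R V W)"
proof -
  obtain C where C: "C > 0" "\<And>x. x \<in> carrier V \<Longrightarrow>
    mnorm W (\<phi> x \<odot>\<^bsub>W\<^esub> w) \<le> C * (mnorm (dual R V) \<phi> * mnorm W w) * mnorm V x"
    using rank_one_bound phi w by metis
  have "\<beta> \<phi> w \<in> ban_hom R V W"
  proof (rule ban_homI)
    show "\<beta> \<phi> w \<in> carrier V \<rightarrow>\<^sub>E carrier W" using dual_app(1)[OF phi] w by auto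
    show "mnorm W (\<beta> \<phi> w x) \<le> C * (mnorm (dual R V) \<phi> * mnorm W w) * mnorm V x"
      if "x \<in> carrier V" for x
      using C(2)[OF that] that by simp
    show "\<beta> \<phi> w (x \<oplus>\<^bsub>V\<^esub> y) = \<beta> \<phi> w x \<oplus>\<^bsub>W\<^esub> \<beta> \<phi> w y" if "x \<in> carrier V" "y \<in> carrier V" for x y
      using that w dual_app(1)[OF phi] ban_homD(3)[OF dual_hom[OF phi]] by (simp add: W.smult_l_distr)
    show "\<beta> \<phi> w (a \<odot>\<^bsub>V\<^esub> x) = a \<odot>\<^bsub>W\<^esub> \<beta> \<phi> w x" if "a \<in> carrier R" "x \<in> carrier V" for a x
      using that w dual_app(1)[OF phi] ban_homD(4)[OF dual_hom[OF phi]] by (simp add: W.smult_assoc1)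
  qed
  then show ?thesis by (simp add: ihom_def)
qed

lemma rank_one_norm:
  "\<exists>C\<ge>0. \<forall>\<phi>\<in>carrier (dual R V). \<forall>w\<in>carrier W.
     mnorm (ihom R V W) (\<beta> \<phi> w) \<le> C * (mnorm (dual R V) \<phi> * mnorm W w)"
proof -
  obtain C where C: "C > 0" "\<And>\<phi> w x. \<lbrakk>\<phi> \<in> carrier (dual R V); w \<in> carrier W; x \<in> carrier V\<rbrakk> \<Longrightarrow>
    mnorm W (\<phi> x \<odot>\<^bsub>W\<^esub> w) \<le> C * (mnorm (dual R V) \<phi> * mnorm W w) * mnorm V x"
    using rank_one_bound by blast
  show ?thesis
  proof (intro exI[of _ C] conjI ballI)
    fix \<phi> w assume phi: "\<phi> \<in> carrier (dual R V)" and w: "w \<in> carrier W"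
    show "mnorm (ihom R V W) (\<beta> \<phi> w) \<le> C * (mnorm (dual R V) \<phi> * mnorm W w)"
      using VW.H.norm_F[OF rank_one_closed[OF phi w], of "C * (mnorm (dual R V) \<phi> * mnorm W w)"]
        C(2)[OF phi w] C(1) D.norm_nonneg[OF phi] W.norm_nonneg[OF w] by simp
  qed (use C(1) in simp)
qed

lemma ex_alg_lift:
  "\<exists>H\<in>ban_hom R T.AT (ihom R V W). \<forall>\<phi>\<in>carrier (dual R V). \<forall>w\<in>carrier W. H (T.pt \<phi> w) = \<beta> \<phi> w"
proof -
  obtain C where C: "C \<ge> 0" "\<And>\<phi> w. \<phi> \<in> carrier (dual R V) \<Longrightarrow> w \<in> carrier W \<Longrightarrow>
     mnorm (ihom R V W) (\<beta> \<phi> w) \<le> C * (mnorm (dual R V) \<phi> * mnorm W w)"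
    using rank_one_norm by blast
  show ?thesis
  proof (rule T.alg_tensor_lift[OF Hm.seminormed_module_axioms C(1) rank_one_closed _ _ _ _ C(2)])
    fix \<phi> \<psi> w assume "\<phi> \<in> carrier (dual R V)" "\<psi> \<in> carrier (dual R V)" "w \<in> carrier W"
    then show "\<beta> (\<phi> \<oplus>\<^bsub>dual R V\<^esub> \<psi>) w = \<beta> \<phi> w \<oplus>\<^bsub>ihom R V W\<^esub> \<beta> \<psi> w"
      by (auto simp: VW.H.add_F dual_app(1) W.smult_l_distr dual_def VD.H.add_F intro!: restrict_ext)
  next
    fix \<phi> w w' assume "\<phi> \<in> carrier (dual R V)" "w \<in> carrier W" "w' \<in> carrier W"
    then show "\<beta> \<phi> (w \<oplus>\<^bsub>W\<^esub> w') = \<beta> \<phi> w \<oplus>\<^bsub>ihom R V W\<^esub> \<beta> \<phi> w'"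
      by (auto simp: VW.H.add_F dual_app(1) W.smult_r_distr intro!: restrict_ext)
  next
    fix a \<phi> w assume "a \<in> carrier R" "\<phi> \<in> carrier (dual R V)" "w \<in> carrier W"
    then show "\<beta> (a \<odot>\<^bsub>dual R V\<^esub> \<phi>) w = a \<odot>\<^bsub>ihom R V W\<^esub> \<beta> \<phi> w"
      by (auto simp: VW.H.smult_F dual_app(1) W.smult_assoc1 dual_def VD.H.smult_F intro!: restrict_ext)
  next
    fix a \<phi> w assume "a \<in> carrier R" "\<phi> \<in> carrier (dual R V)" "w \<in> carrier W"
    then show "\<beta> \<phi> (a \<odot>\<^bsub>W\<^esub> w) = a \<odot>\<^bsub>ihom R V W\<^esub> \<beta> \<phi> w"
      by (auto simp: VW.H.smult_F dual_app(1) V.R.m_comm simp flip: W.smult_assoc1 intro!: restrict_ext)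
  qed
qed

abbreviation "can \<equiv> canonical_map R V W"

text \<open>The canonical map from \<open>V\<^sup>\<or> \<otimes> W\<close> to \<open>Hom(V, W)\<close> is defined as the unique bounded linear map with
  prescribed values on pure tensors.  It exists, as the extension of the map \<open>H\<close> on the algebraic
  tensor product to the completion, and it is unique because its values on constant sequences
  are determined.\<close>

lemma canonical_map_spec:
  "\<exists>H\<in>ban_hom R T.AT (ihom R V W). (\<forall>\<phi>\<in>carrier (dual R V). \<forall>w\<in>carrier W. H (T.pt \<phi> w) = \<beta> \<phi> w) \<and>
     can \<in> ban_hom R (ctensor R (dual R V) W) (ihom R V W) \<and>
     (\<forall>x. T.C.cauchy x \<longrightarrow> asymp_eq (ihom R V W) (\<lambda>n. H (x n)) (\<lambda>_. can (T.C.cl x)))"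
proof -
  obtain H where H: "H \<in> ban_hom R T.AT (ihom R V W)"
    "\<And>\<phi> w. \<phi> \<in> carrier (dual R V) \<Longrightarrow> w \<in> carrier W \<Longrightarrow> H (T.pt \<phi> w) = \<beta> \<phi> w"
    using ex_alg_lift by blast
  obtain h where h: "h \<in> ban_hom R (completion T.AT) (ihom R V W)"
    "\<And>x. T.C.cauchy x \<Longrightarrow> asymp_eq (ihom R V W) (\<lambda>n. H (x n)) (\<lambda>_. h (T.C.cl x))"
    using T.C.completion_lift[OF Hm.banach_mod_axioms H(1)] by blast
  have h_const: "h (T.C.cl (\<lambda>_. c)) = H c" if c: "c \<in> carrier T.AT" for c
  proof -
    have Hc: "H c \<in> carrier (ihom R V W)" "h (T.C.cl (\<lambda>_. c)) \<in> carrier (ihom R V W)"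
      using ban_homD(2)[OF H(1) c] ban_homD(2)[OF h(1) T.C.cl_closed[OF T.C.ncauchy_const[OF c]]] .
    show ?thesis
      by (rule Hm.limit_unique[OF _ Hc(2,1) h(2)[OF T.C.ncauchy_const[OF c]] Hm.asymp_eq_refl])
        (use Hc in auto)
  qed
  have "can = h"
    unfolding canonical_map_def tensor_lift_def T.ctensor_eq T.pure_tensor_eq
  proof (rule the_equality)
    show "h \<in> ban_hom R (completion T.AT) (ihom R V W) \<and>
      (\<forall>\<phi>\<in>carrier (dual R V). \<forall>w\<in>carrier W. h (T.C.cl (\<lambda>_. T.pt \<phi> w)) = \<beta> \<phi> w)"
      using h(1) by (simp add: h_const T.pt_closed H(2))
  next
    fix g assume g: "g \<in> ban_hom R (completion T.AT) (ihom R V W) \<and>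
      (\<forall>\<phi>\<in>carrier (dual R V). \<forall>w\<in>carrier W. g (T.C.cl (\<lambda>_. T.pt \<phi> w)) = \<beta> \<phi> w)"
    then have g1: "g \<in> ban_hom R (completion T.AT) (ihom R V W)" by blast
    obtain B where B: "\<And>t. t \<in> carrier (completion T.AT) \<Longrightarrow>
        mnorm (ihom R V W) (g t) \<le> B * mnorm (completion T.AT) t"
      using g1 unfolding ban_hom_def by blast
    have cc: "T.C.cauchy (\<lambda>_. c)" if "c \<in> carrier T.AT" for c by (rule T.C.ncauchy_const[OF that])
    have cl: "T.C.cl (\<lambda>_. c) \<in> carrier (completion T.AT)" if "c \<in> carrier T.AT" for c
      by (rule T.C.cl_closed[OF cc[OF that]])
    have nrm: "mnorm (completion T.AT) (T.C.cl (\<lambda>_. c)) = mnorm T.AT c" if "c \<in> carrier T.AT" for c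
      using T.C.norm_CM[OF cc[OF that]] by (simp add: LIMSEQ_const_iff)
    have "(\<lambda>c\<in>carrier T.AT. g (T.C.cl (\<lambda>_. c))) \<in> ban_hom R T.AT (ihom R V W)"
    proof (rule ban_homI)
      show "(\<lambda>c\<in>carrier T.AT. g (T.C.cl (\<lambda>_. c))) \<in> carrier T.AT \<rightarrow>\<^sub>E carrier (ihom R V W)"
        using ban_homD(2)[OF g1] cl by auto
      show "mnorm (ihom R V W) ((\<lambda>c\<in>carrier T.AT. g (T.C.cl (\<lambda>_. c))) c) \<le> B * mnorm T.AT c"
        if "c \<in> carrier T.AT" for c
        using B[OF cl[OF that]] that by (simp add: nrm)
    next
      fix c d assume cd: "c \<in> carrier T.AT" "d \<in> carrier T.AT"
      then show "(\<lambda>c\<in>carrier T.AT. g (T.C.cl (\<lambda>_. c))) (c \<oplus>\<^bsub>T.AT\<^esub> d) =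
          (\<lambda>c\<in>carrier T.AT. g (T.C.cl (\<lambda>_. c))) c \<oplus>\<^bsub>ihom R V W\<^esub> (\<lambda>c\<in>carrier T.AT. g (T.C.cl (\<lambda>_. c))) d"
        using ban_homD(3)[OF g1 cl[OF cd(1)] cl[OF cd(2)]] T.C.add_CM[OF cc[OF cd(1)] cc[OF cd(2)]]
        by simp
    next
      fix a c assume ac: "a \<in> carrier R" "c \<in> carrier T.AT"
      then show "(\<lambda>c\<in>carrier T.AT. g (T.C.cl (\<lambda>_. c))) (a \<odot>\<^bsub>T.AT\<^esub> c) =
          a \<odot>\<^bsub>ihom R V W\<^esub> (\<lambda>c\<in>carrier T.AT. g (T.C.cl (\<lambda>_. c))) c"
        using ban_homD(4)[OF g1 ac(1) cl[OF ac(2)]] T.C.smult_CM[OF cc[OF ac(2)] ac(1)]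
        by simp
    qed
    then have "(\<lambda>c\<in>carrier T.AT. g (T.C.cl (\<lambda>_. c))) = H"
      by (rule T.hom_eq_on_pure[OF Hm.module_axioms _ H(1)]) (use g in \<open>simp add: H(2) T.pt_closed\<close>)
    from fun_cong[OF this] have "g (T.C.cl (\<lambda>_. c)) = H c" if "c \<in> carrier T.AT" for c
      using that by (simp add: restrict_def) meson
    then show "g = h"
      by (intro T.C.completion_hom_eqI[OF Hm.banach_mod_axioms g1 h(1)]) (simp add: h_const)
  qed
  then show ?thesis using H h by (auto simp: T.ctensor_eq)
qed

lemma canonical_map_closed:
  "t \<in> carrier (ctensor R (dual R V) W) \<Longrightarrow> can t \<in> ban_hom R V W"
  using canonical_map_spec ban_homD(2)[of can R "ctensor R (dual R V) W" "ihom R V W" t]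
  by (auto simp: ihom_def)

lemma eval_hom:
  assumes x: "x \<in> carrier V"
  shows "(\<lambda>f\<in>carrier (ihom R V W). f x) \<in> ban_hom R (ihom R V W) W"
proof (rule ban_homI)
  show "(\<lambda>f\<in>carrier (ihom R V W). f x) \<in> carrier (ihom R V W) \<rightarrow>\<^sub>E carrier W"
    using VW.H.app_closed x by auto
  show "mnorm W ((\<lambda>f\<in>carrier (ihom R V W). f x) f) \<le> mnorm V x * mnorm (ihom R V W) f"
    if "f \<in> carrier (ihom R V W)" for f
    using VW.H.norm_F_app[OF that x] that by (simp add: mult.commute)
qed (use x in \<open>simp_all add: VW.H.add_F VW.H.smult_F VW.H.add_closed_F VW.H.smult_closed_F\<close>)

lemma canonical_map_series:
  assumes phi: "\<And>k. \<phi> k \<in> carrier (dual R V)" and w: "\<And>k. w k \<in> carrier W"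
    and sm: "summable (\<lambda>k. mnorm (dual R V) (\<phi> k) * mnorm W (w k))"
    and x: "x \<in> carrier V"
  shows "asymp_eq W (psum W (\<lambda>k. \<phi> k x \<odot>\<^bsub>W\<^esub> w k))
    (\<lambda>_. can (T.C.cl (psum T.AT (\<lambda>k. T.pt (\<phi> k) (w k)))) x)"
proof -
  define y where "y = psum T.AT (\<lambda>k. T.pt (\<phi> k) (w k))"
  have y: "T.C.cauchy y" unfolding y_def by (rule T.ncauchy_psum_pt[OF phi w sm])
  obtain H where H: "H \<in> ban_hom R T.AT (ihom R V W)"
    "\<And>\<phi> w. \<phi> \<in> carrier (dual R V) \<Longrightarrow> w \<in> carrier W \<Longrightarrow> H (T.pt \<phi> w) = \<beta> \<phi> w"
    and can: "can \<in> ban_hom R (ctensor R (dual R V) W) (ihom R V W)"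
    and lim: "asymp_eq (ihom R V W) (\<lambda>n. H (y n)) (\<lambda>_. can (T.C.cl y))"
    using canonical_map_spec y by blast
  define e where "e = (\<lambda>f\<in>carrier (ihom R V W). f x)"
  have e: "e \<in> ban_hom R (ihom R V W) W" unfolding e_def by (rule eval_hom[OF x])
  have yc: "y n \<in> carrier T.AT" for n using T.C.ncauchy_range[OF y] by auto
  have cc: "can (T.C.cl y) \<in> carrier (ihom R V W)"
    using ban_homD(2)[OF can] T.C.cl_closed[OF y] by (simp add: T.ctensor_eq)
  have "asymp_eq W (\<lambda>n. e (H (y n))) (\<lambda>_. e (can (T.C.cl y)))"
    by (rule ban_hom_asymp_eq[OF Hm.seminormed_module_axioms W.seminormed_module_axioms e _ _ lim])
      (use ban_homD(2)[OF H(1) yc] cc in auto)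
  moreover have "e (H (y n)) = psum W (\<lambda>k. \<phi> k x \<odot>\<^bsub>W\<^esub> w k) n" for n
  proof -
    have "H (y n) = psum (ihom R V W) (\<lambda>k. \<beta> (\<phi> k) (w k)) n"
      unfolding y_def
      by (simp add: ban_hom_psum[OF H(1) T.module_AT Hm.module_axioms] T.pt_closed phi w H(2))
    then show ?thesis
      by (simp add: ban_hom_psum[OF e Hm.module_axioms W.module_axioms] rank_one_closed phi w)
        (simp add: e_def rank_one_closed phi w x)
  qed
  ultimately show ?thesis using cc by (simp add: e_def y_def)
qed

text \<open>Together with the next theorem: a morphism is nuclear iff it is a \<open>nuclear_series\<close>.\<close>

theorem canonical_map_nuclear_series:
  assumes t: "t \<in> carrier (ctensor R (dual R V) W)"
  shows "\<exists>\<phi> w. nuclear_series R V W (can t) \<phi> w"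
proof -
  obtain \<phi> w where pw: "\<And>k. \<phi> k \<in> carrier (dual R V)" "\<And>k. w k \<in> carrier W"
    "summable (\<lambda>k. mnorm (dual R V) (\<phi> k) * mnorm W (w k))"
    "t = T.C.cl (psum T.AT (\<lambda>k. T.pt (\<phi> k) (w k)))"
    using T.series_expansion[OF t] by blast
  have "asymp_eq W (psum W (\<lambda>k. \<phi> k x \<odot>\<^bsub>W\<^esub> w k)) (\<lambda>_. can t x)" if "x \<in> carrier V" for x
    unfolding pw(4) by (rule canonical_map_series[OF pw(1-3) that])
  then show ?thesis
    unfolding nuclear_series_def using pw(1-3) canonical_map_closed[OF t] by blast
qed

theorem nuclear_series_imp_nuclear:
  assumes f: "nuclear_series R V W f \<phi> w"
  shows "nuclear_morphism R V W f"
proof -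
  have fh: "f \<in> ban_hom R V W" and phi: "\<And>k. \<phi> k \<in> carrier (dual R V)" and w: "\<And>k. w k \<in> carrier W"
    and sm: "summable (\<lambda>k. mnorm (dual R V) (\<phi> k) * mnorm W (w k))"
    and lim: "\<And>x. x \<in> carrier V \<Longrightarrow> asymp_eq W (psum W (\<lambda>k. \<phi> k x \<odot>\<^bsub>W\<^esub> w k)) (\<lambda>_. f x)"
    using f unfolding nuclear_series_def by blast+
  define y where "y = psum T.AT (\<lambda>k. T.pt (\<phi> k) (w k))"
  have y: "T.C.cauchy y" unfolding y_def by (rule T.ncauchy_psum_pt[OF phi w sm])
  have yc: "y n \<in> carrier T.AT" for n using T.C.ncauchy_range[OF y] by auto
  define t where "t = T.C.cl y"
  have t: "t \<in> carrier (completion T.AT)" unfolding t_def by (rule T.C.cl_closed[OF y])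
  then have t': "t \<in> carrier (ctensor R (dual R V) W)" by (simp add: T.ctensor_eq)
  have can_t: "can t = f"
  proof (rule ban_hom_eqI[OF canonical_map_closed[OF t'] fh])
    fix x assume x: "x \<in> carrier V"
    show "can t x = f x"
      by (rule W.limit_unique[OF _ _ _ canonical_map_series[OF phi w sm x, folded y_def t_def] lim[OF x]])
        (use ban_homD(2)[OF canonical_map_closed[OF t'] x] ban_homD(2)[OF fh x] dual_app(1)[OF phi x] w
          W.M.psum_closed in auto)
  qed
  have one: "\<one> \<odot>\<^bsub>completion T.AT\<^esub> t = t"
    unfolding t_def using y yc by (simp add: T.C.smult_CM)
  show ?thesis
    unfolding nuclear_morphism_def
  proof (intro conjI fh bexI)
    show "(\<lambda>a\<in>carrier R. a \<odot>\<^bsub>completion T.AT\<^esub> t) \<in> ban_hom R (self_module R) (ctensor R (dual R V) W)"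
      unfolding T.ctensor_eq by (rule T.C.smult_hom[OF t])
    show "f = compose (carrier R) can (\<lambda>a\<in>carrier R. a \<odot>\<^bsub>completion T.AT\<^esub> t) \<one>"
      by (simp add: compose_def one can_t)
  qed
qed

end

section \<open>Factorization of nuclear morphisms\<close>

lemma nuclear_pairI: "banach_mod R V \<Longrightarrow> banach_mod R W \<Longrightarrow> nuclear_pair R V W"
  by (rule nuclear_pair.intro)

lemma nuclear_seriesD:
  assumes "nuclear_series R V W f \<phi> w"
  shows "f \<in> ban_hom R V W" "\<And>k. \<phi> k \<in> carrier (dual R V)" "\<And>k. w k \<in> carrier W"
    "summable (\<lambda>k. mnorm (dual R V) (\<phi> k) * mnorm W (w k))"
    "\<And>x. x \<in> carrier V \<Longrightarrow> asymp_eq W (psum W (\<lambda>k. \<phi> k x \<odot>\<^bsub>W\<^esub> w k)) (\<lambda>_. f x)"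
  using assms unfolding nuclear_series_def by blast+

lemma (in nuclear_pair) ex_nuclear_series:
  assumes phi: "\<And>k. \<phi> k \<in> carrier (dual R V)" and w: "\<And>k. w k \<in> carrier W"
    and sm: "summable (\<lambda>k. mnorm (dual R V) (\<phi> k) * mnorm W (w k))"
  shows "\<exists>f. nuclear_series R V W f \<phi> w"
proof -
  define t where "t = T.C.cl (psum T.AT (\<lambda>k. T.pt (\<phi> k) (w k)))"
  have "t \<in> carrier (ctensor R (dual R V) W)"
    unfolding t_def T.ctensor_eq by (rule T.C.cl_closed[OF T.ncauchy_psum_pt[OF phi w sm]])
  then have "nuclear_series R V W (can t) \<phi> w"
    unfolding nuclear_series_def
    using phi w sm canonical_map_closed canonical_map_series[OF phi w sm] by (simp add: t_def)
  then show ?thesis by blast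
qed

lemma (in nuclear_pair) psum_rank_one_closed:
  assumes "\<And>k. \<phi> k \<in> carrier (dual R V)" "\<And>k. w k \<in> carrier W" "x \<in> carrier V"
  shows "range (psum W (\<lambda>k. \<phi> k x \<odot>\<^bsub>W\<^esub> w k)) \<subseteq> carrier W"
  using W.M.psum_closed dual_app(1) assms by (auto simp: image_subset_iff)

lemma nuclear_series_post:
  assumes V: "banach_mod R V" and W: "banach_mod R W" and W': "banach_mod R W'"
    and f: "nuclear_series R V W f \<phi> w" and g: "g \<in> ban_hom R W W'"
  shows "nuclear_series R V W' (compose (carrier V) g f) \<phi> (\<lambda>k. g (w k))"
proof -
  interpret N: nuclear_pair R V W by (rule nuclear_pairI[OF V W])
  interpret N': nuclear_pair R V W' by (rule nuclear_pairI[OF V W'])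
  note fD = nuclear_seriesD[OF f]
  obtain C where C: "C > 0" "\<And>x. x \<in> carrier W \<Longrightarrow> mnorm W' (g x) \<le> C * mnorm W x"
    using ban_hom_bounded[OF g N.W.norm_nonneg] by blast
  show ?thesis
    unfolding nuclear_series_def
  proof (intro conjI allI ballI)
    show "compose (carrier V) g f \<in> ban_hom R V W'"
      by (rule compose_ban_hom[OF N.V.seminormed_module_axioms N.W.seminormed_module_axioms fD(1) g])
    show "\<phi> k \<in> carrier (dual R V)" for k by (rule fD(2))
    show "g (w k) \<in> carrier W'" for k by (rule ban_homD(2)[OF g fD(3)])
    show "summable (\<lambda>k. mnorm (dual R V) (\<phi> k) * mnorm W' (g (w k)))"
    proof (rule summable_comparison_test'[of "\<lambda>k. C * (mnorm (dual R V) (\<phi> k) * mnorm W (w k))" 0])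
      show "summable (\<lambda>k. C * (mnorm (dual R V) (\<phi> k) * mnorm W (w k)))"
        by (rule summable_mult[OF fD(4)])
      fix k
      have "mnorm (dual R V) (\<phi> k) * mnorm W' (g (w k)) \<le> mnorm (dual R V) (\<phi> k) * (C * mnorm W (w k))"
        using C(2)[OF fD(3)] N.D.norm_nonneg[OF fD(2)] by (rule mult_left_mono)
      then show "norm (mnorm (dual R V) (\<phi> k) * mnorm W' (g (w k)))
          \<le> C * (mnorm (dual R V) (\<phi> k) * mnorm W (w k))"
        using N.D.norm_nonneg[OF fD(2)] N'.W.norm_nonneg[OF ban_homD(2)[OF g fD(3)]]
        by (simp add: algebra_simps)
    qed
    fix x assume x: "x \<in> carrier V"
    have c: "\<phi> k x \<in> carrier R" "\<phi> k x \<odot>\<^bsub>W\<^esub> w k \<in> carrier W" for k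
      using N.dual_app(1)[OF fD(2) x] fD(3) by auto
    have "asymp_eq W' (\<lambda>n. g (psum W (\<lambda>k. \<phi> k x \<odot>\<^bsub>W\<^esub> w k) n)) (\<lambda>_. g (f x))"
      using N.psum_rank_one_closed[OF fD(2,3) x] ban_homD(2)[OF fD(1) x]
      by (intro ban_hom_asymp_eq[OF N.W.seminormed_module_axioms N'.W.seminormed_module_axioms g] fD(5)[OF x]) auto
    moreover have "(\<lambda>n. g (psum W (\<lambda>k. \<phi> k x \<odot>\<^bsub>W\<^esub> w k) n)) = psum W' (\<lambda>k. \<phi> k x \<odot>\<^bsub>W'\<^esub> g (w k))"
      by (simp add: fun_eq_iff ban_hom_psum[OF g N.W.module_axioms N'.W.module_axioms c(2)]
          ban_homD(4)[OF g c(1) fD(3)])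
    ultimately show "asymp_eq W' (psum W' (\<lambda>k. \<phi> k x \<odot>\<^bsub>W'\<^esub> g (w k))) (\<lambda>_. compose (carrier V) g f x)"
      using x by (simp add: compose_eq)
  qed
qed

text \<open>A nuclear morphism factors through a countable weighted product of copies of the ring, such that
  the second factor is nuclear.\<close>

theorem nuclear_series_factor:
  fixes R :: "('a, 'x) nring_scheme" (structure)
  assumes V: "banach_mod R V" and W: "banach_mod R W" and f: "nuclear_series R V W f \<phi> w"
  shows "\<exists>(c :: nat \<Rightarrow> real) a b p. (\<forall>s. 0 < c s) \<and>
    a \<in> ban_hom R V (weighted_product R UNIV c) \<and>
    nuclear_series R (weighted_product R UNIV c) W b p w \<and>
    f = compose (carrier V) b a"
proof -
  interpret N: nuclear_pair R V W by (rule nuclear_pairI[OF V W])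
  note fD = nuclear_seriesD[OF f]
  \<comment> \<open>The summand \<open>e s\<close> keeps the weights \<open>c s\<close> finite where \<open>\<phi> s = 0\<close>, and is small enough to preserve
    summability.\<close>
  define e where "e s = (1/2) ^ s / (1 + mnorm W (w s))" for s :: nat
  have wn: "0 \<le> mnorm W (w s)" for s by (rule N.W.norm_nonneg[OF fD(3)])
  have pn: "0 \<le> mnorm (dual R V) (\<phi> s)" for s by (rule N.D.norm_nonneg[OF fD(2)])
  have e: "e s > 0" "e s * mnorm W (w s) \<le> (1/2) ^ s" for s
  proof -
    show "e s > 0" using wn[of s] by (simp add: e_def add_pos_nonneg)
    have "mnorm W (w s) / (1 + mnorm W (w s)) \<le> 1" using wn[of s] by (simp add: divide_le_eq_1)
    then have "(1/2) ^ s * (mnorm W (w s) / (1 + mnorm W (w s))) \<le> (1/2) ^ s * 1"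
      by (intro mult_left_mono) auto
    then show "e s * mnorm W (w s) \<le> (1/2) ^ s" by (simp add: e_def)
  qed
  define c where "c s = 1 / (mnorm (dual R V) (\<phi> s) + e s)" for s
  have c: "0 < c s" "1 / c s = mnorm (dual R V) (\<phi> s) + e s" for s
    using pn[of s] e(1)[of s] by (simp_all add: c_def add_nonneg_pos)
  define L where "L = weighted_product R UNIV c"
  interpret P: weighted_prod R UNIV c
    by (rule weighted_prod.intro[OF N.V.banach_ring c(1)])
  have L: "banach_mod R L" unfolding L_def by (rule P.banach_mod_weighted_product)
  interpret NL: nuclear_pair R L W by (rule nuclear_pairI[OF L W])
  have app: "v s \<in> carrier R" "rnorm R (v s) \<le> (mnorm (dual R V) (\<phi> s) + e s) * mnorm L v"
    if "v \<in> carrier L" for v s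
    using P.P.app_closed[of v s] P.P.norm_F_app[of v s] that c(2)[of s]
    by (simp_all add: L_def mult.commute)
  define a where "a = (\<lambda>x\<in>carrier V. \<lambda>s. \<phi> s x)"
  have phi_le: "rnorm R (\<phi> s x) \<le> mnorm V x * (1 / c s)" if x: "x \<in> carrier V" for x s
  proof -
    have "rnorm R (\<phi> s x) \<le> mnorm (dual R V) (\<phi> s) * mnorm V x" by (rule N.dual_app(2)[OF fD(2) x])
    also have "\<dots> \<le> (mnorm (dual R V) (\<phi> s) + e s) * mnorm V x"
      using e(1)[of s] N.V.norm_nonneg[OF x] by (intro mult_right_mono) auto
    finally show ?thesis by (simp add: c(2) mult.commute)
  qed
  have a_closed: "(\<lambda>s. \<phi> s x) \<in> carrier L" if x: "x \<in> carrier V" for x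
    unfolding L_def
    by (rule P.P.F_memI[where B = "mnorm V x"]) (use phi_le[OF x] N.dual_app(1)[OF fD(2) x] in auto)
  have a: "a \<in> ban_hom R V L"
  proof (rule ban_homI)
    show "a \<in> carrier V \<rightarrow>\<^sub>E carrier L" using a_closed by (auto simp: a_def)
    show "mnorm L (a x) \<le> 1 * mnorm V x" if x: "x \<in> carrier V" for x
      using P.P.norm_F[OF a_closed[OF x, unfolded L_def], of "mnorm V x"] phi_le[OF x]
        N.V.norm_nonneg[OF x] x by (simp add: a_def L_def)
    show "a (x \<oplus>\<^bsub>V\<^esub> y) = a x \<oplus>\<^bsub>L\<^esub> a y" if "x \<in> carrier V" "y \<in> carrier V" for x y
      using that by (simp add: a_def L_def restrict_UNIV P.P.add_F restrict_UNIV ban_homD(3)[OF N.dual_hom[OF fD(2)]])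
    show "a (r \<odot>\<^bsub>V\<^esub> x) = r \<odot>\<^bsub>L\<^esub> a x" if "r \<in> carrier R" "x \<in> carrier V" for r x
      using that by (simp add: a_def L_def restrict_UNIV P.P.smult_F restrict_UNIV ban_homD(4)[OF N.dual_hom[OF fD(2)]])
  qed
  define p where "p k = (\<lambda>v\<in>carrier L. v k)" for k :: nat
  have p_hom: "p k \<in> ban_hom R L (self_module R)" for k
  proof (rule ban_homI)
    show "p k \<in> carrier L \<rightarrow>\<^sub>E carrier (self_module R)" using app(1) by (auto simp: p_def)
    show "mnorm (self_module R) (p k v) \<le> (mnorm (dual R V) (\<phi> k) + e k) * mnorm L v"
      if "v \<in> carrier L" for v using app(2)[OF that] that by (simp add: p_def)
    show "p k (u \<oplus>\<^bsub>L\<^esub> v) = p k u \<oplus>\<^bsub>self_module R\<^esub> p k v" if "u \<in> carrier L" "v \<in> carrier L" for u v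
      using that NL.V.M.a_closed[OF that] by (simp add: p_def) (simp add: L_def P.P.add_F)
    show "p k (r \<odot>\<^bsub>L\<^esub> v) = r \<odot>\<^bsub>self_module R\<^esub> p k v" if "r \<in> carrier R" "v \<in> carrier L" for r v
      using that NL.V.smult_closed[OF that] by (simp add: p_def) (simp add: L_def P.P.smult_F)
  qed
  have p: "p k \<in> carrier (dual R L)" for k using p_hom by (simp add: dual_def ihom_def)
  have p_norm: "mnorm (dual R L) (p k) \<le> mnorm (dual R V) (\<phi> k) + e k" for k
    using NL.VD.H.norm_F[OF p[unfolded dual_def], of k "mnorm (dual R V) (\<phi> k) + e k"] app(2)
      pn[of k] e(1)[of k] by (simp add: p_def flip: dual_def)
  have sm: "summable (\<lambda>k. mnorm (dual R L) (p k) * mnorm W (w k))"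
  proof (rule summable_comparison_test'[of "\<lambda>k. mnorm (dual R V) (\<phi> k) * mnorm W (w k) + (1/2) ^ k" 0])
    show "summable (\<lambda>k. mnorm (dual R V) (\<phi> k) * mnorm W (w k) + (1/2) ^ k)"
      by (intro summable_add fD(4) summable_geometric) simp
    fix k
    have "mnorm (dual R L) (p k) * mnorm W (w k) \<le> (mnorm (dual R V) (\<phi> k) + e k) * mnorm W (w k)"
      using p_norm wn by (rule mult_right_mono)
    also have "\<dots> \<le> mnorm (dual R V) (\<phi> k) * mnorm W (w k) + (1/2) ^ k"
      using e(2)[of k] by (simp add: algebra_simps)
    finally show "norm (mnorm (dual R L) (p k) * mnorm W (w k))
        \<le> mnorm (dual R V) (\<phi> k) * mnorm W (w k) + (1/2) ^ k"
      using NL.D.norm_nonneg[OF p[of k]] wn[of k] by simp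
  qed
  obtain b where b: "nuclear_series R L W b p w"
    using NL.ex_nuclear_series[OF p fD(3) sm] by blast
  note bD = nuclear_seriesD[OF b]
  have "f = compose (carrier V) b a"
  proof (rule ban_hom_eqI[OF fD(1)])
    show "compose (carrier V) b a \<in> ban_hom R V W"
      by (rule compose_ban_hom[OF N.V.seminormed_module_axioms NL.V.seminormed_module_axioms a bD(1)])
    fix x assume x: "x \<in> carrier V"
    have ax: "a x \<in> carrier L" by (rule ban_homD(2)[OF a x])
    have "asymp_eq W (psum W (\<lambda>k. \<phi> k x \<odot>\<^bsub>W\<^esub> w k)) (\<lambda>_. b (a x))"
      using bD(5)[OF ax] ax x by (simp add: p_def) (simp add: a_def)
    then have "f x = b (a x)"
      using N.W.limit_unique[OF N.psum_rank_one_closed[OF fD(2,3) x] _ _ fD(5)[OF x]]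
        ban_homD(2)[OF fD(1) x] ban_homD(2)[OF bD(1) ax] by blast
    then show "f x = compose (carrier V) b a x" using x by (simp add: compose_eq)
  qed
  then show ?thesis using c(1) a b unfolding L_def by blast
qed

section \<open>Ind-objects indexed by directed posets\<close>

lemma order_category_simps [simp]:
  "Ob (order_category I r) = I" "Arr (order_category I r) = r"
  "src (order_category I r) = fst" "tgt (order_category I r) = snd"
  "ident (order_category I r) i = (i, i)" "cmp (order_category I r) g f = (fst f, snd g)"
  by (simp_all add: order_category_def)

lemma compose_eq_iff: "compose A g f = compose A g' f' \<longleftrightarrow> (\<forall>x\<in>A. g (f x) = g' (f' x))"
  by (simp add: compose_def restrict_def fun_eq_iff) blast

text \<open>A diagram of Banach modules indexed by a directed poset.\<close>

locale directed_diagram =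
  fixes R :: "('a, 'x) nring_scheme" (structure) and J :: "'o set" and q :: "'o rel"
    and D :: "('a, 'b, 'o, 'o \<times> 'o) diagram"
  assumes banach_ring_R: "banach_ring R"
    and order: "partial_order_on J q"
    and directed: "\<lbrakk>i \<in> J; j \<in> J\<rbrakk> \<Longrightarrow> \<exists>k\<in>J. (i, k) \<in> q \<and> (j, k) \<in> q"
    and idx_D: "idx D = order_category J q"
    and functor_D: "banach_functor R D"
begin

lemma q_field: "(i, j) \<in> q \<Longrightarrow> i \<in> J \<and> j \<in> J"
  using partial_order_onD(4)[OF order] by blast

lemma q_refl: "i \<in> J \<Longrightarrow> (i, i) \<in> q"
  using partial_order_onD(1)[OF order] by (rule refl_onD)

lemma q_trans: "(i, j) \<in> q \<Longrightarrow> (j, k) \<in> q \<Longrightarrow> (i, k) \<in> q"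
  using partial_order_onD(2)[OF order] by (rule transD)

abbreviation "tr i j \<equiv> dar D (i, j)"

lemma banach_mod_D: "i \<in> J \<Longrightarrow> banach_mod R (dob D i)"
  using functor_D by (intro banach_modI[OF banach_ring_R]) (simp add: banach_functor_def idx_D)

lemma snm_D: "i \<in> J \<Longrightarrow> seminormed_module R (dob D i)"
  using banach_mod_D banach_mod.axioms(1) by blast

lemma tr_hom: "(i, j) \<in> q \<Longrightarrow> tr i j \<in> ban_hom R (dob D i) (dob D j)"
  using functor_D unfolding banach_functor_def idx_D by fastforce

lemma tr_closed: "(i, j) \<in> q \<Longrightarrow> x \<in> carrier (dob D i) \<Longrightarrow> tr i j x \<in> carrier (dob D j)"
  using ban_homD(2)[OF tr_hom] .

lemma tr_id: "i \<in> J \<Longrightarrow> x \<in> carrier (dob D i) \<Longrightarrow> tr i i x = x"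
  using functor_D by (simp add: banach_functor_def idx_D)

lemma tr_tr:
  assumes "(i, j) \<in> q" "(j, k) \<in> q" "x \<in> carrier (dob D i)"
  shows "tr j k (tr i j x) = tr i k x"
proof -
  have "\<forall>f\<in>q. \<forall>g\<in>q. snd f = fst g \<longrightarrow>
      dar D (fst f, snd g) = compose (carrier (dob D (fst f))) (dar D g) (dar D f)"
    using functor_D by (simp add: banach_functor_def idx_D)
  from this[rule_format, OF assms(1,2)] have "tr i k = compose (carrier (dob D i)) (tr j k) (tr i j)"
    by simp
  then show ?thesis using assms(3) by (simp add: compose_eq)
qed

lemma colim_rel_iff:
  "((j, f), (j', f')) \<in> colim_rel R E D \<longleftrightarrow> j \<in> J \<and> f \<in> ban_hom R E (dob D j) \<and>
     j' \<in> J \<and> f' \<in> ban_hom R E (dob D j') \<and>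
     (\<exists>m. (j, m) \<in> q \<and> (j', m) \<in> q \<and> (\<forall>x\<in>carrier E. tr j m (f x) = tr j' m (f' x)))"
proof -
  have "(\<exists>u\<in>q. \<exists>u'\<in>q. fst u = j \<and> fst u' = j' \<and> snd u = snd u' \<and>
        (\<forall>x\<in>carrier E. dar D u (f x) = dar D u' (f' x))) \<longleftrightarrow>
      (\<exists>m. (j, m) \<in> q \<and> (j', m) \<in> q \<and> (\<forall>x\<in>carrier E. tr j m (f x) = tr j' m (f' x)))"
    by (simp add: Bex_def split_paired_Ex)
  then show ?thesis by (simp add: colim_rel_def idx_D compose_eq_iff)
qed

lemma colim_relI:
  assumes "(j, m) \<in> q" "(j', m) \<in> q" "f \<in> ban_hom R E (dob D j)" "f' \<in> ban_hom R E (dob D j')"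
    and "\<And>x. x \<in> carrier E \<Longrightarrow> tr j m (f x) = tr j' m (f' x)"
  shows "((j, f), (j', f')) \<in> colim_rel R E D"
  unfolding colim_rel_iff using assms q_field by blast

lemma colim_rel_refl:
  "j \<in> J \<Longrightarrow> f \<in> ban_hom R E (dob D j) \<Longrightarrow> ((j, f), (j, f)) \<in> colim_rel R E D"
  using q_refl by (intro colim_relI) auto

lemma colim_rel_trans:
  assumes ab: "((j, f), (j', f')) \<in> colim_rel R E D" and bc: "((j', f'), (j'', f'')) \<in> colim_rel R E D"
  shows "((j, f), (j'', f'')) \<in> colim_rel R E D"
proof -
  obtain m where m: "(j, m) \<in> q" "(j', m) \<in> q" "\<And>x. x \<in> carrier E \<Longrightarrow> tr j m (f x) = tr j' m (f' x)"
    using ab unfolding colim_rel_iff by blast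
  obtain n where n: "(j', n) \<in> q" "(j'', n) \<in> q" "\<And>x. x \<in> carrier E \<Longrightarrow> tr j' n (f' x) = tr j'' n (f'' x)"
    using bc unfolding colim_rel_iff by blast
  have f: "f \<in> ban_hom R E (dob D j)" "f' \<in> ban_hom R E (dob D j')" "f'' \<in> ban_hom R E (dob D j'')"
    using ab bc unfolding colim_rel_iff by blast+
  obtain k where k: "(m, k) \<in> q" "(n, k) \<in> q" using directed q_field m(1) n(1) by blast
  show ?thesis
  proof (rule colim_relI[OF q_trans[OF m(1) k(1)] q_trans[OF n(2) k(2)] f(1,3)])
    fix x assume x: "x \<in> carrier E"
    note fx = ban_homD(2)[OF f(1) x] ban_homD(2)[OF f(2) x] ban_homD(2)[OF f(3) x]
    have "tr j k (f x) = tr m k (tr j m (f x))" by (rule tr_tr[OF m(1) k(1) fx(1), symmetric])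
    also have "\<dots> = tr m k (tr j' m (f' x))" by (simp only: m(3)[OF x])
    also have "\<dots> = tr j' k (f' x)" by (rule tr_tr[OF m(2) k(1) fx(2)])
    also have "\<dots> = tr n k (tr j' n (f' x))" by (rule tr_tr[OF n(1) k(2) fx(2), symmetric])
    also have "\<dots> = tr n k (tr j'' n (f'' x))" by (simp only: n(3)[OF x])
    also have "\<dots> = tr j'' k (f'' x)" by (rule tr_tr[OF n(2) k(2) fx(3)])
    finally show "tr j k (f x) = tr j'' k (f'' x)" .
  qed
qed

lemma colim_rel_sym:
  assumes "((j, f), (j', f')) \<in> colim_rel R E D" shows "((j', f'), (j, f)) \<in> colim_rel R E D"
  using assms unfolding colim_rel_iff by metis

text \<open>The class of \<open>f : E \<rightarrow> D\<^sub>j\<close> in \<open>colim\<^sub>j Hom(E, D\<^sub>j)\<close>.\<close>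

definition germ :: "('a, 'e) nmodule \<Rightarrow> 'o \<Rightarrow> ('e \<Rightarrow> 'b) \<Rightarrow> ('o \<times> ('e \<Rightarrow> 'b)) set" where
  "germ E j f = colim_rel R E D `` {(j, f)}"

lemma mem_germ_iff: "(j', f') \<in> germ E j f \<longleftrightarrow> ((j, f), (j', f')) \<in> colim_rel R E D"
  by (simp add: germ_def)

lemma germ_eqI:
  assumes "((j, f), (j', f')) \<in> colim_rel R E D" shows "germ E j f = germ E j' f'"
proof -
  have "(k, g) \<in> germ E j f \<longleftrightarrow> (k, g) \<in> germ E j' f'" for k g
    unfolding mem_germ_iff using assms colim_rel_trans colim_rel_sym by blast
  then show ?thesis by (auto simp: set_eq_iff)
qed

lemma germ_in_colim_hom:
  "j \<in> J \<Longrightarrow> f \<in> ban_hom R E (dob D j) \<Longrightarrow> germ E j f \<in> colim_hom R E D"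
  unfolding colim_hom_def germ_def by (rule quotientI) (simp add: idx_D)

lemma colim_rel_precomp:
  assumes E: "seminormed_module R E" and E': "seminormed_module R E'" and h: "h \<in> ban_hom R E' E"
    and rel: "((j, f), (j', f')) \<in> colim_rel R E D"
  shows "((j, compose (carrier E') f h), (j', compose (carrier E') f' h)) \<in> colim_rel R E' D"
proof -
  obtain m where m: "(j, m) \<in> q" "(j', m) \<in> q" "\<And>x. x \<in> carrier E \<Longrightarrow> tr j m (f x) = tr j' m (f' x)"
    and f: "f \<in> ban_hom R E (dob D j)" "f' \<in> ban_hom R E (dob D j')"
    using rel unfolding colim_rel_iff by blast
  show ?thesis
    by (rule colim_relI[OF m(1,2) compose_ban_hom[OF E' E h f(1)] compose_ban_hom[OF E' E h f(2)]])
      (simp add: compose_eq m(3) ban_homD(2)[OF h])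
qed

end

text \<open>A morphism of ind-objects given by representatives \<open>f k : V\<^sub>k \<rightarrow> Z\<^bsub>\<sigma> k\<^esub>\<close> that are compatible with
  the transition maps of \<open>V\<close> in the colimit over \<open>Z\<close>.\<close>

locale ind_morphism = V: directed_diagram R J q V + Z: directed_diagram R J' q' Z
  for R :: "('a, 'x) nring_scheme" (structure) and J :: "'o set" and q and V :: "('a, 'b, 'o, 'o \<times> 'o) diagram"
    and J' :: "'p set" and q' and Z :: "('a, 'c, 'p, 'p \<times> 'p) diagram" +
  fixes \<sigma> :: "'o \<Rightarrow> 'p" and f :: "'o \<Rightarrow> 'b \<Rightarrow> 'c"
  assumes \<sigma>: "k \<in> J \<Longrightarrow> \<sigma> k \<in> J'" and f: "k \<in> J \<Longrightarrow> f k \<in> ban_hom R (dob V k) (dob Z (\<sigma> k))"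
    and compat: "(k, k') \<in> q \<Longrightarrow> ((\<sigma> k', compose (carrier (dob V k)) (f k') (dar V (k, k'))), (\<sigma> k, f k))
      \<in> colim_rel R (dob V k) Z"
begin

definition ind_mor :: "'o \<Rightarrow> ('p \<times> ('b \<Rightarrow> 'c)) set" where
  "ind_mor = (\<lambda>k\<in>J. Z.germ (dob V k) (\<sigma> k) (f k))"

lemma ind_mor_in_ind_hom: "ind_mor \<in> ind_hom R V Z"
  unfolding ind_hom_def
proof (intro CollectI conjI ballI)
  show "ind_mor \<in> (\<Pi>\<^sub>E k\<in>Ob (idx V). colim_hom R (dob V k) Z)"
    by (auto simp: ind_mor_def V.idx_D intro!: Z.germ_in_colim_hom \<sigma> f)
next
  fix u z assume "u \<in> Arr (idx V)" and z: "z \<in> ind_mor (tgt (idx V) u)"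
  then obtain k k' where u: "u = (k, k')" "(k, k') \<in> q" by (cases u) (simp add: V.idx_D)
  obtain j g where zz: "z = (j, g)" by (cases z)
  have k: "k \<in> J" "k' \<in> J" using V.q_field[OF u(2)] by auto
  have "((\<sigma> k', f k'), (j, g)) \<in> colim_rel R (dob V k') Z"
    using z zz u k by (simp add: V.idx_D ind_mor_def Z.mem_germ_iff)
  from Z.colim_rel_precomp[OF V.snm_D[OF k(2)] V.snm_D[OF k(1)] V.tr_hom[OF u(2)] this]
  have "((\<sigma> k, f k), (j, compose (carrier (dob V k)) g (dar V (k, k')))) \<in> colim_rel R (dob V k) Z"
    using Z.colim_rel_trans[OF Z.colim_rel_sym[OF compat[OF u(2)]]] by blast
  then show "case z of (j, g) \<Rightarrow> (j, compose (carrier (dob V (src (idx V) u))) g (dar V u))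
      \<in> ind_mor (src (idx V) u)"
    using zz u k by (simp add: V.idx_D ind_mor_def Z.mem_germ_iff)
qed

end

text \<open>Composition of morphisms of ind-objects is composition of representatives.\<close>

lemma ind_comp_ind_mor:
  assumes F: "ind_morphism R J q V J' q' W \<sigma> f" and G: "ind_morphism R J' q' W J'' q'' Z \<tau> g"
  shows "ind_comp R V Z (ind_morphism.ind_mor R J' W Z \<tau> g) (ind_morphism.ind_mor R J V W \<sigma> f) =
    (\<lambda>k\<in>J. directed_diagram.germ R Z (dob V k) (\<tau> (\<sigma> k)) (compose (carrier (dob V k)) (g (\<sigma> k)) (f k)))"
proof -
  interpret F: ind_morphism R J q V J' q' W \<sigma> f by (rule F)
  interpret G: ind_morphism R J' q' W J'' q'' Z \<tau> g by (rule G)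
  have rel: "((\<tau> (\<sigma> k), compose (carrier (dob V k)) (g (\<sigma> k)) (f k)), (l, compose (carrier (dob V k)) h e))
      \<in> colim_rel R (dob V k) Z"
    if k: "k \<in> J" and je: "((\<sigma> k, f k), (j, e)) \<in> colim_rel R (dob V k) W"
      and lh: "((\<tau> j, g j), (l, h)) \<in> colim_rel R (dob W j) Z" for k j e l h
  proof -
    obtain m where m: "(\<sigma> k, m) \<in> q'" "(j, m) \<in> q'"
        "\<And>x. x \<in> carrier (dob V k) \<Longrightarrow> dar W (\<sigma> k, m) (f k x) = dar W (j, m) (e x)"
      and e: "e \<in> ban_hom R (dob V k) (dob W j)"
      using je unfolding F.Z.colim_rel_iff by blast
    have J: "\<sigma> k \<in> J'" "m \<in> J'" "j \<in> J'" using F.Z.q_field m by blast+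
    note sV = F.V.snm_D[OF k] and sW = F.Z.snm_D[OF J(1)] F.Z.snm_D[OF J(2)] F.Z.snm_D[OF J(3)]
    let ?A = "carrier (dob V k)"
    have 1: "((\<tau> m, compose ?A (compose (carrier (dob W (\<sigma> k))) (g m) (dar W (\<sigma> k, m))) (f k)),
        (\<tau> (\<sigma> k), compose ?A (g (\<sigma> k)) (f k))) \<in> colim_rel R (dob V k) Z"
      by (rule G.Z.colim_rel_precomp[OF sW(1) sV F.f[OF k] G.compat[OF m(1)]])
    have 2: "((\<tau> m, compose ?A (compose (carrier (dob W j)) (g m) (dar W (j, m))) e),
        (\<tau> j, compose ?A (g j) e)) \<in> colim_rel R (dob V k) Z"
      by (rule G.Z.colim_rel_precomp[OF sW(3) sV e G.compat[OF m(2)]])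
    have 3: "((\<tau> j, compose ?A (g j) e), (l, compose ?A h e)) \<in> colim_rel R (dob V k) Z"
      by (rule G.Z.colim_rel_precomp[OF sW(3) sV e lh])
    have "compose ?A (compose (carrier (dob W (\<sigma> k))) (g m) (dar W (\<sigma> k, m))) (f k) =
        compose ?A (compose (carrier (dob W j)) (g m) (dar W (j, m))) e"
      unfolding compose_eq_iff
      using m(3) ban_homD(2)[OF e] ban_homD(2)[OF F.f[OF k]] by (simp add: compose_eq)
    then show ?thesis
      using 1 2 3 G.Z.colim_rel_trans G.Z.colim_rel_sym by metis
  qed
  show ?thesis
    unfolding ind_comp_def F.V.idx_D order_category_simps
  proof (rule restrict_ext)
    fix k assume k: "k \<in> J"
    let ?c = "\<lambda>l h. colim_rel R (dob V k) Z `` {(l, h)}"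
    have k': "\<sigma> k \<in> J'" using F.\<sigma>[OF k] .
    have phi: "F.ind_mor k = F.Z.germ (dob V k) (\<sigma> k) (f k)" using k by (simp add: F.ind_mor_def)
    have psi: "G.ind_mor j = G.Z.germ (dob W j) (\<tau> j) (g j)" if "j \<in> J'" for j
      using that by (simp add: G.ind_mor_def)
    have eq: "?c l (compose (carrier (dob V k)) h e) =
        G.Z.germ (dob V k) (\<tau> (\<sigma> k)) (compose (carrier (dob V k)) (g (\<sigma> k)) (f k))"
      if "(j, e) \<in> F.ind_mor k" "(l, h) \<in> G.ind_mor j" for j e l h
    proof -
      have je: "((\<sigma> k, f k), (j, e)) \<in> colim_rel R (dob V k) W"
        using that(1) by (simp add: phi F.Z.mem_germ_iff)
      then have "j \<in> J'" by (simp add: F.Z.colim_rel_iff)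
      then have lh: "((\<tau> j, g j), (l, h)) \<in> colim_rel R (dob W j) Z"
        using that(2) by (simp add: psi G.Z.mem_germ_iff)
      show ?thesis
        using G.Z.germ_eqI[OF rel[OF k je lh]] by (simp add: G.Z.germ_def)
    qed
    have ne: "(\<sigma> k, f k) \<in> F.ind_mor k" "(\<tau> (\<sigma> k), g (\<sigma> k)) \<in> G.ind_mor (\<sigma> k)"
      using k k' F.f[OF k] G.\<sigma>[OF k'] G.f[OF k']
      by (auto simp: phi psi F.Z.mem_germ_iff G.Z.mem_germ_iff intro!: F.Z.colim_rel_refl G.Z.colim_rel_refl)
    show "(\<Union>(j, e)\<in>F.ind_mor k. \<Union>(l, h)\<in>G.ind_mor j. ?c l (compose (carrier (dob V k)) h e)) =
        G.Z.germ (dob V k) (\<tau> (\<sigma> k)) (compose (carrier (dob V k)) (g (\<sigma> k)) (f k))" (is "?L = ?R")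
    proof (rule subset_antisym)
      show "?L \<subseteq> ?R" using eq by fast
      have "?R = ?c (\<tau> (\<sigma> k)) (compose (carrier (dob V k)) (g (\<sigma> k)) (f k))"
        by (simp add: G.Z.germ_def)
      then show "?R \<subseteq> ?L" using ne by fast
    qed
  qed
qed

lemma (in directed_diagram) ind_id_eq:
  "ind_id R D = (\<lambda>k\<in>J. germ (dob D k) k (\<lambda>x\<in>carrier (dob D k). x))"
  by (simp add: ind_id_def idx_D germ_def)

section \<open>Nuclear ind-objects have nuclear transition maps\<close>

text \<open>Let \<open>X = D\<^sub>i\<close> and let \<open>\<psi>\<close> be inverse to the natural morphism.  On \<open>Hom(X, D\<^sub>i)\<close> it is represented
  by some \<open>f : Hom(X, D\<^sub>i) \<rightarrow> X\<^sup>\<or> \<otimes> D\<^sub>j\<close>.  As \<open>\<psi>\<close> followed by the natural morphism is the identity,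
  the canonical image of \<open>t = f id\<close> and the identity of \<open>X\<close> have the same image in
  \<open>colim\<^sub>k Hom(X, D\<^sub>k)\<close>.  So at a later stage \<open>k\<close> the transition map \<open>D\<^sub>i \<rightarrow> D\<^sub>k\<close> is the nuclear
  morphism given by \<open>t\<close> followed by \<open>D\<^sub>j \<rightarrow> D\<^sub>k\<close>.\<close>

lemma (in directed_diagram) nuclear_ind_transition:
  assumes nuc: "nuclear_ind R D" and i: "i \<in> J"
  shows "\<exists>j. (i, j) \<in> q \<and> (\<exists>\<phi> w. nuclear_series R (dob D i) (dob D j) (tr i j) \<phi> w)"
proof -
  define X where "X = dob D i"
  have Xb: "banach_mod R X" unfolding X_def by (rule banach_mod_D[OF i])
  then have "banach_module R X" by (rule banach_mod.banach_module)
  define T where "T = tensor_diagram R (dual R X) D"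
  define H where "H = hom_diagram R X D"
  define N where "N = natural_morphism R X D"
  have "ind_iso R T H N"
    using nuc \<open>banach_module R X\<close> unfolding nuclear_ind_def T_def H_def N_def by blast
  then obtain \<psi> where psi: "\<psi> \<in> ind_hom R H T" and inv: "ind_comp R H H N \<psi> = ind_id R H"
    unfolding ind_iso_def by blast
  have HT: "Ob (idx H) = J" "Ob (idx T) = J" "idx H = order_category J q"
    "\<And>k. dob H k = ihom R X (dob D k)" "\<And>k. dob T k = ctensor R (dual R X) (dob D k)"
    by (simp_all add: H_def T_def hom_diagram_def tensor_diagram_def idx_D)
  have dar_H: "dar H (j, k) h x = tr j k (h x)"
    if "h \<in> ban_hom R X (dob D j)" "x \<in> carrier X" for j k h x
    using that by (simp add: H_def hom_diagram_def idx_D compose_eq)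
  have pair: "nuclear_pair R X (dob D j)" if "j \<in> J" for j
    by (rule nuclear_pairI[OF Xb banach_mod_D[OF that]])
  define E where "E = ihom R X (dob D i)"
  have cE: "carrier (ihom R X V) = ban_hom R X V" for V :: "('a, 'b) nmodule" by (simp add: ihom_def)
  define idX where "idX = (\<lambda>x\<in>carrier X. x)"
  have idX: "idX \<in> ban_hom R X (dob D i)"
  proof -
    interpret X: banach_mod R X by (rule Xb)
    show ?thesis
      unfolding X_def[symmetric] by (rule ban_homI[where C = 1]) (auto simp: idX_def)
  qed
  define idE where "idE = (\<lambda>h\<in>carrier E. h)"
  have "((i, idE), (i, idE)) \<in> colim_rel R E H"
  proof -
    interpret NP: nuclear_pair R X "dob D i" by (rule pair[OF i])
    have "idE \<in> ban_hom R E (dob H i)"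
      unfolding HT(4) E_def[symmetric]
    proof (rule ban_homI[where C = 1])
      interpret EE: module R E unfolding E_def by (rule NP.Hm.module_axioms)
      show "idE (x \<oplus>\<^bsub>E\<^esub> y) = idE x \<oplus>\<^bsub>E\<^esub> idE y" if "x \<in> carrier E" "y \<in> carrier E" for x y
        using that by (simp add: idE_def)
      show "idE (a \<odot>\<^bsub>E\<^esub> x) = a \<odot>\<^bsub>E\<^esub> idE x" if "a \<in> carrier R" "x \<in> carrier E" for a x
        using that by (simp add: idE_def)
    qed (simp_all add: idE_def)
    moreover have "\<exists>u\<in>q. \<exists>u'\<in>q. fst u = i \<and> fst u' = i \<and> snd u = snd u' \<and>
        compose (carrier E) (dar H u) idE = compose (carrier E) (dar H u') idE"
      by (intro bexI[of _ "(i, i)"]) (simp_all add: q_refl[OF i])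
    ultimately show ?thesis
      by (simp add: colim_rel_def HT i)
  qed
  then have "(i, idE) \<in> ind_id R H i"
    using i HT by (simp add: ind_id_def idE_def E_def)
  then have "(i, idE) \<in> ind_comp R H H N \<psi> i" by (simp only: inv)
  then obtain j f l g where jf: "(j, f) \<in> \<psi> i" and lg: "(l, g) \<in> N j"
    and rel: "((l, compose (carrier E) g f), (i, idE)) \<in> colim_rel R E H"
    using i HT by (auto simp: ind_comp_def E_def)
  have "\<psi> i \<in> colim_hom R E T"
    using psi i HT unfolding ind_hom_def E_def by (simp add: PiE_iff)
  then obtain z where "\<psi> i = colim_rel R E T `` {z}" unfolding colim_hom_def by (rule quotientE)
  with jf have "(z, (j, f)) \<in> colim_rel R E T" by simp
  then have j: "j \<in> J" and f: "f \<in> ban_hom R E (dob T j)"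
    using HT by (auto simp: colim_rel_def)
  interpret NJ: nuclear_pair R X "dob D j" by (rule pair[OF j])
  define t where "t = f idX"
  have idX_E: "idX \<in> carrier E" using idX by (simp add: E_def cE)
  have t: "t \<in> carrier (ctensor R (dual R X) (dob D j))"
    unfolding t_def using ban_homD(2)[OF f idX_E] by (simp add: HT)
  have can: "NJ.can t \<in> ban_hom R X (dob D j)" by (rule NJ.canonical_map_closed[OF t])
  have "((j, canonical_map R X (dob D j)), (l, g)) \<in>
      colim_rel R (ctensor R (dual R X) (dob D j)) H"
    using lg j unfolding N_def natural_morphism_def H_def by (simp add: idx_D)
  then obtain u u' where u: "u \<in> q" "u' \<in> q" "fst u = j" "fst u' = l" "snd u = snd u'"
    and ueq: "compose (carrier (ctensor R (dual R X) (dob D j))) (dar H u) (canonical_map R X (dob D j)) =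
      compose (carrier (ctensor R (dual R X) (dob D j))) (dar H u') g"
    and l: "l \<in> J" and g: "g \<in> ban_hom R (ctensor R (dual R X) (dob D j)) (dob H l)"
    unfolding colim_rel_def using HT by auto
  define m where "m = snd u"
  have um: "u = (j, m)" "u' = (l, m)" using u by (simp_all add: m_def prod_eq_iff)
  have jm: "(j, m) \<in> q" "(l, m) \<in> q" using u(1,2) um by simp_all
  have gt: "g t \<in> ban_hom R X (dob D l)"
    using ban_homD(2)[OF g t] by (simp add: HT cE)
  have eq1: "tr j m (NJ.can t x) = tr l m (g t x)" if x: "x \<in> carrier X" for x
  proof -
    have "dar H (j, m) (NJ.can t) = dar H (l, m) (g t)"
      using ueq t unfolding compose_eq_iff um by blast
    then show ?thesis
      using dar_H[OF can x, of m] dar_H[OF gt x, of m] by simp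
  qed
  obtain v v' where v: "v \<in> q" "v' \<in> q" "fst v = l" "fst v' = i" "snd v = snd v'"
    and veq: "compose (carrier E) (dar H v) (compose (carrier E) g f) = compose (carrier E) (dar H v') idE"
    using rel unfolding colim_rel_def using HT by auto
  define n where "n = snd v"
  have vn: "v = (l, n)" "v' = (i, n)" using v by (simp_all add: n_def prod_eq_iff)
  have ln: "(l, n) \<in> q" "(i, n) \<in> q" using v(1,2) vn by simp_all
  have eq2: "tr l n (g t x) = tr i n x" if x: "x \<in> carrier X" for x
  proof -
    have "dar H (l, n) (compose (carrier E) g f idX) = dar H (i, n) (idE idX)"
      using veq idX_E unfolding compose_eq_iff vn by blast
    then have "dar H (l, n) (g t) = dar H (i, n) idX"
      using idX_E by (simp add: compose_eq idE_def t_def)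
    then show ?thesis
      using dar_H[OF gt x, of n] dar_H[OF idX x, of n] x by (simp add: idX_def)
  qed
  obtain k where k: "(m, k) \<in> q" "(n, k) \<in> q" using directed q_field jm(1) ln(1) by blast
  have ik: "(i, k) \<in> q" and jk: "(j, k) \<in> q" using q_trans ln(2) jm(1) k by blast+
  obtain \<phi> w where phi: "nuclear_series R X (dob D j) (NJ.can t) \<phi> w"
    using NJ.canonical_map_nuclear_series[OF t] by blast
  have "tr i k = compose (carrier X) (tr j k) (NJ.can t)"
  proof (rule ban_hom_eqI[OF tr_hom[OF ik]])
    show "compose (carrier X) (tr j k) (NJ.can t) \<in> ban_hom R (dob D i) (dob D k)"
      using compose_ban_hom[OF NJ.V.seminormed_module_axioms NJ.W.seminormed_module_axioms can tr_hom[OF jk]]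
      by (simp add: X_def)
    fix x assume "x \<in> carrier (dob D i)"
    then have x: "x \<in> carrier X" by (simp add: X_def)
    have "tr i k x = tr n k (tr i n x)" by (rule tr_tr[OF ln(2) k(2), symmetric]) (use x X_def in simp)
    also have "\<dots> = tr n k (tr l n (g t x))" by (simp only: eq2[OF x])
    also have "\<dots> = tr l k (g t x)" by (rule tr_tr[OF ln(1) k(2) ban_homD(2)[OF gt x]])
    also have "\<dots> = tr m k (tr l m (g t x))"
      by (rule tr_tr[OF jm(2) k(1) ban_homD(2)[OF gt x], symmetric])
    also have "\<dots> = tr m k (tr j m (NJ.can t x))" by (simp only: eq1[OF x])
    also have "\<dots> = tr j k (NJ.can t x)" by (rule tr_tr[OF jm(1) k(1) ban_homD(2)[OF can x]])
    finally show "tr i k x = compose (carrier X) (tr j k) (NJ.can t) x" using x by (simp add: compose_eq)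
  qed
  moreover have "nuclear_series R X (dob D k) (compose (carrier X) (tr j k) (NJ.can t)) \<phi> (\<lambda>s. tr j k (w s))"
    using q_field[OF jk] by (intro nuclear_series_post[OF Xb banach_mod_D banach_mod_D phi tr_hom[OF jk]]) auto
  ultimately have "nuclear_series R X (dob D k) (tr i k) \<phi> (\<lambda>s. tr j k (w s))" by simp
  then show ?thesis using ik unfolding X_def by blast
qed

section \<open>The interleaved system\<close>

lemma infinite_times_eqpoll_self: "infinite I \<Longrightarrow> I \<times> I \<approx> I"
  by (simp add: eqpoll_iff_card_of_ordIso card_of_Times_same_infinite)

lemma infinite_order_eqpoll:
  assumes "infinite I" "partial_order_on I r"
  shows "r \<approx> I"
proof (rule lepoll_antisym)
  have "r \<lesssim> I \<times> I" using partial_order_onD(4)[OF assms(2)] by (rule subset_imp_lepoll)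
  also have "I \<times> I \<approx> I" using assms(1) by (rule infinite_times_eqpoll_self)
  finally show "r \<lesssim> I" .
  have "(i, i) \<in> r" if "i \<in> I" for i
    using partial_order_onD(1)[OF assms(2)] that by (rule refl_onD)
  then show "I \<lesssim> r" unfolding lepoll_def by (intro exI[of _ "\<lambda>i. (i, i)"]) (auto simp: inj_on_def)
qed

lemma infinite_times_nat_eqpoll:
  assumes "infinite I"
  shows "I \<times> (UNIV :: nat set) \<approx> I"
proof (rule lepoll_antisym)
  have "(UNIV :: nat set) \<lesssim> I" using assms by (simp add: infinite_le_lepoll)
  then have "I \<times> (UNIV :: nat set) \<lesssim> I \<times> I" by (intro times_lepoll_mono lepoll_refl)
  also have "I \<times> I \<approx> I" using assms by (rule infinite_times_eqpoll_self)
  finally show "I \<times> (UNIV :: nat set) \<lesssim> I" .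
  show "I \<lesssim> I \<times> (UNIV :: nat set)"
    unfolding lepoll_def by (intro exI[of _ "\<lambda>i. (i, 0)"]) (auto simp: inj_on_def)
qed

lemma id_hom: "banach_mod R V \<Longrightarrow> (\<lambda>x\<in>carrier V. x) \<in> ban_hom R V V"
proof -
  assume "banach_mod R V"
  then interpret banach_mod R V .
  show ?thesis by (rule ban_homI[where C = 1]) auto
qed

text \<open>A system \<open>W\<close> with transition maps \<open>W\<^sub>i \<rightarrow> W\<^bsub>s i\<^esub>\<close> that factor as \<open>a i\<close> followed by a nuclear map \<open>b i\<close>
  through a weighted product \<open>L\<^sub>i\<close> of copies of the ring.  A bijection of \<open>I\<close> with \<open>I \<times> \<nat>\<close>, with
  components \<open>base\<close> and \<open>lev\<close>, makes the elements of \<open>I\<close> stand for pairs.\<close>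

locale factored_diagram = D: directed_diagram R I r W
  for R :: "'a nring" (structure) and I :: "'i set" and r :: "'i rel"
    and W :: "('a, 'b, 'i, 'i \<times> 'i) diagram" +
  fixes s :: "'i \<Rightarrow> 'i" and c :: "'i \<Rightarrow> nat \<Rightarrow> real"
    and a :: "'i \<Rightarrow> 'b \<Rightarrow> nat \<Rightarrow> 'a" and b :: "'i \<Rightarrow> (nat \<Rightarrow> 'a) \<Rightarrow> 'b"
    and base :: "'i \<Rightarrow> 'i" and lev :: "'i \<Rightarrow> nat"
  assumes infinite_I: "infinite I"
    and s: "i \<in> I \<Longrightarrow> (i, s i) \<in> r"
    and c: "i \<in> I \<Longrightarrow> 0 < c i n"
    and a: "i \<in> I \<Longrightarrow> a i \<in> ban_hom R (dob W i) (weighted_product R UNIV (c i))"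
    and b_nuc: "i \<in> I \<Longrightarrow> \<exists>\<phi> w. nuclear_series R (weighted_product R UNIV (c i)) (dob W (s i)) (b i) \<phi> w"
    and ba: "i \<in> I \<Longrightarrow> x \<in> carrier (dob W i) \<Longrightarrow> b i (a i x) = dar W (i, s i) x"
    and bij: "bij_betw (\<lambda>k. (base k, lev k)) I (I \<times> UNIV)"
begin

abbreviation "LL i \<equiv> weighted_product R (UNIV :: nat set) (c i)"

lemma banach_LL: "i \<in> I \<Longrightarrow> banach_mod R (LL i)"
  by (rule weighted_prod.banach_mod_weighted_product[OF weighted_prod.intro[OF D.banach_ring_R c]])

lemma snm_LL: "i \<in> I \<Longrightarrow> seminormed_module R (LL i)"
  by (rule banach_mod.axioms(1)[OF banach_LL])

lemma b: "i \<in> I \<Longrightarrow> b i \<in> ban_hom R (LL i) (dob W (s i))"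
  using b_nuc nuclear_seriesD(1) by blast

lemma base: "k \<in> I \<Longrightarrow> base k \<in> I"
  using bij_betwE[OF bij] by blast

lemma s_in: "i \<in> I \<Longrightarrow> s i \<in> I"
  using s D.q_field by blast

lemma ex_index: "i \<in> I \<Longrightarrow> \<exists>k\<in>I. base k = i \<and> lev k = n"
proof -
  assume "i \<in> I"
  then have "(i, n) \<in> (\<lambda>k. (base k, lev k)) ` I" using bij by (simp add: bij_betw_def)
  then show ?thesis by blast
qed

text \<open>The strict order on \<open>I \<times> \<nat>\<close>.  The condition on \<open>lev\<close> makes it irreflexive even if
  \<open>s i = i\<close>.\<close>

definition below :: "'i \<Rightarrow> 'i \<Rightarrow> bool" where
  "below k l \<longleftrightarrow> k \<in> I \<and> l \<in> I \<and> (s (base k), base l) \<in> r \<and> lev k < lev l"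

definition r' :: "'i rel" where
  "r' = {(k, l). k \<in> I \<and> l \<in> I \<and> (k = l \<or> below k l)}"

lemma below_trans: "below k l \<Longrightarrow> below l m \<Longrightarrow> below k m"
  unfolding below_def using D.q_trans s base by (metis less_trans)

lemma below_irrefl: "\<not> below k k"
  by (simp add: below_def)

lemma below_base: "below k l \<Longrightarrow> (base k, base l) \<in> r"
  unfolding below_def using D.q_trans s base by blast

lemma partial_order_r': "partial_order_on I r'"
  unfolding partial_order_on_def preorder_on_def
proof (intro conjI)
  show "r' \<subseteq> I \<times> I" by (auto simp: r'_def)
  show "refl_on I r'" by (auto simp: refl_on_def r'_def)
  show "trans r'" by (rule transI) (auto simp: r'_def dest: below_trans)
  show "antisym r'" by (rule antisymI) (use below_trans below_irrefl in \<open>auto simp: r'_def\<close>)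
qed

lemma ex_above:
  assumes "k \<in> I" "l \<in> I"
  shows "\<exists>m. below k m \<and> below l m"
proof -
  obtain j where j: "(s (base k), j) \<in> r" "(s (base l), j) \<in> r"
    using D.directed[OF s_in[OF base[OF assms(1)]] s_in[OF base[OF assms(2)]]] by blast
  then have "j \<in> I" using D.q_field by blast
  then obtain m where "m \<in> I" "base m = j" "lev m = Suc (max (lev k) (lev l))" using ex_index by blast
  then show ?thesis using assms j by (intro exI[of _ m]) (auto simp: below_def)
qed

text \<open>With \<open>i\<close> and \<open>j\<close> for the base of \<open>k\<close> and of \<open>l\<close>, the transition map from \<open>k\<close> to a strictly larger
  index \<open>l\<close> is \<open>L\<^sub>i \<rightarrow> W\<^bsub>s i\<^esub> \<rightarrow> W\<^sub>j \<rightarrow> L\<^sub>j\<close>.\<close>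

definition trL :: "'i \<Rightarrow> 'i \<Rightarrow> (nat \<Rightarrow> 'a) \<Rightarrow> nat \<Rightarrow> 'a" where
  "trL k l = (if k = l then (\<lambda>x\<in>carrier (LL (base k)). x)
     else compose (carrier (LL (base k))) (a (base l))
       (compose (carrier (LL (base k))) (dar W (s (base k), base l)) (b (base k))))"

text \<open>The interleaved system \<open>L\<close>.\<close>

definition LD :: "('a, nat \<Rightarrow> 'a, 'i, 'i \<times> 'i) diagram" where
  "LD = \<lparr>idx = order_category I r', dob = (\<lambda>k. LL (base k)), dar = (\<lambda>u. trL (fst u) (snd u))\<rparr>"

lemma trL_below:
  "below k l \<Longrightarrow> x \<in> carrier (LL (base k)) \<Longrightarrow>
    trL k l x = a (base l) (dar W (s (base k), base l) (b (base k) x))"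
  using below_irrefl by (auto simp: trL_def compose_eq)

lemma trL_nuclear:
  assumes kl: "below k l"
  shows "\<exists>\<phi> w. nuclear_series R (LL (base k)) (LL (base l)) (trL k l) \<phi> w"
proof -
  have I: "k \<in> I" "l \<in> I" and sr: "(s (base k), base l) \<in> r" using kl by (auto simp: below_def)
  note B = base[OF I(1)] base[OF I(2)] s_in[OF base[OF I(1)]]
  obtain \<phi> w where "nuclear_series R (LL (base k)) (dob W (s (base k))) (b (base k)) \<phi> w"
    using b_nuc[OF B(1)] by blast
  note 1 = nuclear_series_post[OF banach_LL[OF B(1)] D.banach_mod_D[OF B(3)] D.banach_mod_D[OF B(2)] this D.tr_hom[OF sr]]
  note 2 = nuclear_series_post[OF banach_LL[OF B(1)] D.banach_mod_D[OF B(2)] banach_LL[OF B(2)] 1 a[OF B(2)]]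
  have "k \<noteq> l" using kl below_irrefl by blast
  then show ?thesis using 2 by (auto simp: trL_def)
qed

lemma trL_hom:
  assumes "(k, l) \<in> r'"
  shows "trL k l \<in> ban_hom R (LL (base k)) (LL (base l))"
proof (cases "k = l")
  case True
  have "k \<in> I" using assms by (auto simp: r'_def)
  then show ?thesis using True id_hom[OF banach_LL[OF base]] by (simp add: trL_def)
next
  case False
  then have "below k l" using assms by (auto simp: r'_def)
  then show ?thesis using trL_nuclear nuclear_seriesD(1) by blast
qed

text \<open>Functoriality: \<open>W\<^sub>j \<rightarrow> L\<^sub>j \<rightarrow> W\<^bsub>s j\<^esub>\<close> is a transition map of \<open>W\<close>, so the passage through \<open>L\<^sub>j\<close>
  disappears from the composite.\<close>

lemma trL_trL:
  assumes kl: "below k l" and lm: "below l m" and x: "x \<in> carrier (LL (base k))"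
  shows "trL l m (trL k l x) = trL k m x"
proof -
  have I: "base k \<in> I" "base l \<in> I" "base m \<in> I" using kl lm base by (auto simp: below_def)
  have r: "(s (base k), base l) \<in> r" "(s (base l), base m) \<in> r" using kl lm by (auto simp: below_def)
  define y where "y = b (base k) x"
  have y: "y \<in> carrier (dob W (s (base k)))" unfolding y_def by (rule ban_homD(2)[OF b[OF I(1)] x])
  define z where "z = dar W (s (base k), base l) y"
  have z: "z \<in> carrier (dob W (base l))" unfolding z_def by (rule D.tr_closed[OF r(1) y])
  have "trL l m (trL k l x) = trL l m (a (base l) z)"
    by (simp add: trL_below[OF kl x] z_def y_def)
  also have "\<dots> = a (base m) (dar W (s (base l), base m) (b (base l) (a (base l) z)))"
    by (rule trL_below[OF lm ban_homD(2)[OF a[OF I(2)] z]])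
  also have "b (base l) (a (base l) z) = dar W (base l, s (base l)) z" by (rule ba[OF I(2) z])
  also have "dar W (s (base l), base m) (dar W (base l, s (base l)) z) = dar W (base l, base m) z"
    by (rule D.tr_tr[OF s[OF I(2)] r(2) z])
  also have "\<dots> = dar W (s (base k), base m) y"
    unfolding z_def by (rule D.tr_tr[OF r(1) D.q_trans[OF s[OF I(2)] r(2)] y])
  also have "a (base m) \<dots> = trL k m x"
    by (simp add: trL_below[OF below_trans[OF kl lm] x] y_def)
  finally show ?thesis .
qed

lemma is_category_order: "partial_order_on J q \<Longrightarrow> is_category (order_category J q)"
  using partial_order_onD(1,2,4)[of J q] unfolding is_category_def
  by (auto simp: refl_on_def dest: transD)

lemma functor_LD: "banach_functor R LD"
  unfolding banach_functor_def
proof (intro conjI ballI impI)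
  show "is_category (idx LD)" using is_category_order[OF partial_order_r'] by (simp add: LD_def)
  show "banach_module R (dob LD k)" if "k \<in> Ob (idx LD)" for k
    using that banach_mod.banach_module[OF banach_LL[OF base]] by (simp add: LD_def)
  show "dar LD u \<in> ban_hom R (dob LD (src (idx LD) u)) (dob LD (tgt (idx LD) u))" if "u \<in> Arr (idx LD)" for u
    using that trL_hom by (cases u) (simp add: LD_def)
  show "dar LD (ident (idx LD) k) = (\<lambda>x\<in>carrier (dob LD k). x)" for k
    by (simp add: LD_def trL_def)
next
  fix u v assume uv: "u \<in> Arr (idx LD)" "v \<in> Arr (idx LD)" "tgt (idx LD) u = src (idx LD) v"
  obtain k l m where u: "u = (k, l)" and v: "v = (l, m)" using uv(3) by (cases u; cases v) (simp add: LD_def)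
  have r: "(k, l) \<in> r'" "(l, m) \<in> r'" using uv u v by (simp_all add: LD_def)
  have I: "base k \<in> I" "base l \<in> I" using r base by (auto simp: r'_def)
  have km: "(k, m) \<in> r'" using transD[OF partial_order_onD(2)[OF partial_order_r'] r] .
  have "trL k m = compose (carrier (LL (base k))) (trL l m) (trL k l)"
  proof (rule ban_hom_eqI[OF trL_hom[OF km]
        compose_ban_hom[OF snm_LL[OF I(1)] snm_LL[OF I(2)] trL_hom[OF r(1)] trL_hom[OF r(2)]]])
    fix x assume x: "x \<in> carrier (LL (base k))"
    have xl: "trL k l x \<in> carrier (LL (base l))" by (rule ban_homD(2)[OF trL_hom[OF r(1)] x])
    have id: "trL j j y = y" if "y \<in> carrier (LL (base j))" for j y using that by (simp add: trL_def)
    have "trL k m x = trL l m (trL k l x)"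
    proof (cases "k = l \<or> l = m")
      case True
      then show ?thesis using id[OF x] id[OF xl] by auto
    next
      case False
      then have "below k l" "below l m" using r by (auto simp: r'_def)
      then show ?thesis using trL_trL x by simp
    qed
    then show "trL k m x = compose (carrier (LL (base k))) (trL l m) (trL k l) x"
      using x by (simp add: compose_eq)
  qed
  then show "dar LD (cmp (idx LD) v u) =
      compose (carrier (dob LD (src (idx LD) u))) (dar LD v) (dar LD u)"
    by (simp add: LD_def u v)
qed

lemma r'_below: "below k l \<Longrightarrow> (k, l) \<in> r'"
  by (simp add: r'_def below_def)

sublocale L: directed_diagram R I r' LD
proof
  show "\<exists>m\<in>I. (k, m) \<in> r' \<and> (l, m) \<in> r'" if kl: "k \<in> I" "l \<in> I" for k l
  proof -
    obtain m where m: "below k m" "below l m" using ex_above[OF kl] by blast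
    then have "m \<in> I" by (simp add: below_def)
    then show ?thesis using r'_below m by blast
  qed
qed (simp_all add: D.banach_ring_R partial_order_r' functor_LD, simp add: LD_def)

lemma dob_LD: "dob LD k = LL (base k)" and dar_LD: "dar LD (k, l) = trL k l"
  by (simp_all add: LD_def)

text \<open>An index over \<open>i\<close>; the level does not matter.\<close>

definition idx0 :: "'i \<Rightarrow> 'i" where
  "idx0 i = (SOME k. k \<in> I \<and> base k = i)"

lemma idx0: "i \<in> I \<Longrightarrow> idx0 i \<in> I" "i \<in> I \<Longrightarrow> base (idx0 i) = i"
  using someI_ex[of "\<lambda>k. k \<in> I \<and> base k = i"] ex_index[of i 0] unfolding idx0_def by blast+

text \<open>The maps \<open>a\<close> are compatible with the transition maps to a strictly larger index.\<close>

lemma trL_a: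
  assumes i: "k \<in> I" and km: "below k m" and x: "x \<in> carrier (dob W (base k))"
  shows "trL k m (a (base k) x) = a (base m) (dar W (base k, base m) x)"
proof -
  have r: "(s (base k), base m) \<in> r" using km by (simp add: below_def)
  have B: "base k \<in> I" by (rule base[OF i])
  have "trL k m (a (base k) x) = a (base m) (dar W (s (base k), base m) (b (base k) (a (base k) x)))"
    by (rule trL_below[OF km ban_homD(2)[OF a[OF B] x]])
  also have "dar W (s (base k), base m) (b (base k) (a (base k) x)) = dar W (base k, base m) x"
    unfolding ba[OF B x] by (rule D.tr_tr[OF s[OF B] r x])
  finally show ?thesis .
qed

lemma to_L: "ind_morphism R I r W I r' LD idx0 a"
proof (unfold_locales)
  show "idx0 i \<in> I" if "i \<in> I" for i by (rule idx0(1)[OF that])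
  show a': "a i \<in> ban_hom R (dob W i) (dob LD (idx0 i))" if "i \<in> I" for i
    using a[OF that] by (simp add: dob_LD idx0(2)[OF that])
  fix i i' assume ii: "(i, i') \<in> r"
  have I: "i \<in> I" "i' \<in> I" using D.q_field[OF ii] by auto
  obtain m where m: "below (idx0 i) m" "below (idx0 i') m"
    using ex_above[OF idx0(1)[OF I(1)] idx0(1)[OF I(2)]] by blast
  have im: "(i, base m) \<in> r" "(i', base m) \<in> r"
    using below_base[OF m(1)] below_base[OF m(2)] I by (simp_all add: idx0(2))
  show "((idx0 i', compose (carrier (dob W i)) (a i') (dar W (i, i'))), (idx0 i, a i))
      \<in> colim_rel R (dob W i) LD"
  proof (rule L.colim_relI[OF r'_below[OF m(2)] r'_below[OF m(1)]
        compose_ban_hom[OF D.snm_D[OF I(1)] D.snm_D[OF I(2)] D.tr_hom[OF ii] a'[OF I(2)]] a'[OF I(1)]])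
    fix x assume x: "x \<in> carrier (dob W i)"
    have "trL (idx0 i') m (a i' (dar W (i, i') x)) = a (base m) (dar W (i', base m) (dar W (i, i') x))"
      using trL_a[OF idx0(1)[OF I(2)] m(2)] D.tr_closed[OF ii x] by (simp add: idx0(2)[OF I(2)])
    also have "\<dots> = a (base m) (dar W (i, base m) x)" using D.tr_tr[OF ii im(2) x] by simp
    also have "\<dots> = trL (idx0 i) m (a i x)"
      using trL_a[OF idx0(1)[OF I(1)] m(1)] x by (simp add: idx0(2)[OF I(1)])
    finally show "dar LD (idx0 i', m) (compose (carrier (dob W i)) (a i') (dar W (i, i')) x) =
        dar LD (idx0 i, m) (a i x)"
      using x by (simp add: dar_LD compose_eq)
  qed
qed

lemma from_L: "ind_morphism R I r' LD I r W (\<lambda>k. s (base k)) (\<lambda>k. b (base k))"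
proof (unfold_locales)
  show "s (base k) \<in> I" if "k \<in> I" for k by (rule s_in[OF base[OF that]])
  show b': "b (base k) \<in> ban_hom R (dob LD k) (dob W (s (base k)))" if "k \<in> I" for k
    using b[OF base[OF that]] by (simp add: dob_LD)
  fix k l assume kl: "(k, l) \<in> r'"
  have I: "k \<in> I" "l \<in> I" using kl by (auto simp: r'_def)
  note B = base[OF I(1)] base[OF I(2)]
  have comp: "compose (carrier (dob LD k)) (b (base l)) (dar LD (k, l)) \<in> ban_hom R (dob LD k) (dob W (s (base l)))"
    by (rule compose_ban_hom[OF L.snm_D[OF I(1)] L.snm_D[OF I(2)] L.tr_hom[OF kl] b'[OF I(2)]])
  show "((s (base l), compose (carrier (dob LD k)) (b (base l)) (dar LD (k, l))), (s (base k), b (base k)))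
      \<in> colim_rel R (dob LD k) W"
  proof (cases "k = l")
    case True
    have "compose (carrier (dob LD k)) (b (base l)) (dar LD (k, l)) = b (base k)"
      by (rule ban_hom_eqI[OF comp b'[OF I(1)]]) (simp add: compose_eq True L.tr_id[OF I(2)])
    then show ?thesis using True D.colim_rel_refl[OF s_in[OF B(1)] b'[OF I(1)]] by simp
  next
    case False
    then have "below k l" using kl by (auto simp: r'_def)
    then have sr: "(s (base k), base l) \<in> r" by (simp add: below_def)
    show ?thesis
    proof (rule D.colim_relI[OF D.q_refl[OF s_in[OF B(2)]] D.q_trans[OF sr s[OF B(2)]] comp b'[OF I(1)]])
      fix x assume "x \<in> carrier (dob LD k)"
      then have x: "x \<in> carrier (LL (base k))" by (simp add: dob_LD)
      define y where "y = b (base k) x"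
      have y: "y \<in> carrier (dob W (s (base k)))" unfolding y_def by (rule ban_homD(2)[OF b[OF B(1)] x])
      have z: "dar W (s (base k), base l) y \<in> carrier (dob W (base l))" by (rule D.tr_closed[OF sr y])
      have "b (base l) (trL k l x) = dar W (base l, s (base l)) (dar W (s (base k), base l) y)"
        using ba[OF B(2) z] by (simp add: trL_below[OF \<open>below k l\<close> x] y_def)
      also have "\<dots> = dar W (s (base k), s (base l)) y" by (rule D.tr_tr[OF sr s[OF B(2)] y])
      finally have "b (base l) (trL k l x) = dar W (s (base k), s (base l)) y" .
      moreover have "dar W (s (base l), s (base l)) (b (base l) (trL k l x)) = b (base l) (trL k l x)"
        using ban_homD(2)[OF b[OF B(2)] ban_homD(2)[OF trL_hom[OF kl] x]]
        by (rule D.tr_id[OF s_in[OF B(2)]])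
      ultimately show "dar W (s (base l), s (base l)) (compose (carrier (dob LD k)) (b (base l)) (dar LD (k, l)) x)
          = dar W (s (base k), s (base l)) (b (base k) x)"
        using x by (simp add: compose_eq dob_LD dar_LD y_def)
    qed
  qed
qed

text \<open>The representatives \<open>a i\<close> and \<open>b (base k)\<close> compose to transition maps in both orders, which
  represent the identities of \<open>W\<close> and of \<open>L\<close>.\<close>

lemma W_iso_L: "\<exists>\<phi>. ind_iso R W LD \<phi>"
proof -
  interpret F: ind_morphism R I r W I r' LD idx0 a by (rule to_L)
  interpret G: ind_morphism R I r' LD I r W "\<lambda>k. s (base k)" "\<lambda>k. b (base k)" by (rule from_L)
  have "ind_comp R W W G.ind_mor F.ind_mor = ind_id R W"
    unfolding ind_comp_ind_mor[OF to_L from_L] D.ind_id_eq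
  proof (rule restrict_ext)
    fix i assume i: "i \<in> I"
    have bi: "base (idx0 i) = i" by (rule idx0(2)[OF i])
    show "D.germ (dob W i) (s (base (idx0 i))) (compose (carrier (dob W i)) (b (base (idx0 i))) (a i)) =
        D.germ (dob W i) i (\<lambda>x\<in>carrier (dob W i). x)"
      unfolding bi
    proof (rule D.germ_eqI, rule D.colim_relI[OF D.q_refl[OF s_in[OF i]] s[OF i]
          compose_ban_hom[OF D.snm_D[OF i] snm_LL[OF i] a[OF i] b[OF i]] id_hom[OF D.banach_mod_D[OF i]]])
      fix x assume x: "x \<in> carrier (dob W i)"
      show "dar W (s i, s i) (compose (carrier (dob W i)) (b i) (a i) x) =
          dar W (i, s i) ((\<lambda>x\<in>carrier (dob W i). x) x)"
        using x D.tr_id[OF s_in[OF i] D.tr_closed[OF s[OF i] x]] by (simp add: compose_eq ba[OF i x])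
    qed
  qed
  moreover have "ind_comp R LD LD F.ind_mor G.ind_mor = ind_id R LD"
    unfolding ind_comp_ind_mor[OF from_L to_L] L.ind_id_eq
  proof (rule restrict_ext)
    fix k assume k: "k \<in> I"
    note B = base[OF k]
    note sB = s_in[OF B]
    define j where "j = idx0 (s (base k))"
    have j: "j \<in> I" "base j = s (base k)" unfolding j_def using idx0[OF sB] by auto
    obtain m where m: "below j m" "below k m" using ex_above[OF j(1) k] by blast
    show "L.germ (dob LD k) (idx0 (s (base k))) (compose (carrier (dob LD k)) (a (s (base k))) (b (base k))) =
        L.germ (dob LD k) k (\<lambda>x\<in>carrier (dob LD k). x)"
      unfolding j_def[symmetric]
    proof (rule L.germ_eqI, rule L.colim_relI[OF r'_below[OF m(1)] r'_below[OF m(2)] _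
          id_hom[OF L.banach_mod_D[OF k]]])
      show "compose (carrier (dob LD k)) (a (s (base k))) (b (base k)) \<in> ban_hom R (dob LD k) (dob LD j)"
        unfolding dob_LD j(2) by (rule compose_ban_hom[OF snm_LL[OF B] D.snm_D[OF sB] b[OF B] a[OF sB]])
      fix x assume "x \<in> carrier (dob LD k)"
      then have x: "x \<in> carrier (LL (base k))" by (simp add: dob_LD)
      have y: "b (base k) x \<in> carrier (dob W (base j))" unfolding j(2) by (rule ban_homD(2)[OF b[OF B] x])
      have "trL j m (a (base j) (b (base k) x)) = trL k m x"
        using trL_a[OF j(1) m(1) y] trL_below[OF m(2) x] by (simp add: j(2))
      then show "dar LD (j, m) (compose (carrier (dob LD k)) (a (s (base k))) (b (base k)) x) =
          dar LD (k, m) ((\<lambda>x\<in>carrier (dob LD k). x) x)"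
        using x by (simp add: compose_eq dob_LD dar_LD j(2))
    qed
  qed
  ultimately have "ind_iso R W LD F.ind_mor"
    unfolding ind_iso_def using F.ind_mor_in_ind_hom G.ind_mor_in_ind_hom by blast
  then show ?thesis by blast
qed

lemma filtered_order:
  "filtered_category (idx LD)"
  unfolding filtered_category_def L.idx_D order_category_simps
proof (intro conjI ballI impI)
  show "is_category (order_category I r')" by (rule is_category_order[OF partial_order_r'])
  show "I \<noteq> {}" using infinite_I by auto
next
  fix k l assume "k \<in> I" "l \<in> I"
  then obtain m where "(k, m) \<in> r'" "(l, m) \<in> r'" using L.directed by blast
  then show "\<exists>f\<in>r'. \<exists>g\<in>r'. fst f = k \<and> fst g = l \<and> snd f = snd g"
    by (metis fst_conv snd_conv)
next
  fix f g assume f: "f \<in> r'" and "g \<in> r'" "fst f = fst g" "snd f = snd g"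
  have "(snd f, snd f) \<in> r'" using L.q_refl L.q_field[of "fst f" "snd f"] f by simp
  then show "\<exists>h\<in>r'. fst h = snd f \<and> (fst f, snd h) = (fst g, snd h)"
    using \<open>fst f = fst g\<close> by force
qed

end

section \<open>Nuclear ind-objects are colimits of products of weighted copies of the ring\<close>

theorem lemma4p18:
  fixes R :: "'a nring"
    and I :: "'i set" and r :: "'i rel"
    and W :: "('a, 'b, 'i, 'i \<times> 'i) diagram"
  assumes "banach_ring R"
    and "infinite I"
    and "partial_order_on I r"
    and "\<forall>i\<in>I. \<forall>j\<in>I. \<exists>k\<in>I. (i, k) \<in> r \<and> (j, k) \<in> r"
    and "idx W = order_category I r"
    and "banach_functor R W"
    and "nuclear_ind R W"
  shows "\<exists>(L :: ('a, nat \<Rightarrow> 'a, 'i, 'i \<times> 'i) diagram) \<phi>.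
    filtered_category (idx L) \<and>
    Ob (idx L) \<approx> I \<and> Arr (idx L) \<approx> r \<and>
    banach_functor R L \<and>
    ind_iso R W L \<phi> \<and>
    (\<forall>k\<in>Ob (idx L). \<exists>(S :: nat set) (c :: nat \<Rightarrow> real).
       (\<forall>s\<in>S. 0 < c s) \<and> dob L k = prod_le1 S (\<lambda>s. weighted_copy R (c s))) \<and>
    (\<forall>u\<in>Arr (idx L). u \<notin> ident (idx L) ` Ob (idx L) \<longrightarrow>
       nuclear_morphism R (dob L (src (idx L) u)) (dob L (tgt (idx L) u)) (dar L u))"
proof -
  interpret D: directed_diagram R I r W
    by unfold_locales (use assms in auto)
  \<comment> \<open>\<open>Q\<close> collects what is chosen for the index \<open>i\<close>: a nuclear transition map \<open>W\<^sub>i \<rightarrow> W\<^sub>s\<close> and its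
    factorization.\<close>
  define Q where "Q i s c a b \<longleftrightarrow> (i, s) \<in> r \<and> (\<forall>n. 0 < c n) \<and>
      a \<in> ban_hom R (dob W i) (weighted_product R UNIV c) \<and>
      (\<exists>\<phi> w. nuclear_series R (weighted_product R UNIV c) (dob W s) b \<phi> w) \<and>
      (\<forall>x\<in>carrier (dob W i). b (a x) = dar W (i, s) x)"
    for i s and c :: "nat \<Rightarrow> real" and a :: "'b \<Rightarrow> nat \<Rightarrow> 'a" and b :: "(nat \<Rightarrow> 'a) \<Rightarrow> 'b"
  have "\<exists>s c a b. Q i s c a b" if i: "i \<in> I" for i
  proof -
    obtain s \<phi> w where s: "(i, s) \<in> r" "nuclear_series R (dob W i) (dob W s) (dar W (i, s)) \<phi> w"
      using D.nuclear_ind_transition[OF assms(7) i] by blast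
    have "s \<in> I" using D.q_field[OF s(1)] by blast
    then obtain c :: "nat \<Rightarrow> real" and a b p where f: "\<forall>n. 0 < c n" "a \<in> ban_hom R (dob W i) (weighted_product R UNIV c)"
      "nuclear_series R (weighted_product R UNIV c) (dob W s) b p w"
      "dar W (i, s) = compose (carrier (dob W i)) b a"
      using nuclear_series_factor[OF D.banach_mod_D[OF i] D.banach_mod_D s(2)] by blast
    then have "Q i s c a b" unfolding Q_def using s(1) by (auto simp: compose_eq)
    then show ?thesis by blast
  qed
  then have "\<forall>i\<in>I. \<exists>s c a b. Q i s c a b" by blast
  then obtain s c a b where Q: "\<And>i. i \<in> I \<Longrightarrow> Q i (s i) (c i) (a i) (b i)" by metis
  obtain e where e: "bij_betw e I (I \<times> (UNIV :: nat set))"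
    using eqpoll_sym[OF infinite_times_nat_eqpoll[OF assms(2)]] unfolding eqpoll_def by blast
  interpret F: factored_diagram R I r W s c a b "\<lambda>k. fst (e k)" "\<lambda>k. snd (e k)"
    by unfold_locales (use Q assms(2) e in \<open>auto simp: Q_def\<close>)
  obtain \<phi> where phi: "ind_iso R W F.LD \<phi>" using F.W_iso_L by blast
  have nuc: "nuclear_morphism R (dob F.LD k) (dob F.LD l) (dar F.LD (k, l))"
    if "(k, l) \<in> F.r'" "k \<noteq> l" for k l
  proof -
    have kl: "F.below k l" using that by (simp add: F.r'_def)
    then have I: "k \<in> I" "l \<in> I" by (auto simp: F.below_def)
    obtain \<phi> w where "nuclear_series R (F.LL (fst (e k))) (F.LL (fst (e l))) (F.trL k l) \<phi> w"
      using F.trL_nuclear[OF kl] by blast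
    then show ?thesis
      using nuclear_pair.nuclear_series_imp_nuclear[OF nuclear_pairI[OF F.L.banach_mod_D[OF I(1)] F.L.banach_mod_D[OF I(2)]]]
      by (simp add: F.dob_LD F.dar_LD)
  qed
  show ?thesis
  proof (intro exI[of _ F.LD] exI[of _ \<phi>] conjI ballI impI)
    show "filtered_category (idx F.LD)" by (rule F.filtered_order)
    show "Ob (idx F.LD) \<approx> I" by (simp add: F.L.idx_D)
    show "Arr (idx F.LD) \<approx> r"
      using infinite_order_eqpoll[OF assms(2) F.partial_order_r']
        eqpoll_sym[OF infinite_order_eqpoll[OF assms(2,3)]] eqpoll_trans
      by (fastforce simp: F.L.idx_D)
    show "banach_functor R F.LD" by (rule F.functor_LD)
    show "ind_iso R W F.LD \<phi>" by (rule phi)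
  next
    fix k assume "k \<in> Ob (idx F.LD)"
    then have "k \<in> I" by (simp add: F.L.idx_D)
    then show "\<exists>(S :: nat set) d. (\<forall>s\<in>S. 0 < d s) \<and> dob F.LD k = prod_le1 S (\<lambda>s. weighted_copy R (d s))"
      using F.c[OF F.base] by (intro exI[of _ UNIV] exI[of _ "c (fst (e k))"]) (simp add: F.dob_LD)
  next
    fix u assume "u \<in> Arr (idx F.LD)" "u \<notin> ident (idx F.LD) ` Ob (idx F.LD)"
    then have "u \<in> F.r'" "fst u \<noteq> snd u"
      using F.L.q_field by (auto simp: F.L.idx_D image_iff prod_eq_iff)
        (metis F.L.q_field prod.collapse)+
    then show "nuclear_morphism R (dob F.LD (src (idx F.LD) u)) (dob F.LD (tgt (idx F.LD) u)) (dar F.LD u)"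
      using nuc[of "fst u" "snd u"] by (simp add: F.L.idx_D)
  qed
qed

end
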